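(* Let $T>0$. For any populated Feynman multi-index $\gamma\in\mathcal{M}^p_F$ and any $t\in[0,T]$, $$\Pi^{\mathfrak e}_t(\Phi(z^\gamma))=\Pi_t(z^\gamma),$$ where $\Pi^{\mathfrak e}_t$ is extended linearly to linear combinations of exotic coloured trees.
   Context: $\Theta$ is the Heaviside function with $\Theta(0)=0$. Feynman multi-indices: with $\mathbb N=\{0,1,2,\dots\}$ and $\mathbb N^2_\le=\{(k_1,k_2)\in\mathbb N^2:k_1\le k_2\}$, a Feynman multi-index $\gamma\in\mathcal{M}_F$ consists of finitely supported maps $\gamma_\alpha:\mathbb N\to\mathbb N$, $\gamma_\beta:\mathbb N^2_\le\to\mathbb N$, and $\gamma_\bullet:\mathbb N\to\{0,1\}$ with $\gamma_\bullet(n)=\mathbf 1_{n=m}$ for some fixed $m\in\mathbb N$; it is identified with the monomial $z^\gamma=\prod_{n,\mathbf k}z_{\alpha,n}^{\gamma_\alpha(n)}z_{\beta,\mathbf k}^{\gamma_\beta(\mathbf k)}z_{\bullet,n}^{\gamma_\bullet(n)}$. It is populated, $\gamma\in\mathcal{M}_F^p$, if $\sum_n\gamma_\alpha(n)+2\sum_{\mathbf k}\gamma_\beta(\mathbf k)=\sum_n n(\gamma_\alpha(n)+\gamma_\bullet(n))+\sum_{\mathbf k}(k_1+k_2)\gamma_\beta(\mathbf k)$. Its symmetry factor is $\sigma_F(z^\gamma):=\prod_n\gamma_\alpha(n)!\,(n!)^{\gamma_\alpha(n)+\gamma_\bullet(n)}\prod_{\mathbf k}\gamma_\beta(\mathbf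 k)!\,(k_1!k_2!)^{\gamma_\beta(\mathbf k)}\;2^{\sum_i\gamma_\beta(i,i)}$. Realization map on multi-indices: $\Pi_t(z^\gamma)$ is obtained by contracting in all possible ways fields $\psi$ with fields $\tilde\psi$ of different factors (a pair $(\psi_s,\tilde\psi_r)$ giving $\Theta(s-r)$) in the product of the root factor $\psi_t^m$ ($\gamma_\bullet(m)=1$), $\gamma_\alpha(n)$ factors $\int_0^T\tilde\psi_s\psi_s^n\,ds$ for each $n$, and $\gamma_\beta(\mathbf k)$ factors $\int_0^T\tilde\psi_s^2\psi_s^{k_1+k_2}\,ds$ for each $\mathbf k$, and setting $\psi=\tilde\psi=0$. Explicitly, enumerate the non-root factors as $i=1,\dots,N$, with factor $i$ equal to $y_i^{a_i}x_i^{b_i}$, $(a_i,b_i)=(1,n)$ or $(2,k_1+k_2)$; then $$\Pi_t(z^\gamma):=\int_{[0,T]^N}\Big[e^{D}\Big(x_0^{m}\prod_{i=1}^Ny_i^{a_i}x_i^{b_i}\Big)\Big]_{x=0,\,y=0}ds_1\cdots ds_N,\qquad D:=\sum_{0\le i\le N,\ 1\le j\le N,\ i\ne j}\Theta(s_i-s_j)\,\partial_{x_i}\partial_{y_j},\quad s_0:=t.$$ Exotic coloured trees: an exotic coloured tree $\tau$ is a finite non-planar rooted tree with edges oriented towards the root $\rho_\tau$; the root is uncoloured; every non-root vertex has a colour in $\{\alpha,\beta\}$; the set $\mathcal V_\beta(\tau)$ of $\beta$-coloured vertices has even cardinality and is equipped with an exotic decoration $\mathfrak e$, i.e. a partition of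 $\mathcal V_\beta(\tau)$ into pairs ($\mathfrak e(v)=\mathfrak e(w)$ iff $v,w$ are in the same pair; labels irrelevant). Paired vertices may be anywhere in the tree. $\mathcal V_\alpha(\tau)$ is the set of $\alpha$-coloured vertices; $\mathfrak n(v)$ is the number of incoming edges (children) of $v$. $\mathcal{T}^{\mathfrak e}_{\alpha,\beta}$ is the set of isomorphism classes of such trees (including the single root $\bullet$), and $|\tau|:=|\mathcal V_\alpha(\tau)|+\tfrac12|\mathcal V_\beta(\tau)|+1$. $\sigma_{\mathfrak e}(\tau)$ is the number of automorphisms of the rooted tree preserving the colours and the partition of $\mathcal V_\beta(\tau)$ into pairs (pairs may be permuted among themselves). Exotic realization map: $\Pi^{\mathfrak e}_t(\bullet)=1$ and, for $|\tau|>1$, $$\Pi^{\mathfrak e}_t(\tau)=\int\ \prod_{e:\,e_+=\rho_\tau}\Theta(t-t_{e_-})\prod_{e:\,e_+\ne\rho_\tau}\Theta(t_{e_+}-t_{e_-})\prod_{\{v,w\}:\,\mathfrak e(v)=\mathfrak e(w)}\delta(t_v-t_w)\prod_{v\neq\rho_\tau}dt_v,$$ where each edge $e=(e_+,e_-)$ points from $e_-$ towards $e_+$ and all variables range over $[0,T]$; the Dirac deltas mean that the variables of two paired $\beta$-vertices are identified, so the integral is over $[0,T]^{|\tau|-1}$. Counting map: $\Psi(\tau):=z_{\bullet,\mathfrak n(\rho_\tau)}\prod_{v\in\mathcal V_\alpha(\tau)}z_{\alpha,\mathfrak n(v)}\prod_{\{v_1,v_2\}}z_{\beta,(\mathfrak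 n(v_1),\mathfrak n(v_2))}$, the last product being over pairs of $\beta$-vertices with the same exotic decoration, ordered so that $\mathfrak n(v_1)\le\mathfrak n(v_2)$. Map $\Phi$: for $\gamma\in\mathcal M_F^p$, $\Phi(z^\gamma):=\sum_{\tau\in\mathcal{T}^{\mathfrak e}_{\alpha,\beta},\ \Psi(\tau)=z^\gamma}\frac{\sigma_F(z^\gamma)}{\sigma_{\mathfrak e}(\tau)}\,\tau$. *)

theory Defs
  imports
    "HOL-Analysis.Analysis"
    "HOL-Library.Poly_Mapping"
    "HOL-Library.Disjoint_Sets"
    "HOL-Combinatorics.Permutations"
begin

definition heaviside :: "real \<Rightarrow> real" where
  "heaviside x = (if x > 0 then 1 else 0)"

section \<open>Feynman multi-indices\<close>

text \<open>A multi-index is the exponent map of its monomial in the variables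
  \<open>z\<^sub>\<alpha>\<^sub>,\<^sub>n\<close>, \<open>z\<^sub>\<beta>\<^sub>,\<^sub>k\<close>, \<open>z\<^sub>\<bullet>\<^sub>,\<^sub>n\<close>. The variable \<open>ZBeta k1 k2\<close> is only allowed to occur when
  \<open>k1 \<le> k2\<close>; this is imposed in \<open>feynman_mi\<close>.\<close>

datatype zvar = ZAlpha nat | ZBeta nat nat | ZRoot nat

type_synonym multi_index = "zvar \<Rightarrow>\<^sub>0 nat"

abbreviation mi_alpha :: "multi_index \<Rightarrow> nat \<Rightarrow> nat" where
  "mi_alpha \<gamma> n \<equiv> Poly_Mapping.lookup \<gamma> (ZAlpha n)"

abbreviation mi_beta :: "multi_index \<Rightarrow> nat \<times> nat \<Rightarrow> nat" where
  "mi_beta \<gamma> k \<equiv> Poly_Mapping.lookup \<gamma> (ZBeta (fst k) (snd k))"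

abbreviation mi_root :: "multi_index \<Rightarrow> nat \<Rightarrow> nat" where
  "mi_root \<gamma> n \<equiv> Poly_Mapping.lookup \<gamma> (ZRoot n)"

definition feynman_mi :: "multi_index set" where
  "feynman_mi = {\<gamma>. (\<forall>k1 k2. mi_beta \<gamma> (k1, k2) \<noteq> 0 \<longrightarrow> k1 \<le> k2) \<and>
                    (\<exists>m. \<forall>n. mi_root \<gamma> n = (if n = m then 1 else 0))}"

text \<open>\<open>Sum_any\<close> and \<open>Prod_any\<close> range over a whole type; all families below are finitely
  supported.\<close>

definition populated_mi :: "multi_index set" where
  "populated_mi = {\<gamma> \<in> feynman_mi.
     Sum_any (\<lambda>n. mi_alpha \<gamma> n) + 2 * Sum_any (\<lambda>k. mi_beta \<gamma> k) =
     Sum_any (\<lambda>n. n * (mi_alpha \<gamma> n + mi_root \<gamma> n)) +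
     Sum_any (\<lambda>k. (fst k + snd k) * mi_beta \<gamma> k)}"

definition sigma_F :: "multi_index \<Rightarrow> nat" where
  "sigma_F \<gamma> =
     Prod_any (\<lambda>n. fact (mi_alpha \<gamma> n) * fact n ^ (mi_alpha \<gamma> n + mi_root \<gamma> n)) *
     Prod_any (\<lambda>k. fact (mi_beta \<gamma> k) * (fact (fst k) * fact (snd k)) ^ mi_beta \<gamma> k) *
     2 ^ Sum_any (\<lambda>i. mi_beta \<gamma> (i, i))"

section \<open>Multivariate polynomials in two families of variables\<close>

datatype 'i xyvar = X 'i | Y 'i

type_synonym 'i xypoly = "('i xyvar \<Rightarrow>\<^sub>0 nat) \<Rightarrow>\<^sub>0 real"

definition poly_const :: "real \<Rightarrow> 'i xypoly" where
  "poly_const c = Poly_Mapping.single 0 c"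

definition poly_var :: "'i xyvar \<Rightarrow> 'i xypoly" where
  "poly_var v = Poly_Mapping.single (Poly_Mapping.single v 1) 1"

definition poly_eval :: "('i xyvar \<Rightarrow> real) \<Rightarrow> 'i xypoly \<Rightarrow> real" where
  "poly_eval \<rho> p = (\<Sum>m\<in>Poly_Mapping.keys p.
     Poly_Mapping.lookup p m * (\<Prod>v\<in>Poly_Mapping.keys m. \<rho> v ^ Poly_Mapping.lookup m v))"

text \<open>The subtraction of exponents is truncated, but only when the coefficient vanishes.\<close>

definition pderiv_var :: "'i xyvar \<Rightarrow> 'i xypoly \<Rightarrow> 'i xypoly" where
  "pderiv_var v p =
     (\<Sum>m\<in>Poly_Mapping.keys p. Poly_Mapping.single (m - Poly_Mapping.single v 1)
        (real (Poly_Mapping.lookup m v) * Poly_Mapping.lookup p m))"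

text \<open>The exponential of a locally nilpotent operator: for each \<open>p\<close> only finitely many terms are
  nonzero.\<close>

definition exp_op :: "('i xypoly \<Rightarrow> 'i xypoly) \<Rightarrow> 'i xypoly \<Rightarrow> 'i xypoly" where
  "exp_op D p = Sum_any (\<lambda>k. poly_const (1 / fact k) * (D ^^ k) p)"

section \<open>Realization of multi-indices\<close>

text \<open>The factors of \<open>z\<^sup>\<gamma>\<close> are enumerated by the pairs \<open>(z, l)\<close>, standing for the \<open>l\<close>-th copy of the
  variable \<open>z\<close>. The unique root factor \<open>(ZRoot m, 0)\<close> plays the role of the index \<open>0\<close>, the other
  factors that of the indices \<open>1, \<dots>, N\<close>.\<close>

type_synonym factor = "zvar \<times> nat"

definition root_factor :: "multi_index \<Rightarrow> factor" where
  "root_factor \<gamma> = (ZRoot (THE m. mi_root \<gamma> m = 1), 0)"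

definition factors :: "multi_index \<Rightarrow> factor set" where
  "factors \<gamma> = {(z, l). l < Poly_Mapping.lookup \<gamma> z}"

definition inner_factors :: "multi_index \<Rightarrow> factor set" where
  "inner_factors \<gamma> = factors \<gamma> - {root_factor \<gamma>}"

fun y_exponent :: "zvar \<Rightarrow> nat" where
  "y_exponent (ZRoot m) = 0"
| "y_exponent (ZAlpha n) = 1"
| "y_exponent (ZBeta k1 k2) = 2"

fun x_exponent :: "zvar \<Rightarrow> nat" where
  "x_exponent (ZRoot m) = m"
| "x_exponent (ZAlpha n) = n"
| "x_exponent (ZBeta k1 k2) = k1 + k2"

definition factor_poly :: "multi_index \<Rightarrow> factor xypoly" where
  "factor_poly \<gamma> = (\<Prod>i\<in>factors \<gamma>.
     poly_var (Y i) ^ y_exponent (fst i) * poly_var (X i) ^ x_exponent (fst i))"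

definition contraction_op ::
    "multi_index \<Rightarrow> (factor \<Rightarrow> real) \<Rightarrow> factor xypoly \<Rightarrow> factor xypoly" where
  "contraction_op \<gamma> s p = (\<Sum>i\<in>factors \<gamma>. \<Sum>j\<in>inner_factors \<gamma> - {i}.
     poly_const (heaviside (s i - s j)) * pderiv_var (X i) (pderiv_var (Y j) p))"

definition Pi_mi :: "real \<Rightarrow> real \<Rightarrow> multi_index \<Rightarrow> real" where
  "Pi_mi T t \<gamma> =
     set_lebesgue_integral (\<Pi>\<^sub>M i\<in>inner_factors \<gamma>. lborel) (\<Pi>\<^sub>E i\<in>inner_factors \<gamma>. {0..T})
       (\<lambda>s. poly_eval (\<lambda>_. 0)
              (exp_op (contraction_op \<gamma> (s(root_factor \<gamma> := t))) (factor_poly \<gamma>)))"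

section \<open>Exotic coloured trees\<close>

datatype colour = Alpha | Beta

text \<open>An edge \<open>(v, w)\<close> points from \<open>v\<close> to its parent \<open>w\<close>. The value of \<open>vcol\<close> matters only at non-root
  vertices. Vertices are natural numbers; this loses nothing up to isomorphism.\<close>

record etree =
  verts :: "nat set"
  rootv :: nat
  edges :: "(nat \<times> nat) set"
  vcol :: "nat \<Rightarrow> colour"
  vpairs :: "nat set set"

definition alpha_verts :: "etree \<Rightarrow> nat set" where
  "alpha_verts \<tau> = {v \<in> verts \<tau> - {rootv \<tau>}. vcol \<tau> v = Alpha}"

definition beta_verts :: "etree \<Rightarrow> nat set" where
  "beta_verts \<tau> = {v \<in> verts \<tau> - {rootv \<tau>}. vcol \<tau> v = Beta}"

definition rooted_tree :: "nat set \<Rightarrow> nat \<Rightarrow> (nat \<times> nat) set \<Rightarrow> bool" where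
  "rooted_tree V r E \<longleftrightarrow> finite V \<and> r \<in> V \<and> E \<subseteq> V \<times> V \<and>
     (\<forall>w. (r, w) \<notin> E) \<and> (\<forall>v\<in>V - {r}. \<exists>!w. (v, w) \<in> E) \<and> (\<forall>v\<in>V. (v, r) \<in> E\<^sup>*)"

definition exotic_tree :: "etree \<Rightarrow> bool" where
  "exotic_tree \<tau> \<longleftrightarrow> rooted_tree (verts \<tau>) (rootv \<tau>) (edges \<tau>) \<and>
     partition_on (beta_verts \<tau>) (vpairs \<tau>) \<and> (\<forall>p\<in>vpairs \<tau>. card p = 2)"

definition is_etree_iso :: "(nat \<Rightarrow> nat) \<Rightarrow> etree \<Rightarrow> etree \<Rightarrow> bool" where
  "is_etree_iso f \<tau> \<tau>' \<longleftrightarrow>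
     bij_betw f (verts \<tau>) (verts \<tau>') \<and> f (rootv \<tau>) = rootv \<tau>' \<and>
     (\<forall>v\<in>verts \<tau>. \<forall>w\<in>verts \<tau>. (v, w) \<in> edges \<tau> \<longleftrightarrow> (f v, f w) \<in> edges \<tau>') \<and>
     (\<forall>v\<in>verts \<tau> - {rootv \<tau>}. vcol \<tau>' (f v) = vcol \<tau> v) \<and>
     (\<lambda>p. f ` p) ` vpairs \<tau> = vpairs \<tau>'"

definition etree_rel :: "(etree \<times> etree) set" where
  "etree_rel = {(\<tau>, \<tau>'). exotic_tree \<tau> \<and> exotic_tree \<tau>' \<and> (\<exists>f. is_etree_iso f \<tau> \<tau>')}"

definition etree_classes :: "etree set set" where
  "etree_classes = {\<tau>. exotic_tree \<tau>} // etree_rel"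

text \<open>The maps below are isomorphism invariant; on an isomorphism class they are
  evaluated at an arbitrary representative.\<close>

definition class_rep :: "etree set \<Rightarrow> etree" where
  "class_rep C = (SOME \<tau>. \<tau> \<in> C)"

definition sigma_e :: "etree \<Rightarrow> nat" where
  "sigma_e \<tau> = card {f. f permutes verts \<tau> \<and> is_etree_iso f \<tau> \<tau>}"

definition n_children :: "etree \<Rightarrow> nat \<Rightarrow> nat" where
  "n_children \<tau> v = card {u. (u, v) \<in> edges \<tau>}"

definition Psi :: "etree \<Rightarrow> multi_index" where
  "Psi \<tau> = Poly_Mapping.single (ZRoot (n_children \<tau> (rootv \<tau>))) 1 +
     (\<Sum>v\<in>alpha_verts \<tau>. Poly_Mapping.single (ZAlpha (n_children \<tau> v)) 1) +
     (\<Sum>p\<in>vpairs \<tau>. Poly_Mapping.single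
        (ZBeta (Min (n_children \<tau> ` p)) (Max (n_children \<tau> ` p))) 1)"

text \<open>The Dirac deltas identify the time variables of paired vertices, so there is one variable
  for each block: \<open>{v}\<close> for an \<open>\<alpha>\<close>-vertex \<open>v\<close>, and \<open>{v, w}\<close> for a pair of \<open>\<beta>\<close>-vertices.\<close>

definition time_blocks :: "etree \<Rightarrow> nat set set" where
  "time_blocks \<tau> = (\<lambda>v. {v}) ` alpha_verts \<tau> \<union> vpairs \<tau>"

definition vertex_time :: "etree \<Rightarrow> real \<Rightarrow> (nat set \<Rightarrow> real) \<Rightarrow> nat \<Rightarrow> real" where
  "vertex_time \<tau> t s v =
     (if v = rootv \<tau> then t else s (THE b. b \<in> time_blocks \<tau> \<and> v \<in> b))"

definition Pi_e :: "real \<Rightarrow> real \<Rightarrow> etree \<Rightarrow> real" where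
  "Pi_e T t \<tau> =
     (if verts \<tau> = {rootv \<tau>} then 1
      else set_lebesgue_integral (\<Pi>\<^sub>M b\<in>time_blocks \<tau>. lborel) (\<Pi>\<^sub>E b\<in>time_blocks \<tau>. {0..T})
        (\<lambda>s. \<Prod>(v, w)\<in>edges \<tau>. heaviside (vertex_time \<tau> t s w - vertex_time \<tau> t s v)))"

section \<open>Linear combinations of trees and the map \<open>\<Phi>\<close>\<close>

type_synonym etree_comb = "etree set \<Rightarrow>\<^sub>0 real"

definition Phi :: "multi_index \<Rightarrow> etree_comb" where
  "Phi \<gamma> = (\<Sum>C\<in>{C \<in> etree_classes. Psi (class_rep C) = \<gamma>}.
     Poly_Mapping.single C (real (sigma_F \<gamma>) / real (sigma_e (class_rep C))))"

definition Pi_e_lin :: "real \<Rightarrow> real \<Rightarrow> etree_comb \<Rightarrow> real" where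
  "Pi_e_lin T t x = (\<Sum>C\<in>Poly_Mapping.keys x. Poly_Mapping.lookup x C * Pi_e T t (class_rep C))"

end

theory Submission imports Defs begin

text \<open>
  Both sides are the same sum over ways to attach vertices to parents; they differ only in how it is
  organised.

  Give the multi-index one vertex for each variable \<open>y\<close> of its factors, that is one for a factor
  \<open>z\<^sub>\<alpha>\<^sub>,\<^sub>n\<close> and two for a factor \<open>z\<^sub>\<beta>\<^sub>,\<^sub>k\<close>, plus one for the root factor, and split the \<open>k\<^sub>1 + k\<^sub>2\<close>
  variables \<open>x\<close> of a \<open>\<beta>\<close>-factor between its two vertices (locale \<open>leg_system\<close>, where \<open>b w\<close> of the
  variables \<open>x\<close> belong to the vertex \<open>w\<close>). To contract in all possible ways means to assign to
  every non-root vertex \<open>v\<close> a variable \<open>x\<close> of some vertex, its parent \<open>p v\<close>; a parent map \<open>p\<close> whose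
  fibres have the cardinalities \<open>b\<close> arises from \<open>\<Prod>w. b w!\<close> contractions (\<open>wick\<close>). If \<open>p\<close> has a
  cycle, then the product of Heaviside functions vanishes, because the times would have to increase
  strictly along the cycle (\<open>edge_weight_cyclic\<close>). Otherwise \<open>p\<close> makes the vertices into an exotic
  tree \<open>parent_tree p\<close> whose image under the counting map is the multi-index, and its contribution is
  the exotic realization of that tree. Hence \<open>Pi_mi\<close> is \<open>\<Prod>w. b w!\<close> times the sum of the realizations
  of \<open>parent_tree p\<close> over all acyclic \<open>p\<close> (\<open>Pi_mi_eq_sum_parent_integrals\<close>).

  It remains to count the acyclic \<open>p\<close> for which \<open>parent_tree p\<close> is isomorphic to a given tree \<open>\<tau>\<close>. The
  bijections from \<open>\<tau>\<close> to the fixed vertex set that respect colours, pairs and numbers of children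
  are counted by \<open>\<Prod>n. \<gamma>\<^sub>\<alpha>(n)! \<Prod>k. \<gamma>\<^sub>\<beta>(k)! 2 ^ (\<Sum>i. \<gamma>\<^sub>\<beta>(i, i))\<close>: permute the factors of equal type, and exchange
  the two vertices of a pair when they have equally many children (\<open>card_block_isos\<close>). Each of them
  is an isomorphism from \<open>\<tau>\<close> to \<open>parent_tree p\<close> for exactly one \<open>p\<close>, and for each such \<open>p\<close> there are
  \<open>\<sigma>\<^sub>e(\<tau>)\<close> isomorphisms (\<open>card_etree_isos\<close>). So the number of \<open>p\<close> times \<open>\<sigma>\<^sub>e(\<tau>)\<close> times \<open>\<Prod>w. b w!\<close> is
  the symmetry factor of the multi-index: the terms of \<open>Pi_mi\<close> with a tree isomorphic to \<open>\<tau>\<close> add up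
  to the realization of \<open>\<tau>\<close> times its coefficient in \<open>Phi\<close>.
\<close>

section \<open>Wick's theorem for the contraction operator\<close>

lemma poly_eval_zero: "poly_eval (\<lambda>_. 0) p = Poly_Mapping.lookup p 0"
proof -
  have "(\<Prod>v\<in>Poly_Mapping.keys m. (0::real) ^ Poly_Mapping.lookup m v) = (if m = 0 then 1 else 0)"
    for m :: "'a xyvar \<Rightarrow>\<^sub>0 nat"
  proof (cases "m = 0")
    case False
    then obtain v where "v \<in> Poly_Mapping.keys m"
      by (metis keys_eq_empty ex_in_conv)
    then show ?thesis
      using False by (auto simp: prod_zero_iff in_keys_iff intro!: prod_zero bexI[of _ v])
  qed simp
  then have "poly_eval (\<lambda>_. 0) p =
      (\<Sum>m\<in>Poly_Mapping.keys p. if m = 0 then Poly_Mapping.lookup p m else 0)"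
    unfolding poly_eval_def by (intro sum.cong refl) simp
  then show ?thesis
    by (simp add: sum.delta in_keys_iff)
qed

lemma lookup_poly_const_mult:
  "Poly_Mapping.lookup (poly_const c * p) m = c * Poly_Mapping.lookup p m"
  by (simp add: poly_const_def mult_map_scale_conv_mult[symmetric] map.rep_eq when_def)

lemma poly_const_mult_single: "poly_const c * Poly_Mapping.single m a = Poly_Mapping.single m (c * a)"
  by (simp add: poly_const_def mult_single)

lemma pderiv_var_superset:
  assumes "finite A" "Poly_Mapping.keys p \<subseteq> A"
  shows "pderiv_var v p = (\<Sum>m\<in>A. Poly_Mapping.single (m - Poly_Mapping.single v 1)
           (real (Poly_Mapping.lookup m v) * Poly_Mapping.lookup p m))"
  unfolding pderiv_var_def
  by (rule sum.mono_neutral_left) (use assms in \<open>auto simp: in_keys_iff\<close>)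

lemma pderiv_var_add: "pderiv_var v (p + q) = pderiv_var v p + pderiv_var v q"
proof -
  let ?A = "Poly_Mapping.keys p \<union> Poly_Mapping.keys q"
  have "Poly_Mapping.keys (p + q) \<subseteq> ?A"
    by (rule keys_add)
  then show ?thesis
    by (simp add: pderiv_var_superset[of ?A] lookup_add distrib_left single_add
        sum.distrib)
qed

lemma pderiv_var_scale: "pderiv_var v (poly_const c * p) = poly_const c * pderiv_var v p"
proof -
  have "Poly_Mapping.keys (poly_const c * p) \<subseteq> Poly_Mapping.keys p"
    by (auto simp: in_keys_iff lookup_poly_const_mult)
  then show ?thesis
    by (simp add: pderiv_var_superset[of "Poly_Mapping.keys p"] lookup_poly_const_mult
        sum_distrib_left poly_const_mult_single mult.left_commute)
qed

lemma pderiv_var_single: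
  "pderiv_var v (Poly_Mapping.single m a) =
     Poly_Mapping.single (m - Poly_Mapping.single v 1) (real (Poly_Mapping.lookup m v) * a)"
  by (subst pderiv_var_superset[of "{m}"]) (auto split: if_splits)

text \<open>The contraction operator with arbitrary coefficients. Including the pairs with
  \<open>i = j\<close> does no harm as long as \<open>c i i = 0\<close>, and makes the sum over \<open>j\<close> independent of \<open>i\<close>.\<close>

definition pair_contraction ::
    "'i set \<Rightarrow> 'i set \<Rightarrow> ('i \<Rightarrow> 'i \<Rightarrow> real) \<Rightarrow> 'i xypoly \<Rightarrow> 'i xypoly" where
  "pair_contraction I J c p = (\<Sum>i\<in>I. \<Sum>j\<in>J.
     poly_const (c i j) * pderiv_var (X i) (pderiv_var (Y j) p))"

lemma pair_contraction_add:
  "pair_contraction I J c (p + q) = pair_contraction I J c p + pair_contraction I J c q"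
  by (simp add: pair_contraction_def pderiv_var_add distrib_left sum.distrib)

lemma pair_contraction_scale:
  "pair_contraction I J c (poly_const a * p) = poly_const a * pair_contraction I J c p"
  by (simp add: pair_contraction_def pderiv_var_scale sum_distrib_left mult.left_commute)

lemma pair_contraction_power_linear:
  "finite A \<Longrightarrow> (pair_contraction I J c ^^ k) (\<Sum>x\<in>A. poly_const (a x) * f x) =
     (\<Sum>x\<in>A. poly_const (a x) * (pair_contraction I J c ^^ k) (f x))"
proof (induction k)
  case (Suc k)
  have zero: "pair_contraction I J c 0 = 0"
    using pair_contraction_add[of I J c 0 0] by simp
  have "pair_contraction I J c (\<Sum>x\<in>A. g x) = (\<Sum>x\<in>A. pair_contraction I J c (g x))" for g
    using \<open>finite A\<close> by (induction A rule: finite_induct) (auto simp: pair_contraction_add zero)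
  with Suc show ?case
    by (simp add: pair_contraction_scale)
qed simp

text \<open>The monomial in which every \<open>v \<in> L\<close> contributes one variable \<open>y\<close> and every
  \<open>w \<in> W\<close> contributes \<open>b w\<close> variables \<open>x\<close>. The map \<open>\<phi>\<close> need not be injective: several vertices may
  share the variable of one factor. Keeping track of vertices instead of exponents turns
  contractions into maps \<open>L \<Rightarrow> W\<close>.\<close>

definition leg_exponents :: "('v \<Rightarrow> 'i) \<Rightarrow> 'v set \<Rightarrow> 'v set \<Rightarrow> ('v \<Rightarrow> nat) \<Rightarrow> 'i xyvar \<Rightarrow>\<^sub>0 nat" where
  "leg_exponents \<phi> W L b = (\<Sum>v\<in>L. Poly_Mapping.single (Y (\<phi> v)) 1) +
     (\<Sum>w\<in>W. Poly_Mapping.single (X (\<phi> w)) (b w))"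

definition parent_maps :: "'v set \<Rightarrow> 'v set \<Rightarrow> ('v \<Rightarrow> nat) \<Rightarrow> ('v \<Rightarrow> 'v) set" where
  "parent_maps W L b = {p \<in> L \<rightarrow>\<^sub>E W. \<forall>w\<in>W. card {v \<in> L. p v = w} = b w}"

lemma lookup_leg_exponents_Y:
  "finite L \<Longrightarrow> finite W \<Longrightarrow> 
   Poly_Mapping.lookup (leg_exponents \<phi> W L b) (Y j) = (\<Sum>v\<in>L. if \<phi> v = j then 1 else 0)"
  by (auto simp: leg_exponents_def lookup_add lookup_sum lookup_single when_def intro!: sum.cong)

lemma lookup_leg_exponents_X:
  "finite L \<Longrightarrow> finite W \<Longrightarrow> 
   Poly_Mapping.lookup (leg_exponents \<phi> W L b) (X i) = (\<Sum>w\<in>W. if \<phi> w = i then b w else 0)"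
  by (auto simp: leg_exponents_def lookup_add lookup_sum lookup_single when_def intro!: sum.cong)

text \<open>Differentiating by one \<open>y\<close> and one \<open>x\<close> removes the vertex \<open>v\<close> from the open
  ends and uses up one of the places below \<open>w\<close>, so it stays within monomials of this form.\<close>

lemma leg_exponents_contract:
  assumes "finite L" "finite W" "v \<in> L" "w \<in> W" "b w > 0"
  shows "leg_exponents \<phi> W L b - Poly_Mapping.single (Y (\<phi> v)) 1 - Poly_Mapping.single (X (\<phi> w)) 1 =
    leg_exponents \<phi> W (L - {v}) (b(w := b w - 1))"
proof -
  have "b w = 1 + (b w - 1)" using assms(5) by simp
  then have 1: "Poly_Mapping.single (X (\<phi> w)) (b w) =
      Poly_Mapping.single (X (\<phi> w)) 1 + Poly_Mapping.single (X (\<phi> w)) (b w - 1)"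
    by (metis single_add)
  have 2: "(\<Sum>u\<in>W. Poly_Mapping.single (X (\<phi> u)) (b u)) = Poly_Mapping.single (X (\<phi> w)) 1 +
      (\<Sum>u\<in>W. Poly_Mapping.single (X (\<phi> u)) ((b(w := b w - 1)) u))"
    using assms by (simp add: sum.remove[of W w] 1 add.assoc)
  have "leg_exponents \<phi> W L b = leg_exponents \<phi> W (L - {v}) (b(w := b w - 1)) +
     Poly_Mapping.single (X (\<phi> w)) 1 + Poly_Mapping.single (Y (\<phi> v)) 1"
    unfolding leg_exponents_def 2 using assms by (simp add: sum.remove[of L v] ac_simps)
  then show ?thesis by simp
qed

lemma sum_over_fibres:
  fixes g :: "'v \<Rightarrow> 'c::comm_semiring_1"
  assumes "finite I" "\<phi> ` W \<subseteq> I"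
  shows "(\<Sum>i\<in>I. F i * (\<Sum>w\<in>W. if \<phi> w = i then g w else 0)) = (\<Sum>w\<in>W. F (\<phi> w) * g w)"
proof -
  have "(\<Sum>i\<in>I. F i * (\<Sum>w\<in>W. if \<phi> w = i then g w else 0)) =
        (\<Sum>w\<in>W. \<Sum>i\<in>I. if i = \<phi> w then F i * g w else 0)"
    unfolding sum_distrib_left by (subst sum.swap) (auto intro!: sum.cong)
  also have "\<dots> = (\<Sum>w\<in>W. F (\<phi> w) * g w)"
    using assms by (intro sum.cong refl) (auto simp: sum.delta)
  finally show ?thesis .
qed

text \<open>The factor \<open>b w\<close> counts the variables \<open>x\<close> of \<open>w\<close> that can be chosen, and the
  multiplicities of the exponents of \<open>y\<^sub>j\<close> and \<open>x\<^sub>i\<close> become sums over the vertices above \<open>j\<close> and \<open>i\<close>.\<close>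

lemma pair_contraction_monomial:
  assumes fin: "finite L" "finite W" "finite I" "finite J" and sub: "\<phi> ` W \<subseteq> I" "\<phi> ` L \<subseteq> J"
  shows "pair_contraction I J c (Poly_Mapping.single (leg_exponents \<phi> W L b) 1) =
    (\<Sum>(v, w)\<in>L \<times> W. poly_const (c (\<phi> w) (\<phi> v) * real (b w)) *
       Poly_Mapping.single (leg_exponents \<phi> W (L - {v}) (b(w := b w - 1))) 1)"
proof -
  let ?m = "leg_exponents \<phi> W L b"
  let ?e = "\<lambda>i j. Poly_Mapping.single (?m - Poly_Mapping.single (Y j) 1 - Poly_Mapping.single (X i) 1) (1::real)"
  have lX: "Poly_Mapping.lookup (?m - Poly_Mapping.single (Y j) 1) (X i) =
      (\<Sum>w\<in>W. if \<phi> w = i then b w else 0)" for i j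
    using fin by (simp add: lookup_minus lookup_leg_exponents_X lookup_single)
  have rl: "real (\<Sum>w\<in>W. if \<phi> w = i then b w else 0) = (\<Sum>w\<in>W. if \<phi> w = i then real (b w) else 0)"
    "real (\<Sum>v\<in>L. if \<phi> v = j then 1 else 0) = (\<Sum>v\<in>L. if \<phi> v = j then 1 else 0)" for i j
    by (auto simp: of_nat_sum intro!: sum.cong)
  have pc: "poly_const (a * b') = poly_const a * poly_const b'" for a b' :: real
    by (simp add: poly_const_def mult_single)
  have pcs: "poly_const (\<Sum>x\<in>A. f x) = (\<Sum>x\<in>A. poly_const (f x))" for f :: "'x \<Rightarrow> real" and A
    unfolding poly_const_def by (induction A rule: infinite_finite_induct) (auto simp: single_add)
  have pc0: "poly_const 0 = 0" "poly_const 1 = 1"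
    by (simp_all add: poly_const_def)
  have "pair_contraction I J c (Poly_Mapping.single ?m 1) =
    (\<Sum>i\<in>I. \<Sum>j\<in>J. poly_const (c i j) * poly_const (\<Sum>w\<in>W. if \<phi> w = i then real (b w) else 0) *
       poly_const (\<Sum>v\<in>L. if \<phi> v = j then 1 else 0) * ?e i j)"
    unfolding pair_contraction_def pderiv_var_single lX
    using fin by (simp add: lookup_leg_exponents_Y poly_const_mult_single rl mult.assoc del: of_nat_sum)
  also have "\<dots> = (\<Sum>i\<in>I. \<Sum>j\<in>J. (poly_const (c i j) * (\<Sum>w\<in>W. if \<phi> w = i then poly_const (real (b w)) else 0) *
       ?e i j) * (\<Sum>v\<in>L. if \<phi> v = j then 1 else 0))"
    by (simp add: pcs pc0 if_distrib[of poly_const] mult_ac cong: if_cong)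
  also have "\<dots> = (\<Sum>i\<in>I. \<Sum>v\<in>L. (poly_const (c i (\<phi> v)) * (\<Sum>w\<in>W. if \<phi> w = i then poly_const (real (b w)) else 0) *
       ?e i (\<phi> v)))"
    using fin sub by (subst sum_over_fibres) auto
  also have "\<dots> = (\<Sum>v\<in>L. \<Sum>i\<in>I. (poly_const (c i (\<phi> v)) * 
       ?e i (\<phi> v)) * (\<Sum>w\<in>W. if \<phi> w = i then poly_const (real (b w)) else 0))"
    by (subst sum.swap) (simp add: mult_ac)
  also have "\<dots> = (\<Sum>v\<in>L. \<Sum>w\<in>W. poly_const (c (\<phi> w) (\<phi> v)) * ?e (\<phi> w) (\<phi> v) * poly_const (real (b w)))"
    using fin sub by (subst sum_over_fibres) auto
  also have "\<dots> = (\<Sum>v\<in>L. \<Sum>w\<in>W. poly_const (c (\<phi> w) (\<phi> v) * real (b w)) *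
       Poly_Mapping.single (leg_exponents \<phi> W (L - {v}) (b(w := b w - 1))) 1)"
  proof (intro sum.cong refl)
    fix v w assume "v \<in> L" "w \<in> W"
    then show "poly_const (c (\<phi> w) (\<phi> v)) * ?e (\<phi> w) (\<phi> v) * poly_const (real (b w)) =
      poly_const (c (\<phi> w) (\<phi> v) * real (b w)) *
       Poly_Mapping.single (leg_exponents \<phi> W (L - {v}) (b(w := b w - 1))) 1"
      using leg_exponents_contract[OF fin(1,2), of v w b \<phi>]
      by (cases "b w = 0") (auto simp: pc pc0 mult_ac)
  qed
  finally show ?thesis
    by (simp add: sum.cartesian_product)
qed

text \<open>A parent map is a choice of the parent \<open>w\<close> of \<open>v\<close>, which needs a free place at \<open>w\<close>,
  together with a parent map for the other vertices that respects the places that are left.\<close>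

lemma sum_parent_maps_remove:
  fixes g :: "'v \<Rightarrow> 'v \<Rightarrow> real"
  assumes fin: "finite L" "finite W" and v: "v \<in> L"
  shows "(\<Sum>w\<in>{w\<in>W. b w > 0}. g w v * (\<Sum>p\<in>parent_maps W (L - {v}) (b(w := b w - 1)). \<Prod>u\<in>L-{v}. g (p u) u))
    = (\<Sum>p\<in>parent_maps W L b. \<Prod>u\<in>L. g (p u) u)"
proof -
  have fibre: "{u \<in> L. p u = w} = (if p v = w then insert v {u \<in> L - {v}. p u = w} else {u \<in> L - {v}. p u = w})"
    for p :: "'v \<Rightarrow> 'v" and w
    using v by auto
  have cardf: "card {u \<in> L. p u = w} = (if p v = w then Suc (card {u \<in> L - {v}. p u = w}) else card {u \<in> L - {v}. p u = w})"
    for p :: "'v \<Rightarrow> 'v" and w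
    unfolding fibre using fin by auto
  have fibres: "card {u \<in> L - {v}. (p(v := x)) u = w} = card {u \<in> L - {v}. p u = w}" 
    for p :: "'v \<Rightarrow> 'v" and w x
    by (intro arg_cong[of _ _ card]) auto
  have mem: "p(v := w) \<in> parent_maps W L b"
    if "w \<in> W" "b w > 0" "p \<in> parent_maps W (L - {v}) (b(w := b w - 1))" for p w
  proof -
    have "card {u \<in> L. (p(v := w)) u = x} = b x" if "x \<in> W" for x
      using that \<open>b w > 0\<close> \<open>p \<in> _\<close> by (subst cardf, subst (1 2) fibres) (auto simp: parent_maps_def)
    then show ?thesis
      using that v unfolding parent_maps_def by (auto simp: PiE_iff extensional_def)
  qed
  have mem': "p v \<in> W" "b (p v) > 0" "p(v := undefined) \<in> parent_maps W (L - {v}) (b(p v := b (p v) - 1))"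
    if p: "p \<in> parent_maps W L b" for p
  proof -
    have c: "card {u \<in> L. p u = w} = b w" if "w \<in> W" for w
      using p that by (auto simp: parent_maps_def)
    show "p v \<in> W" using p v by (auto simp: parent_maps_def)
    then show "b (p v) > 0" using c[of "p v"] unfolding cardf by auto
    show "p(v := undefined) \<in> parent_maps W (L - {v}) (b(p v := b (p v) - 1))"
    proof -
      have "card {u \<in> L - {v}. (p(v := undefined)) u = w} = (b(p v := b (p v) - 1)) w"
        if "w \<in> W" for w
        using c[OF that] by (subst fibres) (auto simp: cardf split: if_splits)
      then show ?thesis
        using p unfolding parent_maps_def by (auto simp: PiE_iff extensional_def)
    qed
  qed
  have "(\<Sum>w\<in>{w\<in>W. b w > 0}. g w v * (\<Sum>p\<in>parent_maps W (L - {v}) (b(w := b w - 1)). \<Prod>u\<in>L-{v}. g (p u) u)) =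
    (\<Sum>(w, p)\<in>(SIGMA w:{w\<in>W. b w > 0}. parent_maps W (L - {v}) (b(w := b w - 1))). 
        g w v * (\<Prod>u\<in>L-{v}. g (p u) u))"
    unfolding sum_distrib_left
    by (rule sum.Sigma) (use fin in \<open>auto simp: parent_maps_def intro!: finite_subset[OF _ finite_PiE[of "L - {v}" "\<lambda>_. W"]]\<close>)
  also have "\<dots> = (\<Sum>p\<in>parent_maps W L b. \<Prod>u\<in>L. g (p u) u)"
  proof (rule sum.reindex_bij_witness[of _ "\<lambda>p. (p v, p(v := undefined))" "\<lambda>(w, p). p(v := w)"], goal_cases)
    case (1 a)
    then show ?case by (auto simp: parent_maps_def PiE_iff extensional_def)
  next
    case (2 a)
    then show ?case using mem by auto
  next
    case (3 p)
    then show ?case by auto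
  next
    case (4 p)
    then show ?case using mem' by auto
  next
    case (5 a)
    obtain w p where a: "a = (w, p)" by (cases a)
    show ?case
      using fin v unfolding a by (auto simp: prod.remove[of L v] intro!: prod.cong)
  qed
  finally show ?thesis .
qed

text \<open>Every application of the operator lowers the degree in the variables \<open>y\<close> by one, so only
  the power \<open>card L\<close> leaves a constant term. By induction, the first contraction may involve any of the
  \<open>card L\<close> vertices, and by \<open>sum_parent_maps_remove\<close> each of them leads to the same sum; this produces
  the factor \<open>fact k\<close>, which the exponential series cancels.\<close>

lemma wick_power:
  assumes fin: "finite W" "finite I" "finite J" and sub: "\<phi> ` W \<subseteq> I"
  shows "finite L \<Longrightarrow> \<phi> ` L \<subseteq> J \<Longrightarrow>
    Poly_Mapping.lookup ((pair_contraction I J c ^^ k) (Poly_Mapping.single (leg_exponents \<phi> W L b) 1)) 0 =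
    (if k = card L then fact k * (\<Prod>w\<in>W. fact (b w)) *
       (\<Sum>p\<in>parent_maps W L b. \<Prod>v\<in>L. c (\<phi> (p v)) (\<phi> v)) else 0)"
proof (induction k arbitrary: L b)
  case 0
  have Y: "leg_exponents \<phi> W L b \<noteq> 0" if "L \<noteq> {}"
  proof
    from that obtain v where "v \<in> L" by blast
    assume "leg_exponents \<phi> W L b = 0"
    then have "(\<Sum>u\<in>L. if \<phi> u = \<phi> v then 1 else 0) = (0::nat)"
      using lookup_leg_exponents_Y[OF 0(1) fin(1), of \<phi> b "\<phi> v"] by simp
    then show False using \<open>v \<in> L\<close> 0 by auto
  qed
  show ?case
  proof (cases "L = {}")
    case True
    have "leg_exponents \<phi> W {} b = 0 \<longleftrightarrow> (\<forall>w\<in>W. b w = 0)"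
    proof
      assume z: "leg_exponents \<phi> W {} b = 0"
      show "\<forall>w\<in>W. b w = 0"
      proof
        fix w assume "w \<in> W"
        have "(\<Sum>u\<in>W. if \<phi> u = \<phi> w then b u else 0) = (0::nat)"
          using z lookup_leg_exponents_X[of "{}" W \<phi> b "\<phi> w"] fin by simp
        then show "b w = 0" using \<open>w \<in> W\<close> fin by auto
      qed
    qed (auto simp: leg_exponents_def)
    moreover have "parent_maps W {} b = (if \<forall>w\<in>W. b w = 0 then {\<lambda>_. undefined} else {})"
      by (auto simp: parent_maps_def)
    ultimately show ?thesis
      using True by (auto simp: lookup_single when_def)
  next
    case False
    with Y 0 show ?thesis by (auto simp: lookup_single when_def)
  qed
next
  case (Suc k)
  let ?D = "pair_contraction I J c"
  let ?g = "\<lambda>w v. c (\<phi> w) (\<phi> v)"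
  let ?B = "\<Prod>w\<in>W. fact (b w) :: real"
  have fin2: "finite L" using Suc by simp
  have "(?D ^^ Suc k) (Poly_Mapping.single (leg_exponents \<phi> W L b) 1) =
     (\<Sum>x\<in>L \<times> W. poly_const (case x of (v, w) \<Rightarrow> c (\<phi> w) (\<phi> v) * real (b w)) *
       (?D ^^ k) (case x of (v, w) \<Rightarrow> Poly_Mapping.single (leg_exponents \<phi> W (L - {v}) (b(w := b w - 1))) 1))"
    unfolding funpow_Suc_right o_def
    using fin sub Suc.prems
    by (subst pair_contraction_monomial)
       (auto simp: split_def pair_contraction_power_linear)
  then have "Poly_Mapping.lookup ((?D ^^ Suc k) (Poly_Mapping.single (leg_exponents \<phi> W L b) 1)) 0 =
     (\<Sum>v\<in>L. \<Sum>w\<in>W. ?g w v * real (b w) * Poly_Mapping.lookup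
       ((?D ^^ k) (Poly_Mapping.single (leg_exponents \<phi> W (L - {v}) (b(w := b w - 1))) 1)) 0)"
    by (simp add: lookup_sum lookup_poly_const_mult sum.cartesian_product split_def)
  also have "\<dots> = (\<Sum>v\<in>L. if Suc k = card L then fact k * ?B *
       (\<Sum>p\<in>parent_maps W L b. \<Prod>v\<in>L. c (\<phi> (p v)) (\<phi> v)) else 0)"
  proof (intro sum.cong refl)
    fix v assume v: "v \<in> L"
    have cd: "card (L - {v}) = card L - 1" using v fin2 by auto
    have cpos: "card L > 0" using v fin2 by (auto simp: card_gt_0_iff)
    have IH: "Poly_Mapping.lookup ((?D ^^ k) (Poly_Mapping.single (leg_exponents \<phi> W (L - {v}) (b(w := b w - 1))) 1)) 0 =
      (if Suc k = card L then fact k * (\<Prod>u\<in>W. fact ((b(w := b w - 1)) u)) *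
        (\<Sum>p\<in>parent_maps W (L - {v}) (b(w := b w - 1)). \<Prod>v\<in>L - {v}. c (\<phi> (p v)) (\<phi> v)) else 0)" for w
      by (subst Suc.IH) (use Suc.prems cpos in \<open>auto simp: cd\<close>)
    have B: "real (b w) * (\<Prod>u\<in>W. fact ((b(w := b w - 1)) u)) = ?B" if "w \<in> W" "b w > 0" for w
    proof -
      have "real (b w) * fact (b w - 1) = fact (b w)" using that(2) by (metis fact_reduce)
      moreover have "(\<Prod>u\<in>W-{w}. fact ((b(w := b w - 1)) u)) = (\<Prod>u\<in>W-{w}. fact (b u) :: real)"
        by (intro prod.cong) auto
      ultimately show ?thesis using that fin by (simp add: prod.remove[of W w])
    qed
    show "(\<Sum>w\<in>W. ?g w v * real (b w) * Poly_Mapping.lookup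
       ((?D ^^ k) (Poly_Mapping.single (leg_exponents \<phi> W (L - {v}) (b(w := b w - 1))) 1)) 0) =
       (if Suc k = card L then fact k * ?B *
       (\<Sum>p\<in>parent_maps W L b. \<Prod>v\<in>L. c (\<phi> (p v)) (\<phi> v)) else 0)"
    proof (cases "Suc k = card L")
      case True
      have "(\<Sum>w\<in>W. ?g w v * real (b w) * Poly_Mapping.lookup
       ((?D ^^ k) (Poly_Mapping.single (leg_exponents \<phi> W (L - {v}) (b(w := b w - 1))) 1)) 0) =
       (\<Sum>w\<in>{w\<in>W. b w > 0}. ?g w v * (real (b w) * (\<Prod>u\<in>W. fact ((b(w := b w - 1)) u))) * fact k *
        (\<Sum>p\<in>parent_maps W (L - {v}) (b(w := b w - 1)). \<Prod>v\<in>L - {v}. c (\<phi> (p v)) (\<phi> v)))"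
        unfolding IH using True fin by (intro sum.mono_neutral_cong_right) (auto simp: mult_ac)
      also have "\<dots> = fact k * ?B * (\<Sum>w\<in>{w\<in>W. b w > 0}. ?g w v *
        (\<Sum>p\<in>parent_maps W (L - {v}) (b(w := b w - 1)). \<Prod>v\<in>L - {v}. c (\<phi> (p v)) (\<phi> v)))"
        unfolding sum_distrib_left[of "fact k * ?B"] by (intro sum.cong refl) (subst B, auto simp only: mult_ac mem_Collect_eq)
      also have "\<dots> = fact k * ?B * (\<Sum>p\<in>parent_maps W L b. \<Prod>v\<in>L. c (\<phi> (p v)) (\<phi> v))"
        using sum_parent_maps_remove[OF fin2 fin(1) v, where b = b and g = ?g] by simp
      finally show ?thesis using True by simp
    next
      case False
      then show ?thesis unfolding IH by simp
    qed
  qed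
  moreover have "fact (card L) = real (card L) * fact k" if "Suc k = card L"
    using that[symmetric] by simp
  ultimately show ?case
    by (simp add: mult_ac)
qed

text \<open>This makes the exponential series finite, as \<open>Sum_any\<close> requires.\<close>

lemma pair_contraction_nilpotent:
  assumes fin: "finite W" "finite I" "finite J" and sub: "\<phi> ` W \<subseteq> I"
  shows "finite L \<Longrightarrow> \<phi> ` L \<subseteq> J \<Longrightarrow> card L < k \<Longrightarrow>
    (pair_contraction I J c ^^ k) (Poly_Mapping.single (leg_exponents \<phi> W L b) 1) = 0"
proof (induction k arbitrary: L b)
  case (Suc k)
  have "(pair_contraction I J c ^^ k) (Poly_Mapping.single (leg_exponents \<phi> W (L - {v}) b') 1) = 0"
    if "v \<in> L" for v b'
  proof (rule Suc.IH)
    have "card (L - {v}) < card L"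
      using that Suc.prems(1) by (intro card_Diff1_less)
    then show "card (L - {v}) < k"
      using Suc.prems(3) by linarith
  qed (use Suc.prems in auto)
  then show ?case
    unfolding funpow_Suc_right o_def
    using fin sub Suc.prems
    by (subst pair_contraction_monomial)
       (auto simp: split_def pair_contraction_power_linear intro!: sum.neutral)
qed simp

text \<open>A parent map is counted \<open>\<Prod>w. b w!\<close> times: the vertices with parent \<open>w\<close> can be matched with
  the \<open>b w\<close> variables \<open>x\<close> of \<open>w\<close> in \<open>b w!\<close> ways.\<close>

lemma wick:
  assumes fin: "finite W" "finite L" "finite I" "finite J" and sub: "\<phi> ` W \<subseteq> I" "\<phi> ` L \<subseteq> J"
  shows "poly_eval (\<lambda>_. 0) (exp_op (pair_contraction I J c)
       (Poly_Mapping.single (leg_exponents \<phi> W L b) 1)) =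
    (\<Prod>w\<in>W. fact (b w)) * (\<Sum>p\<in>parent_maps W L b. \<Prod>v\<in>L. c (\<phi> (p v)) (\<phi> v))"
proof -
  let ?t = "\<lambda>k. (pair_contraction I J c ^^ k) (Poly_Mapping.single (leg_exponents \<phi> W L b) 1)"
  have "exp_op (pair_contraction I J c) (Poly_Mapping.single (leg_exponents \<phi> W L b) 1) =
     (\<Sum>k\<le>card L. poly_const (1 / fact k) * ?t k)"
    unfolding exp_op_def
  proof (rule Sum_any.expand_superset)
    show "{k. poly_const (1 / fact k) * ?t k \<noteq> 0} \<subseteq> {..card L}"
    proof
      fix k assume "k \<in> {k. poly_const (1 / fact k) * ?t k \<noteq> 0}"
      then have "?t k \<noteq> 0" by auto
      then show "k \<in> {..card L}"
        using pair_contraction_nilpotent[OF fin(1,3,4) sub(1) fin(2) sub(2), of k c b]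
        by (auto simp: not_le[symmetric])
    qed
  qed simp
  then show ?thesis
    using fin sub
    by (simp add: poly_eval_zero lookup_sum lookup_poly_const_mult wick_power if_distrib sum.delta
        cong: if_cong)
qed

section \<open>Integration over boxes and relabelling of coordinates\<close>

interpretation lborel_family: product_sigma_finite "\<lambda>_. lborel :: real measure"
  by standard

text \<open>Both measures agree on boxes, since a bijection only permutes the factors of the
  product of the lengths of the sides.\<close>

lemma distr_lborel_reindex:
  assumes fin: "finite K" and bij: "bij_betw h K I"
  shows "distr (\<Pi>\<^sub>M i\<in>I. lborel :: real measure) (\<Pi>\<^sub>M k\<in>K. lborel) (\<lambda>x. \<lambda>k\<in>K. x (h k)) =
    (\<Pi>\<^sub>M k\<in>K. lborel)"
proof (rule lborel_family.PiM_eqI[OF fin])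
  have finI: "finite I" using bij fin by (simp add: bij_betw_finite)
  have meas: "(\<lambda>x. \<lambda>k\<in>K. x (h k)) \<in> measurable (\<Pi>\<^sub>M i\<in>I. lborel :: real measure) (\<Pi>\<^sub>M k\<in>K. lborel)"
    using bij by (intro measurable_restrict measurable_component_singleton) (auto simp: bij_betw_def)
  fix A :: "'a \<Rightarrow> real set" assume A: "\<And>k. k \<in> K \<Longrightarrow> A k \<in> sets lborel"
  let ?g = "the_inv_into K h"
  have g: "?g (h k) = k" if "k \<in> K" for k
    using that bij by (auto simp: bij_betw_def the_inv_into_f_f)
  have gI: "?g i \<in> K" "h (?g i) = i" if "i \<in> I" for i
    using that bij by (auto simp: bij_betw_def the_inv_into_into f_the_inv_into_f)
  have hK: "h k \<in> I" if "k \<in> K" for k using that bij by (auto simp: bij_betw_def)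
  have pre: "(\<lambda>x. \<lambda>k\<in>K. x (h k)) -` Pi\<^sub>E K A \<inter> space (\<Pi>\<^sub>M i\<in>I. lborel :: real measure) =
      Pi\<^sub>E I (\<lambda>i. A (?g i))"
  proof (intro set_eqI iffI)
    fix x assume "x \<in> (\<lambda>x. \<lambda>k\<in>K. x (h k)) -` Pi\<^sub>E K A \<inter> space (\<Pi>\<^sub>M i\<in>I. lborel :: real measure)"
    then have "x \<in> extensional I" and x: "\<And>k. k \<in> K \<Longrightarrow> x (h k) \<in> A k"
      by (auto simp: space_PiM PiE_iff)
    moreover have "x i \<in> A (?g i)" if "i \<in> I" for i
      using x[OF gI(1)[OF that]] gI(2)[OF that] by simp
    ultimately show "x \<in> Pi\<^sub>E I (\<lambda>i. A (?g i))" by (auto simp: PiE_iff)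
  next
    fix x assume x: "x \<in> Pi\<^sub>E I (\<lambda>i. A (?g i))"
    have "x (h k) \<in> A k" if "k \<in> K" for k
      using PiE_mem[OF x hK[OF that]] g[OF that] by simp
    with x show "x \<in> (\<lambda>x. \<lambda>k\<in>K. x (h k)) -` Pi\<^sub>E K A \<inter> space (\<Pi>\<^sub>M i\<in>I. lborel :: real measure)"
      by (auto simp: space_PiM PiE_iff)
  qed
  have "emeasure (distr (\<Pi>\<^sub>M i\<in>I. lborel :: real measure) (\<Pi>\<^sub>M k\<in>K. lborel) (\<lambda>x. \<lambda>k\<in>K. x (h k))) (Pi\<^sub>E K A) =
    emeasure (\<Pi>\<^sub>M i\<in>I. lborel :: real measure) (Pi\<^sub>E I (\<lambda>i. A (?g i)))"
    using fin A by (subst emeasure_distr[OF meas]) (auto simp: pre intro!: sets_PiM_I_finite)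
  also have "\<dots> = (\<Prod>i\<in>I. emeasure lborel (A (?g i)))"
    using A gI finI by (subst lborel_family.emeasure_PiM) auto
  also have "\<dots> = (\<Prod>k\<in>K. emeasure lborel (A k))"
    using bij by (subst prod.reindex_bij_betw[OF bij, symmetric]) (auto simp: g)
  finally show "emeasure (distr (\<Pi>\<^sub>M i\<in>I. lborel :: real measure) (\<Pi>\<^sub>M k\<in>K. lborel) (\<lambda>x. \<lambda>k\<in>K. x (h k))) (Pi\<^sub>E K A) =
    (\<Prod>k\<in>K. emeasure lborel (A k))" .
qed simp

lemma box_integral_reindex:
  fixes g :: "('k \<Rightarrow> real) \<Rightarrow> real" and I :: "'i set"
  assumes fin: "finite K" and bij: "bij_betw h K I"
    and g: "g \<in> borel_measurable (\<Pi>\<^sub>M k\<in>K. lborel)"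
  shows "set_lebesgue_integral (\<Pi>\<^sub>M k\<in>K. lborel) (\<Pi>\<^sub>E k\<in>K. {0..T}) g =
    set_lebesgue_integral (\<Pi>\<^sub>M i\<in>I. lborel) (\<Pi>\<^sub>E i\<in>I. {0..T}) (\<lambda>x. g (\<lambda>k\<in>K. x (h k)))"
proof -
  have box: "(\<Pi>\<^sub>E k\<in>K. {0..T}) \<in> sets (\<Pi>\<^sub>M k\<in>K. lborel :: real measure)"
    using fin by (intro sets_PiM_I_finite) auto
  have meas: "(\<lambda>x. \<lambda>k\<in>K. x (h k)) \<in> measurable (\<Pi>\<^sub>M i\<in>I. lborel :: real measure) (\<Pi>\<^sub>M k\<in>K. lborel)"
    using bij by (intro measurable_restrict measurable_component_singleton) (auto simp: bij_betw_def)
  have ind: "indicator (\<Pi>\<^sub>E k\<in>K. {0..T}) (\<lambda>k\<in>K. x (h k)) = (indicator (\<Pi>\<^sub>E i\<in>I. {0..T}) x :: real)"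
    if "x \<in> space (\<Pi>\<^sub>M i\<in>I. lborel)" for x :: "'i \<Rightarrow> real"
  proof -
    have "(\<lambda>k\<in>K. x (h k)) \<in> (\<Pi>\<^sub>E k\<in>K. {0..T}) \<longleftrightarrow> (\<forall>i\<in>h ` K. x i \<in> {0..T})"
      by (auto simp: PiE_iff)
    also have "\<dots> \<longleftrightarrow> x \<in> (\<Pi>\<^sub>E i\<in>I. {0..T})"
      using that bij by (auto simp: bij_betw_def space_PiM PiE_iff)
    finally show ?thesis by (auto simp: indicator_def)
  qed
  have "set_lebesgue_integral (\<Pi>\<^sub>M k\<in>K. lborel) (\<Pi>\<^sub>E k\<in>K. {0..T}) g =
    (\<integral>x. indicator (\<Pi>\<^sub>E k\<in>K. {0..T}) x *\<^sub>R g x 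
       \<partial>distr (\<Pi>\<^sub>M i\<in>I. lborel :: real measure) (\<Pi>\<^sub>M k\<in>K. lborel) (\<lambda>x. \<lambda>k\<in>K. x (h k)))"
    by (simp add: distr_lborel_reindex[OF fin bij] set_lebesgue_integral_def)
  also have "\<dots> = (\<integral>x. indicator (\<Pi>\<^sub>E k\<in>K. {0..T}) (\<lambda>k\<in>K. x (h k)) *\<^sub>R g (\<lambda>k\<in>K. x (h k)) 
       \<partial>(\<Pi>\<^sub>M i\<in>I. lborel :: real measure))"
    using box g by (intro integral_distr[OF meas]) auto
  also have "\<dots> = set_lebesgue_integral (\<Pi>\<^sub>M i\<in>I. lborel) (\<Pi>\<^sub>E i\<in>I. {0..T}) (\<lambda>x. g (\<lambda>k\<in>K. x (h k)))"
    unfolding set_lebesgue_integral_def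
    by (intro Bochner_Integration.integral_cong refl) (simp only: ind)
  finally show ?thesis .
qed

text \<open>Needed to exchange the integral with the finite sum over parent maps.\<close>

lemma box_integrable:
  fixes f :: "('i \<Rightarrow> real) \<Rightarrow> real"
  assumes fin: "finite I" and f: "f \<in> borel_measurable (\<Pi>\<^sub>M i\<in>I. lborel)" and bound: "\<And>x. \<bar>f x\<bar> \<le> 1"
  shows "set_integrable (\<Pi>\<^sub>M i\<in>I. lborel) (\<Pi>\<^sub>E i\<in>I. {0..T}) f"
proof -
  let ?M = "\<Pi>\<^sub>M i\<in>I. (lborel :: real measure)"
  have box: "(\<Pi>\<^sub>E i\<in>I. {0..T}) \<in> sets ?M"
    using fin by (intro sets_PiM_I_finite) auto
  have "emeasure ?M (\<Pi>\<^sub>E i\<in>I. {0..T}) = (\<Prod>i\<in>I. emeasure lborel {0..T})"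
    using fin by (subst lborel_family.emeasure_PiM) auto
  also have "\<dots> < \<infinity>"
    by (cases "0 \<le> T") (auto simp: less_top[symmetric] ennreal_prod_eq_top power_eq_top_ennreal)
  finally have "integrable ?M (indicator (\<Pi>\<^sub>E i\<in>I. {0..T}) :: _ \<Rightarrow> real)"
    using box by (simp add: integrable_indicator_iff sets.Int_space_eq2)
  then show ?thesis
    unfolding set_integrable_def
    by (rule Bochner_Integration.integrable_bound)
       (use box f bound in \<open>auto simp: indicator_def abs_mult\<close>)
qed

lemma measurable_heaviside [measurable]: "heaviside \<in> borel_measurable borel"
  unfolding heaviside_def by measurable

lemma measurable_time:
  assumes "i \<in> insert \<rho> I"
  shows "(\<lambda>s. (s(\<rho> := t)) i) \<in> borel_measurable (\<Pi>\<^sub>M i\<in>I. (lborel :: real measure))"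
proof (cases "i = \<rho>")
  case False
  then have "i \<in> I" using assms by auto
  then have "(\<lambda>s. s i) \<in> measurable (\<Pi>\<^sub>M i\<in>I. (lborel :: real measure)) lborel"
    by (rule measurable_component_singleton)
  with False show ?thesis by simp
qed simp

text \<open>The time of a vertex \<open>v\<close> is \<open>s (q v)\<close>: vertices with the same image under \<open>q\<close> share
  their time variable, as the Dirac deltas demand.\<close>

definition edge_weight :: "('v \<times> 'v) set \<Rightarrow> ('v \<Rightarrow> 'i) \<Rightarrow> ('i \<Rightarrow> real) \<Rightarrow> real" where
  "edge_weight E q s = (\<Prod>(v, w)\<in>E. heaviside (s (q w) - s (q v)))"

lemma measurable_edge_weight:
  assumes "E \<subseteq> V \<times> V" "q ` V \<subseteq> insert \<rho> I"
  shows "(\<lambda>s. edge_weight E q (s(\<rho> := t))) \<in> borel_measurable (\<Pi>\<^sub>M i\<in>I. (lborel :: real measure))"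
  unfolding edge_weight_def split_def
proof (rule borel_measurable_prod)
  fix e assume "e \<in> E"
  then have "fst e \<in> V" "snd e \<in> V" using assms(1) by auto
  then have "q (fst e) \<in> insert \<rho> I" "q (snd e) \<in> insert \<rho> I"
    using assms(2) by blast+
  note [measurable] = this[THEN measurable_time, of t]
  show "(\<lambda>s. heaviside ((s(\<rho> := t)) (q (snd e)) - (s(\<rho> := t)) (q (fst e))))
      \<in> borel_measurable (\<Pi>\<^sub>M i\<in>I. (lborel :: real measure))"
    by measurable
qed

lemma abs_edge_weight_le: "\<bar>edge_weight E q s\<bar> \<le> 1"
  unfolding edge_weight_def abs_prod by (rule prod_le_1) (auto simp: heaviside_def)

section \<open>Time blocks of an exotic tree\<close>

lemma rooted_tree_parent:
  assumes "rooted_tree V r E"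
  obtains p where "p \<in> V - {r} \<rightarrow> V" "E = (\<lambda>v. (v, p v)) ` (V - {r})"
proof
  let ?p = "\<lambda>v. THE w. (v, w) \<in> E"
  have ex: "\<exists>!w. (v, w) \<in> E" if "v \<in> V - {r}" for v
    using assms that by (auto simp: rooted_tree_def)
  have p: "(v, ?p v) \<in> E" if "v \<in> V - {r}" for v
    using theI'[OF ex[OF that]] .
  have EV: "E \<subseteq> V \<times> V" and root: "(r, w) \<notin> E" for w
    using assms by (auto simp: rooted_tree_def)
  show "?p \<in> V - {r} \<rightarrow> V" using p EV by blast
  have "w = ?p v" "v \<in> V - {r}" if "(v, w) \<in> E" for v w
  proof -
    show v: "v \<in> V - {r}" using that EV root by auto
    show "w = ?p v" using ex[OF v] p[OF v] that by blast
  qed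
  note E = this
  show "E = (\<lambda>v. (v, ?p v)) ` (V - {r})"
  proof (intro set_eqI iffI)
    fix e assume "e \<in> E"
    then have e: "(fst e, snd e) \<in> E" by simp
    show "e \<in> (\<lambda>v. (v, ?p v)) ` (V - {r})"
      using E(1)[OF e] E(2)[OF e] by (intro image_eqI[of _ _ "fst e"]) (simp_all add: prod_eq_iff)
  next
    fix e assume "e \<in> (\<lambda>v. (v, ?p v)) ` (V - {r})"
    then show "e \<in> E" using p by blast
  qed
qed

text \<open>The root counts as a block of its own, so that blocks correspond to all factors
  of a multi-index, the root factor included.\<close>

definition vertex_blocks :: "etree \<Rightarrow> nat set set" where
  "vertex_blocks \<tau> = insert {rootv \<tau>} (time_blocks \<tau>)"

context
  fixes \<tau> assumes \<tau>: "exotic_tree \<tau>"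
begin

lemma etree_finite: "finite (verts \<tau>)" and etree_root: "rootv \<tau> \<in> verts \<tau>"
  and etree_edges: "edges \<tau> \<subseteq> verts \<tau> \<times> verts \<tau>" and etree_root_no_parent: "(rootv \<tau>, w) \<notin> edges \<tau>"
  using \<tau> by (auto simp: exotic_tree_def rooted_tree_def)

lemma partition_time_blocks: "partition_on (verts \<tau> - {rootv \<tau>}) (time_blocks \<tau>)"
proof -
  have b: "partition_on (beta_verts \<tau>) (vpairs \<tau>)"
    using \<tau> by (simp add: exotic_tree_def)
  have u: "verts \<tau> - {rootv \<tau>} = alpha_verts \<tau> \<union> beta_verts \<tau>"
    unfolding alpha_verts_def beta_verts_def using colour.exhaust by blast
  show ?thesis
  proof (rule partition_onI)
    show "\<Union>(time_blocks \<tau>) = verts \<tau> - {rootv \<tau>}"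
      using partition_onD1[OF b] by (auto simp: u time_blocks_def)
    show "{} \<notin> time_blocks \<tau>"
      using partition_onD3[OF b] by (auto simp: time_blocks_def)
    fix B C assume "B \<in> time_blocks \<tau>" "C \<in> time_blocks \<tau>" "B \<noteq> C"
    moreover have "v \<notin> B" if "v \<in> alpha_verts \<tau>" "B \<in> vpairs \<tau>" for v B
    proof
      assume "v \<in> B"
      then have "v \<in> beta_verts \<tau>" using that(2) partition_onD1[OF b] by blast
      with that(1) show False by (simp add: alpha_verts_def beta_verts_def)
    qed
    ultimately show "disjnt B C"
      using disjointD[OF partition_onD2[OF b], of B C] by (auto simp: time_blocks_def disjnt_def)
  qed
qed

lemma partition_vertex_blocks: "partition_on (verts \<tau>) (vertex_blocks \<tau>)"
proof -
  have "disjnt {rootv \<tau>} (\<Union>(time_blocks \<tau>))"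
    using partition_onD1[OF partition_time_blocks] by (auto simp: disjnt_def)
  from partition_on_insert[OF this, of "verts \<tau>"] show ?thesis
    using partition_time_blocks etree_root by (simp add: vertex_blocks_def)
qed

lemma finite_time_blocks: "finite (time_blocks \<tau>)"
  using partition_time_blocks etree_finite by (metis finite_Diff finite_elements)

text \<open>The realization only depends on the times of vertices, so its variables may be named by
  any map \<open>q\<close> that identifies exactly the vertices in a common block. For the tree with a single
  vertex the box is a point of measure one, in agreement with the value \<open>1\<close> of \<open>Pi_e\<close>.\<close>

lemma Pi_e_reindex:
  fixes q :: "nat \<Rightarrow> 'i"
  assumes root: "q (rootv \<tau>) = \<rho>" "\<rho> \<notin> I"
    and img: "q ` (verts \<tau> - {rootv \<tau>}) = I"
    and blocks: "\<And>B v w. B \<in> time_blocks \<tau> \<Longrightarrow> v \<in> B \<Longrightarrow> w \<in> verts \<tau> - {rootv \<tau>} \<Longrightarrow> q w = q v \<longleftrightarrow> w \<in> B"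
  shows "Pi_e T t \<tau> = set_lebesgue_integral (\<Pi>\<^sub>M i\<in>I. lborel) (\<Pi>\<^sub>E i\<in>I. {0..T})
     (\<lambda>s. edge_weight (edges \<tau>) q (s(\<rho> := t)))"
proof (cases "verts \<tau> = {rootv \<tau>}")
  case True
  then have "edges \<tau> = {}" "I = {}" using etree_edges etree_root_no_parent img by auto
  then show ?thesis using True
    by (simp add: Pi_e_def set_lebesgue_integral_def PiM_empty edge_weight_def lebesgue_integral_count_space_finite)
next
  case False
  let ?N = "verts \<tau> - {rootv \<tau>}"
  define h where "h B = q (SOME v. v \<in> B)" for B
  have part: "partition_on ?N (time_blocks \<tau>)" by (rule partition_time_blocks)
  have sub: "B \<subseteq> ?N" "B \<noteq> {}" if "B \<in> time_blocks \<tau>" for B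
    using part that by (auto simp: partition_on_def)
  have h: "h B = q v" if "B \<in> time_blocks \<tau>" "v \<in> B" for B v
  proof -
    have "(SOME v. v \<in> B) \<in> B" using that(2) by (rule someI)
    then show ?thesis using blocks[OF that(1) that(2)] sub(1)[OF that(1)] by (auto simp: h_def)
  qed
  have bij: "bij_betw h (time_blocks \<tau>) I"
    unfolding bij_betw_def
  proof (intro conjI inj_onI)
    fix B C assume BC: "B \<in> time_blocks \<tau>" "C \<in> time_blocks \<tau>" "h B = h C"
    obtain v w where vw: "v \<in> B" "w \<in> C"
      using sub(2)[OF BC(1)] sub(2)[OF BC(2)] by auto
    then have "q w = q v"
      using h[OF BC(1) vw(1)] h[OF BC(2) vw(2)] BC(3) by simp
    moreover have "w \<in> ?N" using vw(2) sub(1)[OF BC(2)] by blast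
    ultimately have "w \<in> B" using blocks[OF BC(1) vw(1)] by simp
    then show "B = C" using disjointD[OF partition_onD2[OF part] BC(1,2)] vw(2) by blast
  next
    have "h ` time_blocks \<tau> = q ` \<Union>(time_blocks \<tau>)"
    proof (intro set_eqI iffI)
      fix i assume "i \<in> h ` time_blocks \<tau>"
      then obtain B where B: "B \<in> time_blocks \<tau>" "i = h B" by auto
      then obtain v where "v \<in> B" using sub(2)[OF B(1)] by auto
      with B h[OF B(1) \<open>v \<in> B\<close>] show "i \<in> q ` \<Union>(time_blocks \<tau>)" by blast
    next
      fix i assume "i \<in> q ` \<Union>(time_blocks \<tau>)"
      then obtain v B where "i = q v" "v \<in> B" "B \<in> time_blocks \<tau>" by blast
      then show "i \<in> h ` time_blocks \<tau>" using h[of B v] by (intro image_eqI[of _ _ B]) simp_all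
    qed
    also have "\<Union>(time_blocks \<tau>) = ?N" using partition_onD1[OF part] by simp
    finally show "h ` time_blocks \<tau> = I" using img by simp
  qed
  have the_block: "(THE B. B \<in> time_blocks \<tau> \<and> v \<in> B) = B"
    if "B \<in> time_blocks \<tau>" "v \<in> B" for B v
  proof (rule the_equality)
    fix C assume "C \<in> time_blocks \<tau> \<and> v \<in> C"
    then show "C = B"
      using disjointD[OF partition_onD2[OF part], of C B] that by blast
  qed (use that in simp)
  have time: "vertex_time \<tau> t (\<lambda>B\<in>time_blocks \<tau>. x (h B)) v = (x(\<rho> := t)) (q v)"
    if "v \<in> verts \<tau>" for x v
  proof (cases "v = rootv \<tau>")
    case False
    then have v: "v \<in> ?N" using that by simp
    then obtain B where B: "B \<in> time_blocks \<tau>" "v \<in> B" using partition_onD1[OF part] by auto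
    note the_block[OF B]
    moreover have "q v \<in> I" using v img by blast
    then have "q v \<noteq> \<rho>" using root(2) by auto
    ultimately show ?thesis using False B h by (simp add: vertex_time_def)
  qed (simp add: vertex_time_def root)
  have tm: "(\<lambda>s. vertex_time \<tau> t s v) \<in> borel_measurable (\<Pi>\<^sub>M b\<in>time_blocks \<tau>. (lborel :: real measure))"
    if "v \<in> verts \<tau>" for v
  proof (cases "v = rootv \<tau>")
    case False
    then have v: "v \<in> ?N" using that by simp
    then obtain B where B: "B \<in> time_blocks \<tau>" "v \<in> B" using partition_onD1[OF part] by auto
    with the_block[OF B] show ?thesis
      using False measurable_time[of B undefined "time_blocks \<tau>"] 
        measurable_component_singleton[OF B(1), of "\<lambda>_. lborel :: real measure"]
      by (simp add: vertex_time_def)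
  qed (simp add: vertex_time_def)
  have meas: "(\<lambda>s. \<Prod>(v, w)\<in>edges \<tau>. heaviside (vertex_time \<tau> t s w - vertex_time \<tau> t s v))
      \<in> borel_measurable (\<Pi>\<^sub>M b\<in>time_blocks \<tau>. (lborel :: real measure))"
    unfolding split_def
  proof (rule borel_measurable_prod)
    fix e assume "e \<in> edges \<tau>"
    then have "fst e \<in> verts \<tau>" "snd e \<in> verts \<tau>" using etree_edges by auto
    note [measurable] = this[THEN tm]
    show "(\<lambda>s. heaviside (vertex_time \<tau> t s (snd e) - vertex_time \<tau> t s (fst e)))
      \<in> borel_measurable (\<Pi>\<^sub>M b\<in>time_blocks \<tau>. (lborel :: real measure))"
      by measurable
  qed
  have "(\<Prod>(v, w)\<in>edges \<tau>. heaviside (vertex_time \<tau> t (\<lambda>B\<in>time_blocks \<tau>. x (h B)) w -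
      vertex_time \<tau> t (\<lambda>B\<in>time_blocks \<tau>. x (h B)) v)) = edge_weight (edges \<tau>) q (x(\<rho> := t))" for x
    unfolding edge_weight_def
  proof (intro prod.cong refl)
    fix e assume "e \<in> edges \<tau>"
    then have "fst e \<in> verts \<tau>" "snd e \<in> verts \<tau>" using etree_edges by auto
    then show "(case e of (v, w) \<Rightarrow> heaviside (vertex_time \<tau> t (\<lambda>B\<in>time_blocks \<tau>. x (h B)) w -
      vertex_time \<tau> t (\<lambda>B\<in>time_blocks \<tau>. x (h B)) v)) =
      (case e of (v, w) \<Rightarrow> heaviside ((x(\<rho> := t)) (q w) - (x(\<rho> := t)) (q v)))"
      unfolding split_def by (simp only: time)
  qed
  then show ?thesis
    unfolding Pi_e_def if_not_P[OF False] box_integral_reindex[OF finite_time_blocks bij meas] by simp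
qed

end

section \<open>Counting label-preserving bijections between block systems\<close>

text \<open>A root, an \<open>\<alpha>\<close>-vertex and a pair of \<open>\<beta>\<close>-vertices are all treated as blocks of
  labelled vertices; what has to be counted are the bijections that preserve labels and map blocks
  onto blocks.\<close>

definition block_isos ::
    "('v \<Rightarrow> 'c) \<Rightarrow> ('w \<Rightarrow> 'c) \<Rightarrow> 'v set set \<Rightarrow> 'w set set \<Rightarrow> ('v \<Rightarrow> 'w) set" where
  "block_isos lab lab' P Q = {f \<in> extensional (\<Union>P). inj_on f (\<Union>P) \<and> (`) f ` P = Q \<and>
     (\<forall>v\<in>\<Union>P. lab' (f v) = lab v)}"

lemma block_isosI:
  assumes "f \<in> extensional (\<Union>P)" "inj_on f (\<Union>P)" "(`) f ` P = Q" "\<forall>v\<in>\<Union>P. lab' (f v) = lab v"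
  shows "f \<in> block_isos lab lab' P Q"
  unfolding block_isos_def mem_Collect_eq using assms by (intro conjI)

lemma finite_block_isos:
  assumes "finite (\<Union>P)" "finite (\<Union>Q)"
  shows "finite (block_isos lab lab' P Q)"
proof (rule finite_subset[OF _ finite_PiE[OF assms(1), of "\<lambda>_. \<Union>Q"]])
  show "block_isos lab lab' P Q \<subseteq> \<Union>P \<rightarrow>\<^sub>E \<Union>Q"
    unfolding block_isos_def PiE_def by blast
qed (use assms in auto)

text \<open>Such a bijection consists of the image \<open>q\<close> of the block \<open>a\<close>, its restriction to \<open>a\<close>,
  and its restriction to the remaining blocks.\<close>

lemma card_block_isos_insert:
  assumes fin: "finite (\<Union>(insert a P))" "finite (\<Union>Q)" "finite Q"
    and disjP: "a \<inter> \<Union>P = {}" and disjQ: "disjoint Q" and ne: "a \<noteq> {}"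
  shows "card (block_isos lab lab' (insert a P) Q) =
    (\<Sum>q\<in>Q. card (block_isos lab lab' {a} {q}) * card (block_isos lab lab' P (Q - {q})))"
proof -
  let ?S = "SIGMA q:Q. block_isos lab lab' {a} {q} \<times> block_isos lab lab' P (Q - {q})"
  let ?to = "\<lambda>f. (f ` a, restrict f a, restrict f (\<Union>P))"
  let ?from = "\<lambda>(q, g, h). \<lambda>v. if v \<in> a then g v else h v"
  have aP: "a \<notin> P" using disjP ne by auto
  have "bij_betw ?to (block_isos lab lab' (insert a P) Q) ?S"
  proof (rule bij_betw_byWitness[where f' = ?from])
    show "\<forall>f\<in>block_isos lab lab' (insert a P) Q. ?from (?to f) = f"
      by (auto simp: block_isos_def extensional_def fun_eq_iff)
    show "\<forall>x\<in>?S. ?to (?from x) = x"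
    proof
      fix x assume "x \<in> ?S"
      then obtain q g h where x: "x = (q, g, h)" "g \<in> block_isos lab lab' {a} {q}"
        "h \<in> block_isos lab lab' P (Q - {q})" by auto
      have "(\<lambda>v. if v \<in> a then g v else h v) ` a = q"
        using x(2) by (auto simp: block_isos_def)
      moreover have "restrict (\<lambda>v. if v \<in> a then g v else h v) a = g"
        using x(2) by (auto simp: block_isos_def extensional_def fun_eq_iff)
      moreover have "restrict (\<lambda>v. if v \<in> a then g v else h v) (\<Union>P) = h"
        using x(3) disjP by (auto simp: block_isos_def extensional_def fun_eq_iff)
      ultimately show "?to (?from x) = x" using x(1) by simp
    qed
    show "?to ` block_isos lab lab' (insert a P) Q \<subseteq> ?S"
    proof (rule image_subsetI)
      fix f assume f: "f \<in> block_isos lab lab' (insert a P) Q"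
      then have inj: "inj_on f (a \<union> \<Union>P)" and img: "insert (f ` a) ((`) f ` P) = Q"
        by (auto simp: block_isos_def)
      have "f ` a \<notin> (`) f ` P"
      proof
        assume "f ` a \<in> (`) f ` P"
        then obtain b where "b \<in> P" "f ` a = f ` b" by auto
        then have "a = b" using inj_on_image_eq_iff[OF inj, of a b] by blast
        with aP \<open>b \<in> P\<close> show False by simp
      qed
      then have imgP: "(`) f ` P = Q - {f ` a}" using img by blast
      have "(`) (restrict f (\<Union>P)) ` P = (`) f ` P"
        by (intro image_cong refl) auto
      then have imgR: "(`) (restrict f (\<Union>P)) ` P = Q - {f ` a}" using imgP by simp
      have lab: "lab' (f v) = lab v" if "v \<in> a \<union> \<Union>P" for v
        using f that by (simp add: block_isos_def)
      have restr: "inj_on (restrict f A) A" "\<forall>v\<in>A. lab' (restrict f A v) = lab v"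
        if A: "A \<subseteq> a \<union> \<Union>P" for A
        using inj_on_subset[OF inj A] lab[OF subsetD[OF A]] by (simp_all add: inj_on_def)
      have "restrict f (\<Union>P) \<in> block_isos lab lab' P (Q - {f ` a})"
        using imgR restr[of "\<Union>P"] by (intro block_isosI) simp_all
      moreover have "restrict f a \<in> block_isos lab lab' {a} {f ` a}"
        using restr[of a] by (intro block_isosI) simp_all
      ultimately show "?to f \<in> ?S" using img by auto
    qed
    show "?from ` ?S \<subseteq> block_isos lab lab' (insert a P) Q"
    proof (rule image_subsetI)
      fix x assume "x \<in> ?S"
      then obtain q g h where x: "x = (q, g, h)" "q \<in> Q" "g \<in> block_isos lab lab' {a} {q}"
        "h \<in> block_isos lab lab' P (Q - {q})" by auto
      define f where "f = (\<lambda>v. if v \<in> a then g v else h v)"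
      have fa: "f v = g v" if "v \<in> a" for v using that by (simp add: f_def)
      have fP: "f v = h v" if "v \<in> \<Union>P" for v using that disjP by (auto simp: f_def)
      have g: "g ` a = q" "inj_on g a" using x(3) by (auto simp: block_isos_def)
      have h: "(`) h ` P = Q - {q}" "inj_on h (\<Union>P)" using x(4) by (auto simp: block_isos_def)
      have hU: "h ` \<Union>P = \<Union>(Q - {q})" using h(1) by (metis image_Union)
      have "inj_on f a" using g(2) fa by (auto simp: inj_on_def)
      moreover have "inj_on f (\<Union>P)" using h(2) fP unfolding inj_on_def by metis
      moreover have "f ` a = q" using g(1) fa by auto
      moreover have fU: "f ` \<Union>P = \<Union>(Q - {q})" using hU fP by (metis image_cong)
      moreover have "q \<inter> \<Union>(Q - {q}) = {}" using disjQ x(2) by (auto simp: disjoint_def)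
      ultimately have "inj_on f (a \<union> \<Union>P)" by (auto simp: inj_on_Un)
      moreover have "(`) f ` P = Q - {q}"
        unfolding h(1)[symmetric] by (intro image_cong refl) (use fP in auto)
      moreover have "f \<in> extensional (a \<union> \<Union>P)"
        using x(3,4) by (auto simp: f_def block_isos_def extensional_def)
      moreover have "\<forall>v\<in>a \<union> \<Union>P. lab' (f v) = lab v"
      proof
        fix v assume v: "v \<in> a \<union> \<Union>P"
        have gl: "\<forall>v\<in>a. lab' (g v) = lab v" and hl: "\<forall>v\<in>\<Union>P. lab' (h v) = lab v"
          using x(3,4) by (simp_all add: block_isos_def)
        show "lab' (f v) = lab v"
        proof (cases "v \<in> a")
          case True
          then show ?thesis using gl fa by simp
        next
          case False
          then have "v \<in> \<Union>P" using v by simp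
          then show ?thesis using bspec[OF hl, of v] fP[of v] by metis
        qed
      qed
      moreover have "insert q (Q - {q}) = Q" using x(2) by auto
      ultimately have "f \<in> block_isos lab lab' (insert a P) Q"
        using \<open>f ` a = q\<close> by (simp add: block_isos_def)
      then show "?from x \<in> block_isos lab lab' (insert a P) Q" by (simp add: x(1) f_def)
    qed
  qed
  then have "card (block_isos lab lab' (insert a P) Q) = card ?S"
    by (rule bij_betw_same_card)
  also have "\<dots> = (\<Sum>q\<in>Q. card (block_isos lab lab' {a} {q} \<times> block_isos lab lab' P (Q - {q})))"
  proof (rule card_SigmaI[OF fin(3)], rule ballI)
    fix q assume q: "q \<in> Q"
    have "finite (\<Union>{q})" "finite (\<Union>(Q - {q}))"
      using finite_subset[OF _ fin(2), of "\<Union>{q}"] finite_subset[OF _ fin(2), of "\<Union>(Q - {q})"] q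
      by blast+
    moreover have "finite (\<Union>{a})" "finite (\<Union>P)" using fin(1) by simp_all
    ultimately show "finite (block_isos lab lab' {a} {q} \<times> block_isos lab lab' P (Q - {q}))"
      by (intro finite_cartesian_product finite_block_isos)
  qed
  finally show ?thesis by (simp add: card_cartesian_product)
qed

text \<open>The blocks of type \<open>z\<close> can be matched in \<open>m!\<close> ways if there are \<open>m\<close> of them on both
  sides, and each matched pair of blocks admits \<open>i z\<close> bijections.\<close>

lemma card_block_isos:
  assumes finP: "finite P" "finite (\<Union>P)" and disjP: "disjoint P" "{} \<notin> P"
    and finZ: "finite Z" and tyZ: "ty ` P \<subseteq> Z"
  shows "finite Q \<Longrightarrow> finite (\<Union>Q) \<Longrightarrow> disjoint Q \<Longrightarrow>
    (\<And>a q. a \<in> P \<Longrightarrow> q \<in> Q \<Longrightarrow>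
       card (block_isos lab lab' {a} {q}) = (if ty' q = ty a then i (ty a) else 0)) \<Longrightarrow>
    (\<And>z. card {q \<in> Q. ty' q = z} = card {a \<in> P. ty a = z}) \<Longrightarrow>
    card (block_isos lab lab' P Q) =
      (\<Prod>z\<in>Z. fact (card {a \<in> P. ty a = z}) * i z ^ card {a \<in> P. ty a = z})"
  using finP disjP tyZ
proof (induction P arbitrary: Q rule: finite_induct)
  case empty
  then have "{q \<in> Q. ty' q = z} = {}" for z by simp
  then have "Q = {}" by blast
  then have "block_isos lab lab' {} Q = {\<lambda>_. undefined}"
    by (auto simp: block_isos_def extensional_def)
  then show ?case by simp
next
  case (insert a P)
  let ?m = "\<lambda>z. card {b \<in> P. ty b = z}"
  let ?N = "\<Prod>z\<in>Z. fact (?m z) * i z ^ ?m z"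
  have count: "card {b \<in> insert a P. ty b = z} = (if ty a = z then Suc (?m z) else ?m z)" for z
  proof -
    have "{b \<in> insert a P. ty b = z} = (if ty a = z then insert a {b \<in> P. ty b = z} else {b \<in> P. ty b = z})"
      by auto
    then show ?thesis using insert.hyps by auto
  qed
  have rest: "card (block_isos lab lab' P (Q - {q})) = ?N" if q: "q \<in> Q" "ty' q = ty a" for q
  proof (rule insert.IH)
    fix z
    have "{r \<in> Q - {q}. ty' r = z} = {r \<in> Q. ty' r = z} - {q}" by auto
    then have "card {r \<in> Q - {q}. ty' r = z} =
        card {r \<in> Q. ty' r = z} - (if ty' q = z then 1 else 0)"
      using insert.prems(1) q(1) by (simp add: card_Diff_singleton_if)
    also have "\<dots> = ?m z"
      unfolding insert.prems(5)[of z] count q(2) by simp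
    finally show "card {r \<in> Q - {q}. ty' r = z} = ?m z" .
    show "finite (Q - {q})" using insert.prems(1) by simp
    show "finite (\<Union>(Q - {q}))" by (rule finite_subset[OF _ insert.prems(2)]) blast
    show "disjoint (Q - {q})" using insert.prems(3) by (auto simp: disjoint_def)
    show "finite (\<Union>P)" using insert.prems(6) by simp
    show "disjoint P" using insert.prems(7) by (auto simp: disjoint_def)
    show "{} \<notin> P" "ty ` P \<subseteq> Z" using insert.prems(8,9) by auto
    show "card (block_isos lab lab' {b} {r}) = (if ty' r = ty b then i (ty b) else 0)"
      if "b \<in> P" "r \<in> Q - {q}" for b r
      using insert.prems(4)[of b r] that by simp
  qed
  have "a \<inter> \<Union>P = {}"
  proof -
    have "a \<inter> b = {}" if "b \<in> P" for b
      using disjointD[OF insert.prems(7), of a b] that insert.hyps(2) by fastforce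
    then show ?thesis by blast
  qed
  have "a \<noteq> {}" using insert.prems(8) by auto
  have "card (block_isos lab lab' (insert a P) Q) =
     (\<Sum>q\<in>Q. card (block_isos lab lab' {a} {q}) * card (block_isos lab lab' P (Q - {q})))"
    by (rule card_block_isos_insert[OF insert.prems(6,2,1) \<open>a \<inter> \<Union>P = {}\<close> insert.prems(3) \<open>a \<noteq> {}\<close>])
  also have "\<dots> = (\<Sum>q\<in>{q \<in> Q. ty' q = ty a}. i (ty a) * ?N)"
  proof (rule sum.mono_neutral_cong_right)
    show "\<forall>q\<in>Q - {q \<in> Q. ty' q = ty a}.
        card (block_isos lab lab' {a} {q}) * card (block_isos lab lab' P (Q - {q})) = 0"
      using insert.prems(4)[of a] by simp
    show "card (block_isos lab lab' {a} {q}) * card (block_isos lab lab' P (Q - {q})) = i (ty a) * ?N"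
      if "q \<in> {q \<in> Q. ty' q = ty a}" for q
      using insert.prems(4)[of a q] rest[of q] that by simp
  qed (use insert.prems(1) in auto)
  also have "\<dots> = Suc (?m (ty a)) * (i (ty a) * ?N)"
    unfolding sum_constant insert.prems(5)[of "ty a"] count by simp
  also have "\<dots> = (\<Prod>z\<in>Z. fact (card {b \<in> insert a P. ty b = z}) * i z ^ card {b \<in> insert a P. ty b = z})"
  proof -
    have Z: "ty a \<in> Z" using insert.prems(9) by simp
    have "(\<Prod>z\<in>Z - {ty a}. fact (card {b \<in> insert a P. ty b = z}) * i z ^ card {b \<in> insert a P. ty b = z}) =
        (\<Prod>z\<in>Z - {ty a}. fact (?m z) * i z ^ ?m z)"
      unfolding count by (intro prod.cong refl) auto
    then show ?thesis
      unfolding prod.remove[OF finZ Z] count by (simp add: algebra_simps)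
  qed
  finally show ?case .
qed

text \<open>The variable of a multi-index that a block contributes. In a pair the vertices are
  labelled with \<open>ZBeta k k\<close> and \<open>ZBeta l l\<close>, where \<open>k\<close> and \<open>l\<close> are their numbers of children; in this way
  vertex labels need no type of their own.\<close>

inductive block_type :: "('v \<Rightarrow> zvar) \<Rightarrow> 'v set \<Rightarrow> zvar \<Rightarrow> bool" for lab where
  root: "lab v = ZRoot n \<Longrightarrow> block_type lab {v} (ZRoot n)"
| alpha: "lab v = ZAlpha n \<Longrightarrow> block_type lab {v} (ZAlpha n)"
| beta: "v \<noteq> w \<Longrightarrow> lab v = ZBeta k k \<Longrightarrow> lab w = ZBeta l l \<Longrightarrow> k \<le> l \<Longrightarrow>
    block_type lab {v, w} (ZBeta k l)"

text \<open>A pair of vertices can be exchanged only if both have the same number of children.\<close>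

fun self_isos :: "zvar \<Rightarrow> nat" where
  "self_isos (ZBeta k l) = (if k = l then 2 else 1)"
| "self_isos z = 1"

lemma block_isos_singleton:
  "block_isos lab lab' {{v}} {{v'}} = (if lab v = lab' v' then {\<lambda>x\<in>{v}. v'} else {})"
  by (auto simp: block_isos_def extensional_def fun_eq_iff)

lemma block_isos_pair:
  assumes "v \<noteq> w" "v' \<noteq> w'"
  shows "block_isos lab lab' {{v, w}} {{v', w'}} =
    (if lab v = lab' v' \<and> lab w = lab' w' then {(\<lambda>x\<in>{v, w}. if x = v then v' else w')} else {}) \<union>
    (if lab v = lab' w' \<and> lab w = lab' v' then {(\<lambda>x\<in>{v, w}. if x = v then w' else v')} else {})"
proof (rule set_eqI)
  have mem: "(\<lambda>x\<in>{v, w}. if x = v then x' else y') \<in> block_isos lab lab' {{v, w}} {{v', w'}}"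
    if "lab v = lab' x'" "lab w = lab' y'" "x' \<noteq> y'" "{x', y'} = {v', w'}" for x' y'
    using that assms(1) by (intro block_isosI) (auto simp: inj_on_def)
  fix f
  show "f \<in> block_isos lab lab' {{v, w}} {{v', w'}} \<longleftrightarrow>
    f \<in> (if lab v = lab' v' \<and> lab w = lab' w' then {(\<lambda>x\<in>{v, w}. if x = v then v' else w')} else {}) \<union>
    (if lab v = lab' w' \<and> lab w = lab' v' then {(\<lambda>x\<in>{v, w}. if x = v then w' else v')} else {})"
    (is "_ \<longleftrightarrow> f \<in> ?R")
  proof
    assume f: "f \<in> block_isos lab lab' {{v, w}} {{v', w'}}"
    then have ext: "f \<in> extensional {v, w}" and labs: "lab' (f v) = lab v" "lab' (f w) = lab w"
      and "{f v, f w} = {v', w'}"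
      by (simp_all add: block_isos_def)
    then consider "f v = v'" "f w = w'" | "f v = w'" "f w = v'"
      by (auto simp: doubleton_eq_iff)
    then show "f \<in> ?R"
    proof cases
      case 1
      have "f = (\<lambda>x\<in>{v, w}. if x = v then v' else w')"
        by (rule extensionalityI[OF ext]) (use 1 assms in auto)
      then show ?thesis using 1 labs by simp
    next
      case 2
      have "f = (\<lambda>x\<in>{v, w}. if x = v then w' else v')"
        by (rule extensionalityI[OF ext]) (use 2 assms in auto)
      then show ?thesis using 2 labs by simp
    qed
  next
    assume "f \<in> ?R"
    then consider
      "lab v = lab' v'" "lab w = lab' w'" "f = (\<lambda>x\<in>{v, w}. if x = v then v' else w')"
    | "lab v = lab' w'" "lab w = lab' v'" "f = (\<lambda>x\<in>{v, w}. if x = v then w' else v')"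
      unfolding Un_iff by (metis empty_iff singletonD)
    then show "f \<in> block_isos lab lab' {{v, w}} {{v', w'}}"
    proof cases
      case 1
      show ?thesis unfolding 1(3) by (rule mem) (use 1 assms in auto)
    next
      case 2
      show ?thesis unfolding 2(3) by (rule mem) (use 2 assms in auto)
    qed
  qed
qed

lemma block_isos_singleton_pair: "v \<noteq> w \<Longrightarrow> block_isos lab lab' {{u}} {{v, w}} = {}"
  by (auto simp: block_isos_def)

lemma block_isos_pair_singleton: "v \<noteq> w \<Longrightarrow> block_isos lab lab' {{v, w}} {{u}} = {}"
  by (auto simp: block_isos_def)

lemma card_block_isos_types:
  assumes "block_type lab a z" "block_type lab' q z'"
  shows "card (block_isos lab lab' {a} {q}) = (if z' = z then self_isos z else 0)"
proof -
  have ne: "(\<lambda>x\<in>{v, w}. if x = v then v' else w') \<noteq> (\<lambda>x\<in>{v, w}. if x = v then w' else v')"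
    if "v \<noteq> w" "v' \<noteq> w'" for v w :: 'a and v' w' :: 'b
    using that by (auto dest!: fun_cong[of _ _ v])
  show ?thesis
    using assms(1)
  proof cases
    case (root v n)
    from assms(2) show ?thesis
      by cases (use root in \<open>auto simp: block_isos_singleton block_isos_singleton_pair block_isos_pair_singleton\<close>)
  next
    case (alpha v n)
    from assms(2) show ?thesis
      by cases (use alpha in \<open>auto simp: block_isos_singleton block_isos_singleton_pair block_isos_pair_singleton\<close>)
  next
    case (beta v w k l)
    from assms(2) show ?thesis
    proof cases
      case (beta v' w' k' m)
      define F G where "F = (\<lambda>x\<in>{v, w}. if x = v then v' else w')"
        and "G = (\<lambda>x\<in>{v, w}. if x = v then w' else v')"
      have FG: "F \<noteq> G" unfolding F_def G_def by (rule ne) fact+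
      have "block_isos lab lab' {a} {q} =
        (if k = k' \<and> l = m then {F} else {}) \<union> (if k = m \<and> l = k' then {G} else {})"
        unfolding \<open>a = {v, w}\<close> \<open>q = {v', w'}\<close> F_def G_def block_isos_pair[OF \<open>v \<noteq> w\<close> \<open>v' \<noteq> w'\<close>]
        using \<open>lab v = _\<close> \<open>lab w = _\<close> \<open>lab' v' = _\<close> \<open>lab' w' = _\<close> by simp
      moreover have "k = m \<and> l = k' \<longleftrightarrow> k = l \<and> k' = k \<and> m = l"
        using \<open>k \<le> l\<close> \<open>k' \<le> m\<close> by auto
      ultimately show ?thesis
        unfolding \<open>z = _\<close> \<open>z' = _\<close> using FG by auto
    qed (use beta in \<open>auto simp: block_isos_singleton_pair block_isos_pair_singleton\<close>)
  qed
qed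

lemma block_type_unique:
  assumes "block_type lab a z" "block_type lab a z'"
  shows "z = z'"
proof (rule ccontr)
  assume "z \<noteq> z'"
  have id: "restrict id a \<in> block_isos lab lab {a} {a}"
    by (auto simp: block_isos_def inj_on_def)
  have "finite a" using assms(1) by cases auto
  then have "finite (block_isos lab lab {a} {a})" by (intro finite_block_isos) auto
  with id \<open>z \<noteq> z'\<close> card_block_isos_types[OF assms] show False by auto
qed

section \<open>The counting map in terms of labelled blocks\<close>

text \<open>The label records all that an isomorphism must preserve at a single vertex: whether it
  is the root, its colour and its number of children.\<close>

definition vertex_label :: "etree \<Rightarrow> nat \<Rightarrow> zvar" where
  "vertex_label \<tau> v =
     (if v = rootv \<tau> then ZRoot (n_children \<tau> v)
      else case vcol \<tau> v of Alpha \<Rightarrow> ZAlpha (n_children \<tau> v)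
                          | Beta \<Rightarrow> ZBeta (n_children \<tau> v) (n_children \<tau> v))"

definition the_block_type :: "('v \<Rightarrow> zvar) \<Rightarrow> 'v set \<Rightarrow> zvar" where
  "the_block_type lab a = (THE z. block_type lab a z)"

lemma the_block_type_eq: "block_type lab a z \<Longrightarrow> the_block_type lab a = z"
  unfolding the_block_type_def by (rule the_equality) (auto intro: block_type_unique)

text \<open>The counting map is a sum over blocks of a quantity that only depends on the labels in
  the block. Therefore it is invariant under label-preserving bijections of blocks, in particular
  under isomorphisms of trees.\<close>

lemma Psi_vertex_blocks:
  assumes \<tau>: "exotic_tree \<tau>"
  shows "\<And>a. a \<in> vertex_blocks \<tau> \<Longrightarrow> block_type (vertex_label \<tau>) a (the_block_type (vertex_label \<tau>) a)"
    and "Psi \<tau> = (\<Sum>a\<in>vertex_blocks \<tau>. Poly_Mapping.single (the_block_type (vertex_label \<tau>) a) 1)"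
proof -
  let ?lab = "vertex_label \<tau>"
  have root: "block_type ?lab {rootv \<tau>} (ZRoot (n_children \<tau> (rootv \<tau>)))"
    by (rule block_type.root) (simp add: vertex_label_def)
  have alpha: "block_type ?lab {v} (ZAlpha (n_children \<tau> v))" if "v \<in> alpha_verts \<tau>" for v
    by (rule block_type.alpha) (use that in \<open>simp add: vertex_label_def alpha_verts_def\<close>)
  have pt: "partition_on (beta_verts \<tau>) (vpairs \<tau>)" and two: "\<And>p. p \<in> vpairs \<tau> \<Longrightarrow> card p = 2"
    using \<tau> by (auto simp: exotic_tree_def)
  have bsub: "p \<subseteq> beta_verts \<tau>" if "p \<in> vpairs \<tau>" for p
    using partition_onD1[OF pt] that by blast
  have beta: "block_type ?lab p (ZBeta (Min (n_children \<tau> ` p)) (Max (n_children \<tau> ` p)))"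
    if pv: "p \<in> vpairs \<tau>" for p
  proof -
    obtain v w where p: "p = {v, w}" "v \<noteq> w" using two[OF pv] by (auto simp: card_2_iff)
    have lab: "?lab u = ZBeta (n_children \<tau> u) (n_children \<tau> u)" if "u \<in> {v, w}" for u
      using that bsub[OF pv] p(1) by (auto simp: vertex_label_def beta_verts_def)
    have "block_type ?lab {x, y} (ZBeta (n_children \<tau> x) (n_children \<tau> y))"
      if "x \<noteq> y" "x \<in> {v, w}" "y \<in> {v, w}" "n_children \<tau> x \<le> n_children \<tau> y" for x y
      using that lab by (intro block_type.beta) simp_all
    from this[of v w] this[of w v] p show ?thesis
      by (cases "n_children \<tau> v \<le> n_children \<tau> w") (simp_all add: insert_commute min_def max_def)
  qed
  show "block_type ?lab a (the_block_type ?lab a)" if "a \<in> vertex_blocks \<tau>" for a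
  proof -
    have "\<exists>z. block_type ?lab a z"
      using that root alpha beta unfolding vertex_blocks_def time_blocks_def by blast
    then show ?thesis using the_block_type_eq by metis
  qed
  have fin: "finite (alpha_verts \<tau>)" "finite (vpairs \<tau>)"
    using finite_time_blocks[OF \<tau>] etree_finite[OF \<tau>] by (simp_all add: time_blocks_def alpha_verts_def)
  have disj: "(\<lambda>v. {v}) ` alpha_verts \<tau> \<inter> vpairs \<tau> = {}"
    using two by fastforce
  have notin: "{rootv \<tau>} \<notin> time_blocks \<tau>"
    using partition_onD1[OF partition_time_blocks[OF \<tau>]] by blast
  let ?s = "\<lambda>a. Poly_Mapping.single (the_block_type ?lab a) (1::nat)"
  have "(\<Sum>a\<in>vertex_blocks \<tau>. ?s a) = ?s {rootv \<tau>} + (\<Sum>a\<in>time_blocks \<tau>. ?s a)"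
    unfolding vertex_blocks_def using notin finite_time_blocks[OF \<tau>] by simp
  also have "(\<Sum>a\<in>time_blocks \<tau>. ?s a) = (\<Sum>v\<in>alpha_verts \<tau>. ?s {v}) + (\<Sum>p\<in>vpairs \<tau>. ?s p)"
    unfolding time_blocks_def using fin disj
    by (subst sum.union_disjoint) (simp_all add: sum.reindex)
  finally show "Psi \<tau> = (\<Sum>a\<in>vertex_blocks \<tau>. ?s a)"
    unfolding Psi_def using the_block_type_eq[OF root] the_block_type_eq[OF alpha] the_block_type_eq[OF beta]
    by (simp add: add.assoc)
qed

lemma block_type_transfer:
  assumes "block_type lab a z" "inj_on f a" "\<And>v. v \<in> a \<Longrightarrow> lab' (f v) = lab v"
  shows "block_type lab' (f ` a) z"
  using assms(1)
proof cases
  case (root v n)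
  have "block_type lab' {f v} (ZRoot n)" by (rule block_type.root) (use root assms(3) in simp)
  then show ?thesis using root by simp
next
  case (alpha v n)
  have "block_type lab' {f v} (ZAlpha n)" by (rule block_type.alpha) (use alpha assms(3) in simp)
  then show ?thesis using alpha by simp
next
  case (beta v w k l)
  have "f v \<noteq> f w" using beta(1,3) inj_onD[OF assms(2), of v w] by auto
  then have "block_type lab' {f v, f w} (ZBeta k l)"
    by (rule block_type.beta) (use beta assms(3) in simp_all)
  then show ?thesis using beta by simp
qed

lemma sum_block_types_eq:
  assumes f: "f \<in> block_isos lab lab' P Q"
    and P: "\<And>a. a \<in> P \<Longrightarrow> block_type lab a (the_block_type lab a)"
  shows "(\<Sum>a\<in>P. g (the_block_type lab a)) = (\<Sum>q\<in>Q. g (the_block_type lab' q))"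
proof -
  have inj: "inj_on f (\<Union>P)" and img: "(`) f ` P = Q" and lab: "\<forall>v\<in>\<Union>P. lab' (f v) = lab v"
    using f by (simp_all add: block_isos_def)
  have bij: "bij_betw ((`) f) P Q"
    unfolding bij_betw_def using img inj_on_image[OF inj] by simp
  have "(\<Sum>a\<in>P. g (the_block_type lab a)) = (\<Sum>a\<in>P. g (the_block_type lab' (f ` a)))"
  proof (intro sum.cong refl)
    fix a assume a: "a \<in> P"
    have "inj_on f a" by (rule inj_on_subset[OF inj]) (use a in blast)
    with P[OF a] have "block_type lab' (f ` a) (the_block_type lab a)"
      by (rule block_type_transfer) (use a lab in blast)
    then show "g (the_block_type lab a) = g (the_block_type lab' (f ` a))"
      by (simp add: the_block_type_eq)
  qed
  also have "\<dots> = (\<Sum>q\<in>Q. g (the_block_type lab' q))"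
    by (rule sum.reindex_bij_betw[OF bij])
  finally show ?thesis .
qed

section \<open>Isomorphisms of exotic trees\<close>

lemma vpairs_subset: "exotic_tree \<tau> \<Longrightarrow> p \<in> vpairs \<tau> \<Longrightarrow> p \<subseteq> verts \<tau>"
  unfolding exotic_tree_def beta_verts_def using partition_onD1 by blast

lemma is_etree_iso_cong:
  assumes "exotic_tree \<tau>" "is_etree_iso f \<tau> \<tau>'" "\<And>v. v \<in> verts \<tau> \<Longrightarrow> g v = f v"
  shows "is_etree_iso g \<tau> \<tau>'"
proof -
  have "g ` p = f ` p" if "p \<in> vpairs \<tau>" for p
    using vpairs_subset[OF assms(1) that] assms(3) by (intro image_cong) auto
  then have "(`) g ` vpairs \<tau> = (`) f ` vpairs \<tau>" by (rule image_cong[OF refl])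
  moreover have "bij_betw g (verts \<tau>) (verts \<tau>') = bij_betw f (verts \<tau>) (verts \<tau>')"
    by (rule bij_betw_cong) (rule assms(3))
  ultimately show ?thesis
    using assms(2,3) etree_root[OF assms(1)] unfolding is_etree_iso_def by simp
qed

lemma is_etree_iso_id: "is_etree_iso id \<tau> \<tau>"
  by (simp add: is_etree_iso_def)

lemma is_etree_iso_comp:
  assumes "is_etree_iso f \<tau> \<tau>'" "is_etree_iso g \<tau>' \<tau>''" and \<tau>: "exotic_tree \<tau>"
  shows "is_etree_iso (g \<circ> f) \<tau> \<tau>''"
proof -
  have f: "bij_betw f (verts \<tau>) (verts \<tau>')" "f (rootv \<tau>) = rootv \<tau>'"
    "\<And>v w. v \<in> verts \<tau> \<Longrightarrow> w \<in> verts \<tau> \<Longrightarrow> (v, w) \<in> edges \<tau> \<longleftrightarrow> (f v, f w) \<in> edges \<tau>'"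
    "\<And>v. v \<in> verts \<tau> - {rootv \<tau>} \<Longrightarrow> vcol \<tau>' (f v) = vcol \<tau> v"
    "(`) f ` vpairs \<tau> = vpairs \<tau>'"
    using assms(1) unfolding is_etree_iso_def by auto
  have g: "bij_betw g (verts \<tau>') (verts \<tau>'')" "g (rootv \<tau>') = rootv \<tau>''"
    "\<And>v w. v \<in> verts \<tau>' \<Longrightarrow> w \<in> verts \<tau>' \<Longrightarrow> (v, w) \<in> edges \<tau>' \<longleftrightarrow> (g v, g w) \<in> edges \<tau>''"
    "\<And>v. v \<in> verts \<tau>' - {rootv \<tau>'} \<Longrightarrow> vcol \<tau>'' (g v) = vcol \<tau>' v"
    "(`) g ` vpairs \<tau>' = vpairs \<tau>''"
    using assms(2) unfolding is_etree_iso_def by auto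
  have fV: "f v \<in> verts \<tau>'" if "v \<in> verts \<tau>" for v using f(1) that by (rule bij_betwE[THEN bspec])
  have fr: "f v \<noteq> rootv \<tau>'" if "v \<in> verts \<tau> - {rootv \<tau>}" for v
    using that f(2) inj_onD[OF bij_betw_imp_inj_on[OF f(1)], of v "rootv \<tau>"] etree_root[OF \<tau>] by auto
  show ?thesis
    unfolding is_etree_iso_def
  proof (intro conjI ballI)
    show "bij_betw (g \<circ> f) (verts \<tau>) (verts \<tau>'')" by (rule bij_betw_trans[OF f(1) g(1)])
    show "(g \<circ> f) (rootv \<tau>) = rootv \<tau>''" by (simp add: f(2) g(2))
    show "(v, w) \<in> edges \<tau> \<longleftrightarrow> ((g \<circ> f) v, (g \<circ> f) w) \<in> edges \<tau>''"
      if "v \<in> verts \<tau>" "w \<in> verts \<tau>" for v w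
      using f(3)[OF that] g(3)[OF fV[OF that(1)] fV[OF that(2)]] by simp
    show "vcol \<tau>'' ((g \<circ> f) v) = vcol \<tau> v" if "v \<in> verts \<tau> - {rootv \<tau>}" for v
      using f(4)[OF that] g(4)[of "f v"] fr[OF that] fV[of v] that by simp
    show "(`) (g \<circ> f) ` vpairs \<tau> = vpairs \<tau>''"
      unfolding g(5)[symmetric] f(5)[symmetric] by (simp add: image_image image_comp)
  qed
qed

lemma is_etree_iso_inverse:
  assumes f: "is_etree_iso f \<tau> \<tau>'" and \<tau>: "exotic_tree \<tau>"
  shows "is_etree_iso (the_inv_into (verts \<tau>) f) \<tau>' \<tau>"
proof -
  let ?g = "the_inv_into (verts \<tau>) f"
  have bij: "bij_betw f (verts \<tau>) (verts \<tau>')"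
    using f by (simp add: is_etree_iso_def)
  note inj = bij_betw_imp_inj_on[OF bij]
  have gf: "?g (f v) = v" if "v \<in> verts \<tau>" for v
    using the_inv_into_f_f[OF inj that] .
  have fg: "f (?g v) = v" "?g v \<in> verts \<tau>" if "v \<in> verts \<tau>'" for v
    using f_the_inv_into_f_bij_betw[OF bij] that the_inv_into_into[OF inj, of v "verts \<tau>"] bij_betw_imp_surj_on[OF bij]
    by auto
  have root: "?g (rootv \<tau>') = rootv \<tau>"
    using gf[OF etree_root[OF \<tau>]] f by (simp add: is_etree_iso_def)
  have gpair: "?g ` f ` p = p" if "p \<in> vpairs \<tau>" for p
    unfolding image_image using vpairs_subset[OF \<tau> that] gf
    by (metis (no_types, lifting) image_cong image_ident subsetD)
  show ?thesis
    unfolding is_etree_iso_def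
  proof (intro conjI ballI)
    show "bij_betw ?g (verts \<tau>') (verts \<tau>)" by (rule bij_betw_the_inv_into[OF bij])
    show "?g (rootv \<tau>') = rootv \<tau>" by (rule root)
    show "(v, w) \<in> edges \<tau>' \<longleftrightarrow> (?g v, ?g w) \<in> edges \<tau>" if "v \<in> verts \<tau>'" "w \<in> verts \<tau>'" for v w
      using f fg[OF that(1)] fg[OF that(2)] unfolding is_etree_iso_def by auto
    show "vcol \<tau> (?g v) = vcol \<tau>' v" if "v \<in> verts \<tau>' - {rootv \<tau>'}" for v
    proof -
      have "?g v \<noteq> rootv \<tau>" using fg(1)[of v] that f by (auto simp: is_etree_iso_def)
      moreover have "?g v \<in> verts \<tau>" "f (?g v) = v" using fg that by auto
      ultimately show ?thesis using f unfolding is_etree_iso_def by (metis DiffI singletonD)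
    qed
    have "vpairs \<tau>' = (`) f ` vpairs \<tau>" using f by (simp add: is_etree_iso_def)
    then have "(`) ?g ` vpairs \<tau>' = (\<lambda>p. ?g ` f ` p) ` vpairs \<tau>"
      by (simp only: image_image[of "(`) ?g" "(`) f" "vpairs \<tau>"])
    also have "\<dots> = (\<lambda>p. p) ` vpairs \<tau>"
      by (intro image_cong refl gpair)
    finally show "(`) ?g ` vpairs \<tau>' = vpairs \<tau>" by simp
  qed
qed

lemma equiv_etree_rel: "equiv {\<tau>. exotic_tree \<tau>} etree_rel"
proof (rule equivI)
  show "etree_rel \<subseteq> {\<tau>. exotic_tree \<tau>} \<times> {\<tau>. exotic_tree \<tau>}"
    by (auto simp: etree_rel_def)
  show "refl_on {\<tau>. exotic_tree \<tau>} etree_rel"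
    using is_etree_iso_id by (auto simp: etree_rel_def refl_on_def)
  show "sym etree_rel"
    using is_etree_iso_inverse by (fastforce simp: etree_rel_def sym_def)
  show "trans etree_rel"
    unfolding trans_def etree_rel_def using is_etree_iso_comp by blast
qed

definition etree_isos :: "etree \<Rightarrow> etree \<Rightarrow> (nat \<Rightarrow> nat) set" where
  "etree_isos \<tau> \<tau>' = {f \<in> extensional (verts \<tau>). is_etree_iso f \<tau> \<tau>'}"

lemma etree_isos_nonempty:
  assumes "exotic_tree \<tau>"
  shows "etree_isos \<tau> \<tau>' \<noteq> {} \<longleftrightarrow> (\<exists>f. is_etree_iso f \<tau> \<tau>')"
proof
  assume "\<exists>f. is_etree_iso f \<tau> \<tau>'"
  then obtain f where "is_etree_iso f \<tau> \<tau>'" ..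
  then have "restrict f (verts \<tau>) \<in> etree_isos \<tau> \<tau>'"
    using is_etree_iso_cong[OF assms, of f \<tau>' "restrict f (verts \<tau>)"] by (simp add: etree_isos_def)
  then show "etree_isos \<tau> \<tau>' \<noteq> {}" by blast
qed (auto simp: etree_isos_def)

text \<open>If \<open>g\<close> is one isomorphism, then composition with \<open>g\<close> is a bijection from the automorphisms
  of \<open>\<tau>\<close> to all isomorphisms onto \<open>\<tau>'\<close>. Isomorphisms are taken to be extensional, and automorphisms
  are the identity outside the tree, so that in both cases equal restrictions mean equal maps.\<close>

lemma card_etree_isos:
  assumes \<tau>: "exotic_tree \<tau>" and \<tau>': "exotic_tree \<tau>'" and g: "is_etree_iso g \<tau> \<tau>'"
  shows "card (etree_isos \<tau> \<tau>') = sigma_e \<tau>"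
proof -
  let ?V = "verts \<tau>"
  let ?h = "the_inv_into ?V g"
  have h: "is_etree_iso ?h \<tau>' \<tau>" by (rule is_etree_iso_inverse[OF g \<tau>])
  have bij: "bij_betw g ?V (verts \<tau>')" using g by (simp add: is_etree_iso_def)
  have hg: "?h (g v) = v" if "v \<in> ?V" for v
    using the_inv_into_f_f[OF bij_betw_imp_inj_on[OF bij] that] .
  have gh: "g (?h v) = v" if "v \<in> verts \<tau>'" for v
    using f_the_inv_into_f_bij_betw[OF bij] that by auto
  have "bij_betw (\<lambda>a. restrict (g \<circ> a) ?V) {a. a permutes ?V \<and> is_etree_iso a \<tau> \<tau>} (etree_isos \<tau> \<tau>')"
  proof (rule bij_betw_byWitness[where f' = "\<lambda>f v. if v \<in> ?V then ?h (f v) else v"])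
    show "\<forall>a\<in>{a. a permutes ?V \<and> is_etree_iso a \<tau> \<tau>}.
        (\<lambda>v. if v \<in> ?V then ?h (restrict (g \<circ> a) ?V v) else v) = a"
    proof (intro ballI ext)
      fix a v assume "a \<in> {a. a permutes ?V \<and> is_etree_iso a \<tau> \<tau>}"
      then have "a permutes ?V" by simp
      then show "(if v \<in> ?V then ?h (restrict (g \<circ> a) ?V v) else v) = a v"
        using hg[of "a v"] permutes_in_image[of a ?V v] permutes_not_in[of a ?V v] by simp
    qed
    show "\<forall>f\<in>etree_isos \<tau> \<tau>'. restrict (g \<circ> (\<lambda>v. if v \<in> ?V then ?h (f v) else v)) ?V = f"
    proof
      fix f assume f: "f \<in> etree_isos \<tau> \<tau>'"
      then have ext: "f \<in> extensional ?V" and "bij_betw f ?V (verts \<tau>')"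
        by (simp_all add: etree_isos_def is_etree_iso_def)
      then have "f v \<in> verts \<tau>'" if "v \<in> ?V" for v using that by (auto simp: bij_betw_def)
      then show "restrict (g \<circ> (\<lambda>v. if v \<in> ?V then ?h (f v) else v)) ?V = f"
        by (intro extensionalityI[OF _ ext]) (simp_all add: gh)
    qed
    show "(\<lambda>a. restrict (g \<circ> a) ?V) ` {a. a permutes ?V \<and> is_etree_iso a \<tau> \<tau>} \<subseteq> etree_isos \<tau> \<tau>'"
    proof (rule image_subsetI)
      fix a assume "a \<in> {a. a permutes ?V \<and> is_etree_iso a \<tau> \<tau>}"
      then have "is_etree_iso (g \<circ> a) \<tau> \<tau>'" using is_etree_iso_comp[OF _ g \<tau>] by simp
      then show "restrict (g \<circ> a) ?V \<in> etree_isos \<tau> \<tau>'"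
        using is_etree_iso_cong[OF \<tau>, of "g \<circ> a" \<tau>' "restrict (g \<circ> a) ?V"]
        by (simp add: etree_isos_def)
    qed
    show "(\<lambda>f v. if v \<in> ?V then ?h (f v) else v) ` etree_isos \<tau> \<tau>' \<subseteq> {a. a permutes ?V \<and> is_etree_iso a \<tau> \<tau>}"
    proof (rule image_subsetI)
      fix f assume "f \<in> etree_isos \<tau> \<tau>'"
      then have "is_etree_iso (?h \<circ> f) \<tau> \<tau>"
        using is_etree_iso_comp[OF _ h \<tau>, of f] by (simp add: etree_isos_def)
      then have iso: "is_etree_iso (\<lambda>v. if v \<in> ?V then ?h (f v) else v) \<tau> \<tau>"
        by (rule is_etree_iso_cong[OF \<tau>]) simp
      then have "bij_betw (\<lambda>v. if v \<in> ?V then ?h (f v) else v) ?V ?V" by (simp add: is_etree_iso_def)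
      then have "(\<lambda>v. if v \<in> ?V then ?h (f v) else v) permutes ?V"
        by (rule bij_imp_permutes) simp
      with iso show "(\<lambda>v. if v \<in> ?V then ?h (f v) else v) \<in> {a. a permutes ?V \<and> is_etree_iso a \<tau> \<tau>}"
        by simp
    qed
  qed
  then show ?thesis
    unfolding sigma_e_def by (rule bij_betw_same_card[symmetric])
qed

lemma sigma_e_pos:
  assumes "exotic_tree \<tau>"
  shows "sigma_e \<tau> > 0"
proof -
  have "finite {f. f permutes verts \<tau> \<and> is_etree_iso f \<tau> \<tau>}"
    by (rule finite_subset[OF _ finite_permutations[OF etree_finite[OF assms]]]) auto
  moreover have "id \<in> {f. f permutes verts \<tau> \<and> is_etree_iso f \<tau> \<tau>}"
    using is_etree_iso_id permutes_id by simp
  ultimately show ?thesis unfolding sigma_e_def card_gt_0_iff by blast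
qed

lemma n_children_iso:
  assumes "exotic_tree \<tau>" "exotic_tree \<tau>'" "is_etree_iso f \<tau> \<tau>'" "v \<in> verts \<tau>"
  shows "n_children \<tau>' (f v) = n_children \<tau> v"
proof -
  have bij: "bij_betw f (verts \<tau>) (verts \<tau>')"
    and e: "\<And>v w. v \<in> verts \<tau> \<Longrightarrow> w \<in> verts \<tau> \<Longrightarrow> (v, w) \<in> edges \<tau> \<longleftrightarrow> (f v, f w) \<in> edges \<tau>'"
    using assms(3) by (simp_all add: is_etree_iso_def)
  have "f ` {u. (u, v) \<in> edges \<tau>} = {u. (u, f v) \<in> edges \<tau>'}"
  proof (intro set_eqI iffI)
    fix u assume "u \<in> f ` {u. (u, v) \<in> edges \<tau>}"
    then show "u \<in> {u. (u, f v) \<in> edges \<tau>'}" using e etree_edges[OF assms(1)] by auto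
  next
    fix u assume u: "u \<in> {u. (u, f v) \<in> edges \<tau>'}"
    then have "u \<in> verts \<tau>'" using etree_edges[OF assms(2)] by auto
    then obtain x where "x \<in> verts \<tau>" "u = f x" using bij by (auto simp: bij_betw_def)
    then show "u \<in> f ` {u. (u, v) \<in> edges \<tau>}" using u e assms(4) by auto
  qed
  moreover have "inj_on f {u. (u, v) \<in> edges \<tau>}"
    by (rule inj_on_subset[OF bij_betw_imp_inj_on[OF bij]]) (use etree_edges[OF assms(1)] in auto)
  ultimately show ?thesis
    unfolding n_children_def using card_image by fastforce
qed

lemma vertex_label_iso:
  assumes "exotic_tree \<tau>" "exotic_tree \<tau>'" "is_etree_iso f \<tau> \<tau>'" "v \<in> verts \<tau>"
  shows "vertex_label \<tau>' (f v) = vertex_label \<tau> v"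
proof -
  have "inj_on f (verts \<tau>)" using assms(3) by (simp add: is_etree_iso_def bij_betw_def)
  then have "f v = rootv \<tau>' \<longleftrightarrow> v = rootv \<tau>"
    using assms(3,4) etree_root[OF assms(1)] by (metis is_etree_iso_def inj_onD)
  moreover have "v \<noteq> rootv \<tau> \<Longrightarrow> vcol \<tau>' (f v) = vcol \<tau> v"
    using assms(3,4) by (simp add: is_etree_iso_def)
  ultimately show ?thesis
    unfolding vertex_label_def n_children_iso[OF assms] by auto
qed

lemma etree_isos_subset_block_isos:
  assumes \<tau>: "exotic_tree \<tau>" and \<tau>': "exotic_tree \<tau>'"
  shows "etree_isos \<tau> \<tau>' \<subseteq> block_isos (vertex_label \<tau>) (vertex_label \<tau>') (vertex_blocks \<tau>) (vertex_blocks \<tau>')"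
proof
  fix f assume "f \<in> etree_isos \<tau> \<tau>'"
  then have ext: "f \<in> extensional (verts \<tau>)" and iso: "is_etree_iso f \<tau> \<tau>'"
    by (simp_all add: etree_isos_def)
  have bij: "bij_betw f (verts \<tau>) (verts \<tau>')" and root: "f (rootv \<tau>) = rootv \<tau>'"
    and col: "\<And>v. v \<in> verts \<tau> - {rootv \<tau>} \<Longrightarrow> vcol \<tau>' (f v) = vcol \<tau> v"
    and pairs: "(`) f ` vpairs \<tau> = vpairs \<tau>'"
    using iso by (simp_all add: is_etree_iso_def)
  note inj = bij_betw_imp_inj_on[OF bij]
  have U: "\<Union>(vertex_blocks \<tau>) = verts \<tau>"
    using partition_onD1[OF partition_vertex_blocks[OF \<tau>]] by simp
  have fr: "f v = rootv \<tau>' \<longleftrightarrow> v = rootv \<tau>" if "v \<in> verts \<tau>" for v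
    using that root inj etree_root[OF \<tau>] by (metis inj_onD)
  have "f ` alpha_verts \<tau> = alpha_verts \<tau>'"
  proof (intro set_eqI iffI)
    fix u assume "u \<in> f ` alpha_verts \<tau>"
    then obtain v where v: "v \<in> verts \<tau>" "v \<noteq> rootv \<tau>" "vcol \<tau> v = Alpha" "u = f v"
      by (auto simp: alpha_verts_def)
    then show "u \<in> alpha_verts \<tau>'"
      using fr[OF v(1)] col[of v] bij_betwE[OF bij] by (simp add: alpha_verts_def)
  next
    fix u assume u: "u \<in> alpha_verts \<tau>'"
    then have "u \<in> f ` verts \<tau>" using bij by (simp add: alpha_verts_def bij_betw_def)
    then obtain v where v: "v \<in> verts \<tau>" "u = f v" by blast
    then show "u \<in> f ` alpha_verts \<tau>"
      using u fr[OF v(1)] col[of v] by (simp add: alpha_verts_def)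
  qed
  then have alpha: "(`) f ` (\<lambda>v. {v}) ` alpha_verts \<tau> = (\<lambda>v. {v}) ` alpha_verts \<tau>'"
    by (force simp: image_image)
  have "(`) f ` vertex_blocks \<tau> = vertex_blocks \<tau>'"
    unfolding vertex_blocks_def time_blocks_def image_insert image_Un alpha pairs using root by simp
  then show "f \<in> block_isos (vertex_label \<tau>) (vertex_label \<tau>') (vertex_blocks \<tau>) (vertex_blocks \<tau>')"
    using ext inj vertex_label_iso[OF \<tau> \<tau>' iso] by (intro block_isosI) (simp_all add: U)
qed

lemma Psi_iso:
  assumes "exotic_tree \<tau>" "exotic_tree \<tau>'" "is_etree_iso f \<tau> \<tau>'"
  shows "Psi \<tau>' = Psi \<tau>"
proof -
  obtain g where "g \<in> etree_isos \<tau> \<tau>'" using etree_isos_nonempty[OF assms(1)] assms(3) by blast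
  then have "g \<in> block_isos (vertex_label \<tau>) (vertex_label \<tau>') (vertex_blocks \<tau>) (vertex_blocks \<tau>')"
    using etree_isos_subset_block_isos[OF assms(1,2)] by blast
  from sum_block_types_eq[OF this Psi_vertex_blocks(1)[OF assms(1)], of "\<lambda>z. Poly_Mapping.single z 1"]
  show ?thesis
    unfolding Psi_vertex_blocks(2)[OF assms(1)] Psi_vertex_blocks(2)[OF assms(2)] by (rule sym)
qed

section \<open>Exotic trees on a fixed set of vertices\<close>

lemma root_factor_feynman:
  assumes "\<gamma> \<in> feynman_mi"
  obtains m where "root_factor \<gamma> = (ZRoot m, 0)"
    "\<And>n. Poly_Mapping.lookup \<gamma> (ZRoot n) = (if n = m then 1 else 0)"
proof -
  obtain m where m: "\<And>n. Poly_Mapping.lookup \<gamma> (ZRoot n) = (if n = m then 1 else 0)"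
    using assms by (auto simp: feynman_mi_def)
  have "(THE k. Poly_Mapping.lookup \<gamma> (ZRoot k) = 1) = m"
    by (rule the_equality) (auto simp: m split: if_splits)
  then show ?thesis using that m by (simp add: root_factor_def)
qed

lemma finite_factors: "finite (factors \<gamma>)"
proof -
  have "factors \<gamma> = (SIGMA z:Poly_Mapping.keys \<gamma>. {..<Poly_Mapping.lookup \<gamma> z})"
    by (auto simp: factors_def in_keys_iff)
  then show ?thesis by simp
qed

lemma root_in_factors: "\<gamma> \<in> feynman_mi \<Longrightarrow> root_factor \<gamma> \<in> factors \<gamma>"
  by (erule root_factor_feynman) (simp add: factors_def)

lemma factors_ZRoot: "\<gamma> \<in> feynman_mi \<Longrightarrow> (ZRoot n, l) \<in> factors \<gamma> \<Longrightarrow> (ZRoot n, l) = root_factor \<gamma>"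
  by (erule root_factor_feynman) (auto simp: factors_def split: if_splits)

lemma card_factors_of_type: "card {i \<in> factors \<gamma>. fst i = z} = Poly_Mapping.lookup \<gamma> z"
proof -
  have "{i \<in> factors \<gamma>. fst i = z} = {z} \<times> {..<Poly_Mapping.lookup \<gamma> z}"
    by (auto simp: factors_def)
  then show ?thesis by simp
qed

lemma sum_factors: "(\<Sum>i\<in>factors \<gamma>. Poly_Mapping.single (fst i) 1) = \<gamma>"
proof (rule poly_mapping_eqI)
  fix z
  have "Poly_Mapping.lookup (\<Sum>i\<in>factors \<gamma>. Poly_Mapping.single (fst i) 1) z =
    (\<Sum>i\<in>factors \<gamma>. if fst i = z then 1 else 0)"
    by (simp add: lookup_sum lookup_single when_def)
  also have "\<dots> = card {i \<in> factors \<gamma>. fst i = z}"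
    using finite_factors[of \<gamma>] by (simp add: sum.If_cases Collect_conj_eq Int_commute)
  finally show "Poly_Mapping.lookup (\<Sum>i\<in>factors \<gamma>. Poly_Mapping.single (fst i) 1) z = Poly_Mapping.lookup \<gamma> z"
    by (simp add: card_factors_of_type)
qed

text \<open>The label that a vertex must have in every tree with numbers of children \<open>b\<close>; unlike
  \<open>vertex_label\<close>, it does not refer to a particular tree.\<close>

definition leg_label :: "('v \<Rightarrow> factor) \<Rightarrow> ('v \<Rightarrow> nat) \<Rightarrow> 'v \<Rightarrow> zvar" where
  "leg_label \<phi> b w = (case fst (\<phi> w) of ZRoot _ \<Rightarrow> ZRoot (b w) | ZAlpha _ \<Rightarrow> ZAlpha (b w)
     | ZBeta _ _ \<Rightarrow> ZBeta (b w) (b w))"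

text \<open>A fixed set \<open>W\<close> of vertices for the trees of a multi-index. The map \<open>\<phi>\<close> sends a vertex to its
  factor and \<open>b\<close> gives the number of children that it must have. By \<open>types\<close>, a factor
  \<open>z\<^sub>\<alpha>\<^sub>,\<^sub>n\<close> has one vertex with \<open>b = n\<close>, a factor \<open>z\<^sub>\<beta>\<^sub>,\<^sub>k\<close> has two, with \<open>b = k\<^sub>1\<close> and \<open>b = k\<^sub>2\<close>, and the root factor
  has the vertex \<open>r\<close>. Vertices are natural numbers because those of an \<open>etree\<close> are.\<close>

locale leg_system =
  fixes \<gamma> :: multi_index and W :: "nat set" and \<phi> :: "nat \<Rightarrow> factor" and b :: "nat \<Rightarrow> nat" and r :: nat
  assumes feynman: "\<gamma> \<in> feynman_mi"
    and finW: "finite W" and rW: "r \<in> W"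
    and img: "\<phi> ` W = factors \<gamma>"
    and root_iff: "\<And>w. w \<in> W \<Longrightarrow> \<phi> w = root_factor \<gamma> \<longleftrightarrow> w = r"
    and types: "\<And>i. i \<in> factors \<gamma> \<Longrightarrow> block_type (leg_label \<phi> b) {w \<in> W. \<phi> w = i} (fst i)"
begin

definition legs :: "nat set" where "legs = W - {r}"

definition fibre :: "factor \<Rightarrow> nat set" where "fibre i = {w \<in> W. \<phi> w = i}"

definition parent_edges :: "(nat \<Rightarrow> nat) \<Rightarrow> (nat \<times> nat) set" where
  "parent_edges p = (\<lambda>v. (v, p v)) ` legs"

definition parent_tree :: "(nat \<Rightarrow> nat) \<Rightarrow> etree" where
  "parent_tree p = \<lparr>verts = W, rootv = r, edges = parent_edges p,
     vcol = (\<lambda>w. case fst (\<phi> w) of ZBeta _ _ \<Rightarrow> Beta | _ \<Rightarrow> Alpha),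
     vpairs = fibre ` {i \<in> factors \<gamma>. \<exists>k l. fst i = ZBeta k l}\<rparr>"

definition tree_parents :: "(nat \<Rightarrow> nat) set" where
  "tree_parents = {p \<in> parent_maps W legs b. \<forall>v\<in>W. (v, r) \<in> (parent_edges p)\<^sup>*}"

lemma fin_legs: "finite legs" using finW by (simp add: legs_def)

lemma phi_root: "\<phi> r = root_factor \<gamma>" using root_iff[OF rW] by simp

lemma phi_legs: "\<phi> ` legs = inner_factors \<gamma>"
proof -
  have "\<phi> ` legs = \<phi> ` W - {root_factor \<gamma>}"
  proof (intro set_eqI iffI)
    fix i assume "i \<in> \<phi> ` legs"
    then obtain v where "v \<in> W" "v \<noteq> r" "i = \<phi> v" by (auto simp: legs_def)
    then show "i \<in> \<phi> ` W - {root_factor \<gamma>}" using root_iff[of v] by simp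
  next
    fix i assume "i \<in> \<phi> ` W - {root_factor \<gamma>}"
    then obtain v where "v \<in> W" "i = \<phi> v" "\<phi> v \<noteq> root_factor \<gamma>" by auto
    then show "i \<in> \<phi> ` legs" using root_iff[of v] by (simp add: legs_def)
  qed
  then show ?thesis by (simp add: img inner_factors_def)
qed

lemma fibre_cases:
  assumes "i \<in> factors \<gamma>"
  obtains (root) "i = root_factor \<gamma>" "fst i = ZRoot (b r)" "fibre i = {r}"
  | (alpha) v n where "fst i = ZAlpha n" "fibre i = {v}" "b v = n" "v \<in> legs"
  | (beta) v w k l where "fst i = ZBeta k l" "fibre i = {v, w}" "v \<noteq> w" "b v = k" "b w = l"
      "v \<in> legs" "w \<in> legs"
proof -
  have phi: "\<phi> v = i" "v \<in> W" if "v \<in> fibre i" for v using that by (auto simp: fibre_def)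
  have leg: "v \<in> legs" if "v \<in> fibre i" "\<And>n. fst i \<noteq> ZRoot n" for v
  proof -
    have "v \<noteq> r"
    proof
      assume "v = r"
      then have "i = root_factor \<gamma>" using phi(1)[OF that(1)] phi_root by simp
      then show False using that(2) root_factor_feynman[OF feynman] by (metis fst_conv)
    qed
    then show ?thesis using phi(2)[OF that(1)] by (simp add: legs_def)
  qed
  have lab: "leg_label \<phi> b v = (case fst i of ZRoot _ \<Rightarrow> ZRoot (b v) | ZAlpha _ \<Rightarrow> ZAlpha (b v)
     | ZBeta _ _ \<Rightarrow> ZBeta (b v) (b v))" if "v \<in> fibre i" for v
    using phi(1)[OF that] by (simp add: leg_label_def)
  from types[OF assms] have "block_type (leg_label \<phi> b) (fibre i) (fst i)" by (simp add: fibre_def)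
  then show ?thesis
  proof cases
    case A: (root v n)
    then have i: "i = root_factor \<gamma>"
      using factors_ZRoot[OF feynman, of n "snd i"] assms by (metis prod.collapse)
    have "r \<in> fibre i" using rW phi_root i by (simp add: fibre_def)
    then have "v = r" using A(1) by simp
    then have "fst i = ZRoot (b r)" using A lab[of v] by simp
    then show ?thesis using A \<open>v = r\<close> i root by simp
  next
    case A: (alpha v n)
    then have "v \<in> legs" "b v = n" using leg[of v] lab[of v] by simp_all
    then show ?thesis using A alpha[of n v] by simp
  next
    case A: (beta v w k l)
    then have "v \<in> legs" "w \<in> legs" "b v = k" "b w = l"
      using leg[of v] leg[of w] lab[of v] lab[of w] by simp_all
    then show ?thesis using A beta[of k l v w] by simp
  qed
qed

lemma finite_parent_maps: "finite (parent_maps W legs b)"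
  unfolding parent_maps_def
  by (rule finite_subset[OF _ finite_PiE[OF fin_legs, of "\<lambda>_. W"]]) (use finW in auto)

lemma finite_tree_parents: "finite tree_parents"
  unfolding tree_parents_def using finite_parent_maps by simp

lemma parent_in_W: "p \<in> parent_maps W legs b \<Longrightarrow> v \<in> legs \<Longrightarrow> p v \<in> W"
  by (auto simp: parent_maps_def)

lemma parent_tree_sel [simp]:
  "verts (parent_tree p) = W" "rootv (parent_tree p) = r" "edges (parent_tree p) = parent_edges p"
  "vpairs (parent_tree p) = fibre ` {i \<in> factors \<gamma>. \<exists>k l. fst i = ZBeta k l}"
  "vcol (parent_tree p) w = (case fst (\<phi> w) of ZBeta _ _ \<Rightarrow> Beta | _ \<Rightarrow> Alpha)"
  by (simp_all add: parent_tree_def)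

lemma phi_leg_not_root: "v \<in> legs \<Longrightarrow> fst (\<phi> v) \<noteq> ZRoot n"
proof
  assume v: "v \<in> legs" and z: "fst (\<phi> v) = ZRoot n"
  have "\<phi> v \<in> factors \<gamma>" using v img by (auto simp: legs_def)
  then have "\<phi> v = root_factor \<gamma>"
    using factors_ZRoot[OF feynman, of n "snd (\<phi> v)"] z by (metis prod.collapse)
  then show False using root_iff[of v] v by (simp add: legs_def)
qed

lemma alpha_verts_parent_tree:
  "alpha_verts (parent_tree p) = {v \<in> legs. \<exists>n. fst (\<phi> v) = ZAlpha n}"
proof -
  have "(case fst (\<phi> v) of ZBeta _ _ \<Rightarrow> Beta | _ \<Rightarrow> Alpha) = Alpha \<longleftrightarrow> (\<exists>n. fst (\<phi> v) = ZAlpha n)"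
    if "v \<in> legs" for v
    using phi_leg_not_root[OF that] by (simp split: zvar.split)
  then show ?thesis by (auto simp: alpha_verts_def legs_def)
qed

lemma beta_verts_parent_tree:
  "beta_verts (parent_tree p) = {v \<in> legs. \<exists>k l. fst (\<phi> v) = ZBeta k l}"
proof -
  have "(case fst (\<phi> v) of ZBeta _ _ \<Rightarrow> Beta | _ \<Rightarrow> Alpha) = Beta \<longleftrightarrow> (\<exists>k l. fst (\<phi> v) = ZBeta k l)"
    for v
    by (simp split: zvar.split)
  then show ?thesis by (auto simp: beta_verts_def legs_def)
qed

lemma fibre_nonempty: "i \<in> factors \<gamma> \<Longrightarrow> fibre i \<noteq> {}"
  by (erule fibre_cases) simp_all

lemma fibre_beta_legs: "i \<in> factors \<gamma> \<Longrightarrow> fst i = ZBeta k l \<Longrightarrow> fibre i \<subseteq> legs \<and> card (fibre i) = 2"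
  by (erule fibre_cases) simp_all

lemma exotic_parent_tree:
  assumes p: "p \<in> tree_parents"
  shows "exotic_tree (parent_tree p)"
  unfolding exotic_tree_def
proof (intro conjI ballI)
  have pW: "p v \<in> W" if "v \<in> legs" for v
    using p that parent_in_W by (simp add: tree_parents_def)
  show "rooted_tree (verts (parent_tree p)) (rootv (parent_tree p)) (edges (parent_tree p))"
    unfolding rooted_tree_def parent_tree_sel
  proof (intro conjI allI ballI)
    show "parent_edges p \<subseteq> W \<times> W"
      using pW by (auto simp: parent_edges_def legs_def)
    show "(r, w) \<notin> parent_edges p" for w by (auto simp: parent_edges_def legs_def)
    show "\<exists>!w. (v, w) \<in> parent_edges p" if "v \<in> W - {r}" for v
      using that by (auto simp: parent_edges_def legs_def)
    show "(v, r) \<in> (parent_edges p)\<^sup>*" if "v \<in> W" for v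
      using p that by (simp add: tree_parents_def)
  qed (use finW rW in auto)
  show "partition_on (beta_verts (parent_tree p)) (vpairs (parent_tree p))"
    unfolding beta_verts_parent_tree parent_tree_sel
  proof (rule partition_onI)
    show "\<Union>(fibre ` {i \<in> factors \<gamma>. \<exists>k l. fst i = ZBeta k l}) = {v \<in> legs. \<exists>k l. fst (\<phi> v) = ZBeta k l}"
    proof (intro set_eqI iffI)
      fix v assume "v \<in> \<Union>(fibre ` {i \<in> factors \<gamma>. \<exists>k l. fst i = ZBeta k l})"
      then obtain i k l where i: "i \<in> factors \<gamma>" "fst i = ZBeta k l" "v \<in> fibre i" by blast
      then have "v \<in> legs" "\<phi> v = i" using fibre_beta_legs[OF i(1,2)] by (auto simp: fibre_def)
      then show "v \<in> {v \<in> legs. \<exists>k l. fst (\<phi> v) = ZBeta k l}" using i(2) by simp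
    next
      fix v assume v: "v \<in> {v \<in> legs. \<exists>k l. fst (\<phi> v) = ZBeta k l}"
      then have "\<phi> v \<in> factors \<gamma>" "v \<in> fibre (\<phi> v)" using img by (auto simp: legs_def fibre_def)
      with v show "v \<in> \<Union>(fibre ` {i \<in> factors \<gamma>. \<exists>k l. fst i = ZBeta k l})" by blast
    qed
    show "{} \<notin> fibre ` {i \<in> factors \<gamma>. \<exists>k l. fst i = ZBeta k l}"
      using fibre_nonempty by force
    show "disjnt B C" if "B \<in> fibre ` {i \<in> factors \<gamma>. \<exists>k l. fst i = ZBeta k l}"
      "C \<in> fibre ` {i \<in> factors \<gamma>. \<exists>k l. fst i = ZBeta k l}" "B \<noteq> C" for B C
      using that by (auto simp: fibre_def disjnt_def)
  qed
  show "card B = 2" if "B \<in> vpairs (parent_tree p)" for B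
    using that fibre_beta_legs unfolding parent_tree_sel by blast
qed

lemma vertex_blocks_parent_tree: "vertex_blocks (parent_tree p) = fibre ` factors \<gamma>"
proof -
  have "(\<lambda>v. {v}) ` alpha_verts (parent_tree p) = fibre ` {i \<in> factors \<gamma>. \<exists>n. fst i = ZAlpha n}"
    unfolding alpha_verts_parent_tree
  proof (intro set_eqI iffI)
    fix B assume "B \<in> (\<lambda>v. {v}) ` {v \<in> legs. \<exists>n. fst (\<phi> v) = ZAlpha n}"
    then obtain v n where v: "v \<in> legs" "fst (\<phi> v) = ZAlpha n" "B = {v}" by blast
    have i: "\<phi> v \<in> factors \<gamma>" "v \<in> fibre (\<phi> v)" using v(1) img by (auto simp: legs_def fibre_def)
    from i(1) have "fibre (\<phi> v) = {v}"
      by (cases rule: fibre_cases) (use v(2) i(2) in simp_all)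
    then show "B \<in> fibre ` {i \<in> factors \<gamma>. \<exists>n. fst i = ZAlpha n}" using v i by blast
  next
    fix B assume "B \<in> fibre ` {i \<in> factors \<gamma>. \<exists>n. fst i = ZAlpha n}"
    then obtain i n where i: "i \<in> factors \<gamma>" "fst i = ZAlpha n" "B = fibre i" by blast
    from i(1) obtain v where v: "fibre i = {v}" "v \<in> legs"
      by (cases rule: fibre_cases) (use i(2) in simp_all)
    then have "\<phi> v = i" by (auto simp: fibre_def)
    then show "B \<in> (\<lambda>v. {v}) ` {v \<in> legs. \<exists>n. fst (\<phi> v) = ZAlpha n}" using i v by blast
  qed
  note alpha = this
  have root: "{r} = fibre (root_factor \<gamma>)"
    using root_iff rW by (auto simp: fibre_def)
  have split: "factors \<gamma> = insert (root_factor \<gamma>) ({i \<in> factors \<gamma>. \<exists>n. fst i = ZAlpha n} \<union>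
      {i \<in> factors \<gamma>. \<exists>k l. fst i = ZBeta k l})"
  proof (intro set_eqI iffI)
    fix i assume i: "i \<in> factors \<gamma>"
    from i show "i \<in> insert (root_factor \<gamma>) ({i \<in> factors \<gamma>. \<exists>n. fst i = ZAlpha n} \<union>
      {i \<in> factors \<gamma>. \<exists>k l. fst i = ZBeta k l})"
      by (cases rule: fibre_cases) (use i in simp_all)
  qed (use root_in_factors[OF feynman] in auto)
  have "vertex_blocks (parent_tree p) = fibre ` insert (root_factor \<gamma>)
      ({i \<in> factors \<gamma>. \<exists>n. fst i = ZAlpha n} \<union> {i \<in> factors \<gamma>. \<exists>k l. fst i = ZBeta k l})"
    unfolding vertex_blocks_def time_blocks_def parent_tree_sel alpha image_insert image_Un root ..
  also have "\<dots> = fibre ` factors \<gamma>"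
    by (rule arg_cong[OF split[symmetric]])
  finally show ?thesis .
qed

lemma n_children_parent_tree:
  assumes "p \<in> parent_maps W legs b" "w \<in> W"
  shows "n_children (parent_tree p) w = b w"
proof -
  have "{u. (u, w) \<in> edges (parent_tree p)} = {v \<in> legs. p v = w}"
    by (auto simp: parent_edges_def)
  then show ?thesis using assms by (simp add: n_children_def parent_maps_def)
qed

lemma vertex_label_parent_tree:
  assumes "p \<in> parent_maps W legs b" "w \<in> W"
  shows "vertex_label (parent_tree p) w = leg_label \<phi> b w"
proof (cases "w = r")
  case True
  obtain m where "root_factor \<gamma> = (ZRoot m, 0)" using root_factor_feynman[OF feynman] .
  then show ?thesis
    using True phi_root n_children_parent_tree[OF assms] by (simp add: vertex_label_def leg_label_def)
next
  case False
  then have "fst (\<phi> w) \<noteq> ZRoot n" for n using phi_leg_not_root[of w] assms(2) by (simp add: legs_def)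
  then show ?thesis
    using False n_children_parent_tree[OF assms]
    by (simp add: vertex_label_def leg_label_def split: zvar.split)
qed

lemma inj_fibre: "inj_on fibre (factors \<gamma>)"
proof (rule inj_onI)
  fix i j assume ij: "i \<in> factors \<gamma>" "j \<in> factors \<gamma>" "fibre i = fibre j"
  obtain v where "v \<in> fibre i" using fibre_nonempty[OF ij(1)] by blast
  then show "i = j" using ij(3) by (auto simp: fibre_def)
qed

lemma the_block_type_fibre: "i \<in> factors \<gamma> \<Longrightarrow> the_block_type (leg_label \<phi> b) (fibre i) = fst i"
  using the_block_type_eq[OF types] by (simp add: fibre_def)

lemma Union_fibres: "\<Union>(fibre ` factors \<gamma>) = W"
  using img by (auto simp: fibre_def)

lemma block_type_cong:
  assumes "\<And>v. v \<in> a \<Longrightarrow> lab v = lab' v"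
  shows "block_type lab a z \<longleftrightarrow> block_type lab' a z"
  using block_type_transfer[of lab a z id lab'] block_type_transfer[of lab' a z id lab] assms
  by auto

lemma Psi_parent_tree:
  assumes p: "p \<in> tree_parents"
  shows "Psi (parent_tree p) = \<gamma>"
proof -
  have pm: "p \<in> parent_maps W legs b" using p by (simp add: tree_parents_def)
  have ty: "the_block_type (vertex_label (parent_tree p)) (fibre i) = fst i" if "i \<in> factors \<gamma>" for i
  proof (rule the_block_type_eq)
    have "vertex_label (parent_tree p) v = leg_label \<phi> b v" if "v \<in> fibre i" for v
      using that vertex_label_parent_tree[OF pm] by (simp add: fibre_def)
    then show "block_type (vertex_label (parent_tree p)) (fibre i) (fst i)"
      using types[OF that] block_type_cong[of "fibre i"] unfolding fibre_def[symmetric] by blast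
  qed
  have "Psi (parent_tree p) =
    (\<Sum>i\<in>factors \<gamma>. Poly_Mapping.single (the_block_type (vertex_label (parent_tree p)) (fibre i)) 1)"
    unfolding Psi_vertex_blocks(2)[OF exotic_parent_tree[OF p]] vertex_blocks_parent_tree
    by (subst sum.reindex[OF inj_fibre]) simp
  also have "\<dots> = \<gamma>" using ty sum_factors[of \<gamma>] by simp
  finally show ?thesis .
qed

end

section \<open>Labellings of a tree by the factors of a multi-index\<close>

lemma vpairs_by_label:
  assumes \<tau>: "exotic_tree \<tau>"
  shows "vpairs \<tau> = {a \<in> vertex_blocks \<tau>. \<exists>v\<in>a. \<exists>k. vertex_label \<tau> v = ZBeta k k}"
proof -
  have pt: "partition_on (beta_verts \<tau>) (vpairs \<tau>)"
    using \<tau> by (auto simp: exotic_tree_def)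
  have "\<exists>v\<in>a. \<exists>k. vertex_label \<tau> v = ZBeta k k" if a: "a \<in> vpairs \<tau>" for a
  proof -
    obtain v where v: "v \<in> a" using a partition_onD3[OF pt] by (metis ex_in_conv)
    then have "v \<in> beta_verts \<tau>" using a partition_onD1[OF pt] by blast
    then show ?thesis using v by (auto simp: vertex_label_def beta_verts_def)
  qed
  moreover have "vertex_label \<tau> v \<noteq> ZBeta k k" if "v \<in> alpha_verts \<tau> \<or> v = rootv \<tau>" for v k
    using that by (auto simp: vertex_label_def alpha_verts_def)
  ultimately show ?thesis
    unfolding vertex_blocks_def time_blocks_def by blast
qed

lemma card_blocks_of_type:
  assumes \<tau>: "exotic_tree \<tau>"
  shows "card {a \<in> vertex_blocks \<tau>. the_block_type (vertex_label \<tau>) a = z} = Poly_Mapping.lookup (Psi \<tau>) z"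
proof -
  have fin: "finite (vertex_blocks \<tau>)"
    using finite_time_blocks[OF \<tau>] by (simp add: vertex_blocks_def)
  have "Poly_Mapping.lookup (Psi \<tau>) z =
    (\<Sum>a\<in>vertex_blocks \<tau>. if the_block_type (vertex_label \<tau>) a = z then 1 else 0)"
    unfolding Psi_vertex_blocks(2)[OF \<tau>] lookup_sum lookup_single when_def ..
  also have "\<dots> = card {a \<in> vertex_blocks \<tau>. the_block_type (vertex_label \<tau>) a = z}"
    using fin by (simp add: sum.If_cases Collect_conj_eq Int_commute)
  finally show ?thesis by simp
qed

lemma edges_iso:
  assumes "exotic_tree \<tau>" "exotic_tree \<tau>'" "is_etree_iso f \<tau> \<tau>'"
  shows "edges \<tau>' = map_prod f f ` edges \<tau>"
proof -
  have surj: "f ` verts \<tau> = verts \<tau>'"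
    and e: "\<And>v w. v \<in> verts \<tau> \<Longrightarrow> w \<in> verts \<tau> \<Longrightarrow> (v, w) \<in> edges \<tau> \<longleftrightarrow> (f v, f w) \<in> edges \<tau>'"
    using assms(3) by (simp_all add: is_etree_iso_def bij_betw_def)
  show ?thesis
  proof (intro set_eqI iffI)
    fix x assume x: "x \<in> edges \<tau>'"
    then have "fst x \<in> f ` verts \<tau>" "snd x \<in> f ` verts \<tau>" using etree_edges[OF assms(2)] surj by auto
    then obtain v w where "v \<in> verts \<tau>" "w \<in> verts \<tau>" "x = (f v, f w)" by (metis imageE prod.collapse)
    then show "x \<in> map_prod f f ` edges \<tau>" using x e[of v w] by (metis image_eqI map_prod_simp)
  next
    fix x assume "x \<in> map_prod f f ` edges \<tau>"
    then obtain v w where "(v, w) \<in> edges \<tau>" "x = (f v, f w)" by auto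
    then show "x \<in> edges \<tau>'" using e[of v w] etree_edges[OF assms(1)] by auto
  qed
qed

lemma rtrancl_map_prod: "(u, x) \<in> E\<^sup>* \<Longrightarrow> (f u, f x) \<in> (map_prod f f ` E)\<^sup>*"
proof (induction rule: rtrancl_induct)
  case (step y z)
  have "(f y, f z) \<in> map_prod f f ` E" using step(2) by force
  with step(3) show ?case by (rule rtrancl.rtrancl_into_rtrancl)
qed simp

context leg_system begin

text \<open>The types of the blocks of \<open>\<tau>\<close> and of the fibres of \<open>\<phi>\<close> have the same multiplicities,
  because both add up to the multi-index.\<close>

lemma card_labellings:
  assumes \<tau>: "exotic_tree \<tau>" and Psi: "Psi \<tau> = \<gamma>"
  shows "card (block_isos (vertex_label \<tau>) (leg_label \<phi> b) (vertex_blocks \<tau>) (fibre ` factors \<gamma>)) =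
    (\<Prod>z\<in>Poly_Mapping.keys \<gamma>. fact (Poly_Mapping.lookup \<gamma> z) * self_isos z ^ Poly_Mapping.lookup \<gamma> z)"
proof -
  let ?ty = "the_block_type (vertex_label \<tau>)" and ?ty' = "the_block_type (leg_label \<phi> b)"
  have part: "partition_on (verts \<tau>) (vertex_blocks \<tau>)" by (rule partition_vertex_blocks[OF \<tau>])
  have count: "card {a \<in> vertex_blocks \<tau>. ?ty a = z} = Poly_Mapping.lookup \<gamma> z" for z
    using card_blocks_of_type[OF \<tau>] Psi by simp
  have finB: "finite (vertex_blocks \<tau>)"
    using finite_time_blocks[OF \<tau>] by (simp add: vertex_blocks_def)
  have "card (block_isos (vertex_label \<tau>) (leg_label \<phi> b) (vertex_blocks \<tau>) (fibre ` factors \<gamma>)) =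
    (\<Prod>z\<in>Poly_Mapping.keys \<gamma>. fact (card {a \<in> vertex_blocks \<tau>. ?ty a = z}) *
       self_isos z ^ card {a \<in> vertex_blocks \<tau>. ?ty a = z})"
  proof (rule card_block_isos[where ty' = ?ty'])
    show "finite (\<Union>(vertex_blocks \<tau>))" using etree_finite[OF \<tau>] partition_onD1[OF part] by simp
    show "?ty ` vertex_blocks \<tau> \<subseteq> Poly_Mapping.keys \<gamma>"
    proof (rule image_subsetI)
      fix a assume "a \<in> vertex_blocks \<tau>"
      then have "card {c \<in> vertex_blocks \<tau>. ?ty c = ?ty a} > 0"
        using finB by (auto simp: card_gt_0_iff)
      then show "?ty a \<in> Poly_Mapping.keys \<gamma>" by (simp add: count in_keys_iff)
    qed
    show "finite (\<Union>(fibre ` factors \<gamma>))" unfolding Union_fibres by (rule finW)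
    show "disjoint (fibre ` factors \<gamma>)" by (auto simp: disjoint_def fibre_def)
    show "card (block_isos (vertex_label \<tau>) (leg_label \<phi> b) {a} {q}) =
       (if ?ty' q = ?ty a then self_isos (?ty a) else 0)"
      if a: "a \<in> vertex_blocks \<tau>" and q: "q \<in> fibre ` factors \<gamma>" for a q
    proof -
      obtain i where i: "i \<in> factors \<gamma>" "q = fibre i" using q by blast
      have "block_type (leg_label \<phi> b) q (?ty' q)"
        unfolding i(2) the_block_type_fibre[OF i(1)] using types[OF i(1)] by (simp add: fibre_def)
      then show ?thesis by (rule card_block_isos_types[OF Psi_vertex_blocks(1)[OF \<tau> a]])
    qed
    fix z
    have "{q \<in> fibre ` factors \<gamma>. ?ty' q = z} = fibre ` {i \<in> factors \<gamma>. fst i = z}"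
      using the_block_type_fibre by force
    then have "card {q \<in> fibre ` factors \<gamma>. ?ty' q = z} = card {i \<in> factors \<gamma>. fst i = z}"
      using card_image[OF inj_on_subset[OF inj_fibre, of "{i \<in> factors \<gamma>. fst i = z}"]] by simp
    then show "card {q \<in> fibre ` factors \<gamma>. ?ty' q = z} = card {a \<in> vertex_blocks \<tau>. ?ty a = z}"
      by (simp add: count card_factors_of_type)
  qed (use finB partition_onD2[OF part] partition_onD3[OF part] finite_factors in simp_all)
  then show ?thesis by (simp add: count)
qed

lemma iso_parent_tree_is_labelling:
  assumes \<tau>: "exotic_tree \<tau>" and p: "p \<in> tree_parents"
  shows "etree_isos \<tau> (parent_tree p) \<subseteq>
    block_isos (vertex_label \<tau>) (leg_label \<phi> b) (vertex_blocks \<tau>) (fibre ` factors \<gamma>)"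
proof
  fix f assume "f \<in> etree_isos \<tau> (parent_tree p)"
  then have f: "f \<in> block_isos (vertex_label \<tau>) (vertex_label (parent_tree p)) (vertex_blocks \<tau>) (fibre ` factors \<gamma>)"
    using etree_isos_subset_block_isos[OF \<tau> exotic_parent_tree[OF p]] vertex_blocks_parent_tree by auto
  have pm: "p \<in> parent_maps W legs b" using p by (simp add: tree_parents_def)
  have img: "(`) f ` vertex_blocks \<tau> = fibre ` factors \<gamma>"
    using f by (simp add: block_isos_def)
  have fW: "f v \<in> W" if "v \<in> \<Union>(vertex_blocks \<tau>)" for v
  proof -
    obtain a where "a \<in> vertex_blocks \<tau>" "v \<in> a" using \<open>v \<in> \<Union>(vertex_blocks \<tau>)\<close> by blast
    then have "f ` a \<in> fibre ` factors \<gamma>" "f v \<in> f ` a" using img by blast+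
    then show ?thesis using Union_fibres by blast
  qed
  have lab: "\<forall>v\<in>\<Union>(vertex_blocks \<tau>). vertex_label (parent_tree p) (f v) = vertex_label \<tau> v"
    using f by (simp add: block_isos_def)
  have "leg_label \<phi> b (f v) = vertex_label \<tau> v" if "v \<in> \<Union>(vertex_blocks \<tau>)" for v
    using bspec[OF lab that] vertex_label_parent_tree[OF pm fW[OF that]] by simp
  then show "f \<in> block_isos (vertex_label \<tau>) (leg_label \<phi> b) (vertex_blocks \<tau>) (fibre ` factors \<gamma>)"
    using f by (intro block_isosI) (simp_all add: block_isos_def)
qed

text \<open>Transporting the parents of \<open>\<tau>\<close> along \<open>f\<close> makes \<open>W\<close> into a tree. The vertices then have
  the prescribed numbers of children because \<open>f\<close> preserves labels.\<close>

lemma labelling_is_iso_parent_tree: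
  assumes \<tau>: "exotic_tree \<tau>"
    and f: "f \<in> block_isos (vertex_label \<tau>) (leg_label \<phi> b) (vertex_blocks \<tau>) (fibre ` factors \<gamma>)"
  obtains p where "p \<in> tree_parents" "f \<in> etree_isos \<tau> (parent_tree p)"
proof -
  let ?V = "verts \<tau>" and ?\<rho> = "rootv \<tau>"
  have UV: "\<Union>(vertex_blocks \<tau>) = ?V"
    using partition_onD1[OF partition_vertex_blocks[OF \<tau>]] by simp
  have ext: "f \<in> extensional ?V" and inj: "inj_on f ?V"
    and img: "(`) f ` vertex_blocks \<tau> = fibre ` factors \<gamma>"
    and lab: "\<And>v. v \<in> ?V \<Longrightarrow> leg_label \<phi> b (f v) = vertex_label \<tau> v"
    using f by (simp_all add: block_isos_def UV)
  have fV: "f ` ?V = W"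
    using arg_cong[OF img, of Union] unfolding Union_fibres image_Union[symmetric] UV .
  have bij: "bij_betw f ?V W" using inj fV by (simp add: bij_betw_def)
  have fW: "f v \<in> W" if "v \<in> ?V" for v using fV that by blast
  have root: "f ?\<rho> = r"
  proof (rule ccontr)
    assume "f ?\<rho> \<noteq> r"
    then have "f ?\<rho> \<in> legs" using fW[OF etree_root[OF \<tau>]] by (simp add: legs_def)
    from phi_leg_not_root[OF this] lab[OF etree_root[OF \<tau>]] show False
      by (auto simp: leg_label_def vertex_label_def split: zvar.splits)
  qed
  have legs: "f ` (?V - {?\<rho>}) = legs"
    using inj_on_image_set_diff[OF inj, of ?V "{?\<rho>}"] etree_root[OF \<tau>] fV root by (simp add: legs_def)
  have fleg: "f v \<in> legs" if "v \<in> ?V" "v \<noteq> ?\<rho>" for v using legs that by blast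
  have col: "(case fst (\<phi> (f v)) of ZBeta _ _ \<Rightarrow> Beta | _ \<Rightarrow> Alpha) = vcol \<tau> v"
    if "v \<in> ?V" "v \<noteq> ?\<rho>" for v
    using lab[OF that(1)] that(2) phi_leg_not_root[OF fleg[OF that]]
    by (auto simp: leg_label_def vertex_label_def split: zvar.splits colour.splits)
  have nch: "n_children \<tau> v = b (f v)" if "v \<in> ?V" for v
    using lab[OF that] by (auto simp: leg_label_def vertex_label_def split: zvar.splits colour.splits if_splits)
  have rt: "rooted_tree ?V ?\<rho> (edges \<tau>)" using \<tau> by (simp add: exotic_tree_def)
  obtain q where q: "q \<in> ?V - {?\<rho>} \<rightarrow> ?V" "edges \<tau> = (\<lambda>v. (v, q v)) ` (?V - {?\<rho>})"
    using rooted_tree_parent[OF rt] .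
  \<comment> \<open>the parent of \<open>w\<close> is found by going back to \<open>\<tau>\<close>\<close>
  define p where "p = (\<lambda>w\<in>legs. f (q (the_inv_into ?V f w)))"
  have pf: "p (f v) = f (q v)" if "v \<in> ?V - {?\<rho>}" for v
    using that fleg[of v] the_inv_into_f_f[OF inj, of v] by (simp add: p_def)
  have pe: "parent_edges p = map_prod f f ` edges \<tau>"
  proof -
    have "parent_edges p = (\<lambda>v. (f v, p (f v))) ` (?V - {?\<rho>})"
      unfolding parent_edges_def legs[symmetric] by (simp add: image_image)
    also have "\<dots> = (\<lambda>v. (f v, f (q v))) ` (?V - {?\<rho>})"
      by (rule image_cong[OF refl]) (simp only: pf)
    finally show ?thesis by (simp add: q(2) image_image)
  qed
  have edge: "(v, w) \<in> edges \<tau> \<longleftrightarrow> (f v, f w) \<in> parent_edges p" if "v \<in> ?V" "w \<in> ?V" for v w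
  proof
    assume "(f v, f w) \<in> parent_edges p"
    then obtain v' w' where e: "(v', w') \<in> edges \<tau>" "f v = f v'" "f w = f w'" unfolding pe by auto
    then have "v' \<in> ?V" "w' \<in> ?V" using etree_edges[OF \<tau>] by auto
    then have "v = v'" "w = w'" using inj_onD[OF inj] e that by metis+
    then show "(v, w) \<in> edges \<tau>" using e by simp
  qed (force simp: pe)
  have pW: "p w \<in> W" if w: "w \<in> legs" for w
  proof -
    obtain v where v: "v \<in> ?V - {?\<rho>}" "w = f v" using legs w by blast
    then have "q v \<in> ?V" using q(1) by auto
    then show ?thesis using pf[OF v(1)] v(2) fW by simp
  qed
  have deg: "card {v \<in> legs. p v = w} = b w" if w: "w \<in> W" for w
  proof -
    obtain u where u: "u \<in> ?V" "w = f u" using fV w by blast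
    have "{v \<in> legs. p v = w} = f ` {v. (v, u) \<in> edges \<tau>}"
    proof (intro set_eqI iffI)
      fix x assume x: "x \<in> {v \<in> legs. p v = w}"
      then obtain v where v: "v \<in> ?V - {?\<rho>}" "x = f v" using legs by blast
      have "(f v, f u) \<in> parent_edges p" using x v u(2) by (auto simp: parent_edges_def)
      then have "(v, u) \<in> edges \<tau>" using edge[of v u] v u by simp
      then show "x \<in> f ` {v. (v, u) \<in> edges \<tau>}" using v by blast
    next
      fix x assume "x \<in> f ` {v. (v, u) \<in> edges \<tau>}"
      then obtain v where v: "(v, u) \<in> edges \<tau>" "x = f v" by blast
      then have "v \<in> ?V" using etree_edges[OF \<tau>] by auto
      then have "(x, w) \<in> parent_edges p" using edge[of v u] v u by simp
      then show "x \<in> {v \<in> legs. p v = w}" by (auto simp: parent_edges_def)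
    qed
    moreover have "inj_on f {v. (v, u) \<in> edges \<tau>}"
      by (rule inj_on_subset[OF inj]) (use etree_edges[OF \<tau>] in auto)
    ultimately have "card {v \<in> legs. p v = w} = n_children \<tau> u"
      by (simp add: card_image n_children_def)
    then show ?thesis using nch[OF u(1)] u(2) by simp
  qed
  have reach: "(w, r) \<in> (parent_edges p)\<^sup>*" if w: "w \<in> W" for w
  proof -
    obtain u where u: "u \<in> ?V" "w = f u" using fV w by blast
    then have "(u, ?\<rho>) \<in> (edges \<tau>)\<^sup>*" using rt by (simp add: rooted_tree_def)
    from rtrancl_map_prod[OF this, of f] show ?thesis using u(2) root pe by simp
  qed
  have pm: "p \<in> parent_maps W legs b"
    unfolding parent_maps_def using pW deg by (auto simp: p_def)
  then have ptree: "p \<in> tree_parents" using reach by (simp add: tree_parents_def)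
  have beta_fibre: "fibre ` {i \<in> factors \<gamma>. \<exists>k l. fst i = ZBeta k l} =
    {a \<in> fibre ` factors \<gamma>. \<exists>v\<in>a. \<exists>k. leg_label \<phi> b v = ZBeta k k}"
  proof -
    have "(\<exists>k. leg_label \<phi> b v = ZBeta k k) \<longleftrightarrow> (\<exists>k l. fst i = ZBeta k l)" if "v \<in> fibre i" for v i
      using that by (auto simp: fibre_def leg_label_def split: zvar.splits)
    then show ?thesis using fibre_nonempty by blast
  qed
  have pairs: "(`) f ` vpairs \<tau> = vpairs (parent_tree p)"
  proof -
    have "(\<exists>v\<in>f ` a. \<exists>k. leg_label \<phi> b v = ZBeta k k) \<longleftrightarrow> (\<exists>v\<in>a. \<exists>k. vertex_label \<tau> v = ZBeta k k)"
      if a: "a \<in> vertex_blocks \<tau>" for a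
    proof -
      have "leg_label \<phi> b (f v) = vertex_label \<tau> v" if "v \<in> a" for v
        by (rule lab) (use that a UV in blast)
      then show ?thesis by simp
    qed
    then show ?thesis
      unfolding vpairs_by_label[OF \<tau>] parent_tree_sel beta_fibre img[symmetric] by blast
  qed
  have "is_etree_iso f \<tau> (parent_tree p)"
    unfolding is_etree_iso_def parent_tree_sel(1-3,5)
    using bij root edge col pairs by auto
  then show ?thesis using that[OF ptree] ext by (simp add: etree_isos_def)
qed

text \<open>The edges of \<open>parent_tree p\<close> are the images of the edges of \<open>\<tau>\<close>, so \<open>f\<close> determines \<open>p\<close>.\<close>

lemma etree_isos_disjoint:
  assumes \<tau>: "exotic_tree \<tau>" and p: "p \<in> tree_parents" "p' \<in> tree_parents"
    and f: "f \<in> etree_isos \<tau> (parent_tree p)" "f \<in> etree_isos \<tau> (parent_tree p')"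
  shows "p = p'"
proof -
  have "parent_edges p = parent_edges p'"
    using edges_iso[OF \<tau> exotic_parent_tree[OF p(1)], of f] edges_iso[OF \<tau> exotic_parent_tree[OF p(2)], of f] f
    by (simp add: etree_isos_def)
  then have "p v = p' v" if "v \<in> legs" for v
    using that unfolding parent_edges_def by blast
  moreover have "p \<in> extensional legs" "p' \<in> extensional legs"
    using p by (simp_all add: tree_parents_def parent_maps_def PiE_def)
  ultimately show ?thesis by (intro extensionalityI)
qed

text \<open>A double count of the labellings of \<open>\<tau>\<close>: directly, and according to the parent map that
  each of them induces, where every parent map that occurs is induced by \<open>sigma_e \<tau>\<close> labellings.\<close>

lemma card_parents_times_sigma_e:
  assumes \<tau>: "exotic_tree \<tau>" and Psi: "Psi \<tau> = \<gamma>"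
  shows "card {p \<in> tree_parents. \<exists>f. is_etree_iso f \<tau> (parent_tree p)} * sigma_e \<tau> =
    (\<Prod>z\<in>Poly_Mapping.keys \<gamma>. fact (Poly_Mapping.lookup \<gamma> z) * self_isos z ^ Poly_Mapping.lookup \<gamma> z)"
proof -
  let ?B = "block_isos (vertex_label \<tau>) (leg_label \<phi> b) (vertex_blocks \<tau>) (fibre ` factors \<gamma>)"
  have fB: "finite ?B"
  proof (rule finite_block_isos)
    show "finite (\<Union>(vertex_blocks \<tau>))"
      using etree_finite[OF \<tau>] partition_onD1[OF partition_vertex_blocks[OF \<tau>]] by simp
    show "finite (\<Union>(fibre ` factors \<gamma>))" unfolding Union_fibres by (rule finW)
  qed
  have sub: "etree_isos \<tau> (parent_tree p) \<subseteq> ?B" if "p \<in> tree_parents" for p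
    by (rule iso_parent_tree_is_labelling[OF \<tau> that])
  have "?B = (\<Union>p\<in>tree_parents. etree_isos \<tau> (parent_tree p))"
  proof
    show "?B \<subseteq> (\<Union>p\<in>tree_parents. etree_isos \<tau> (parent_tree p))"
    proof
      fix f assume "f \<in> ?B"
      then obtain p where "p \<in> tree_parents" "f \<in> etree_isos \<tau> (parent_tree p)"
        using labelling_is_iso_parent_tree[OF \<tau>] by blast
      then show "f \<in> (\<Union>p\<in>tree_parents. etree_isos \<tau> (parent_tree p))" by blast
    qed
  qed (use sub in blast)
  then have "card ?B = (\<Sum>p\<in>tree_parents. card (etree_isos \<tau> (parent_tree p)))"
    using etree_isos_disjoint[OF \<tau>] finite_subset[OF sub fB]
    by (simp only:) (rule card_UN_disjoint[OF finite_tree_parents], blast+)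
  also have "\<dots> = (\<Sum>p\<in>{p \<in> tree_parents. \<exists>f. is_etree_iso f \<tau> (parent_tree p)}. sigma_e \<tau>)"
  proof (rule sum.mono_neutral_cong_right[OF finite_tree_parents])
    show "\<forall>p\<in>tree_parents - {p \<in> tree_parents. \<exists>f. is_etree_iso f \<tau> (parent_tree p)}.
        card (etree_isos \<tau> (parent_tree p)) = 0"
      using etree_isos_nonempty[OF \<tau>] by (metis (no_types, lifting) DiffE card.empty mem_Collect_eq)
    show "card (etree_isos \<tau> (parent_tree p)) = sigma_e \<tau>"
      if "p \<in> {p \<in> tree_parents. \<exists>f. is_etree_iso f \<tau> (parent_tree p)}" for p
      using that card_etree_isos[OF \<tau> exotic_parent_tree[of p]] by blast
  qed blast
  finally show ?thesis using card_labellings[OF \<tau> Psi] by simp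
qed

definition parent_integral :: "real \<Rightarrow> real \<Rightarrow> (nat \<Rightarrow> nat) \<Rightarrow> real" where
  "parent_integral T t p = set_lebesgue_integral (\<Pi>\<^sub>M i\<in>inner_factors \<gamma>. lborel)
     (\<Pi>\<^sub>E i\<in>inner_factors \<gamma>. {0..T}) (\<lambda>s. edge_weight (parent_edges p) \<phi> (s(root_factor \<gamma> := t)))"

lemma Pi_e_eq_parent_integral:
  assumes \<tau>: "exotic_tree \<tau>" and p: "p \<in> tree_parents" and f: "is_etree_iso f \<tau> (parent_tree p)"
  shows "Pi_e T t \<tau> = parent_integral T t p"
proof -
  have bij: "bij_betw f (verts \<tau>) W" and root: "f (rootv \<tau>) = r" using f by (simp_all add: is_etree_iso_def)
  note inj = bij_betw_imp_inj_on[OF bij]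
  have legs: "f ` (verts \<tau> - {rootv \<tau>}) = legs"
    using inj_on_image_set_diff[OF inj, of "verts \<tau>" "{rootv \<tau>}"] etree_root[OF \<tau>]
      bij_betw_imp_surj_on[OF bij] root by (simp add: legs_def)
  obtain g where g: "g \<in> etree_isos \<tau> (parent_tree p)" "\<And>v. v \<in> verts \<tau> \<Longrightarrow> g v = f v"
  proof
    show "restrict f (verts \<tau>) \<in> etree_isos \<tau> (parent_tree p)"
      using is_etree_iso_cong[OF \<tau> f, of "restrict f (verts \<tau>)"] by (simp add: etree_isos_def)
  qed simp
  have gB: "(`) g ` vertex_blocks \<tau> = fibre ` factors \<gamma>"
    using subsetD[OF iso_parent_tree_is_labelling[OF \<tau> p] g(1)] by (simp add: block_isos_def)
  have "Pi_e T t \<tau> = set_lebesgue_integral (\<Pi>\<^sub>M i\<in>inner_factors \<gamma>. lborel)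
     (\<Pi>\<^sub>E i\<in>inner_factors \<gamma>. {0..T}) (\<lambda>s. edge_weight (edges \<tau>) (\<phi> \<circ> f) (s(root_factor \<gamma> := t)))"
  proof (rule Pi_e_reindex[OF \<tau>])
    show "(\<phi> \<circ> f) (rootv \<tau>) = root_factor \<gamma>" by (simp add: root phi_root)
    show "root_factor \<gamma> \<notin> inner_factors \<gamma>" by (simp add: inner_factors_def)
    show "(\<phi> \<circ> f) ` (verts \<tau> - {rootv \<tau>}) = inner_factors \<gamma>"
      unfolding image_comp[symmetric] legs phi_legs ..
    fix B v w assume B: "B \<in> time_blocks \<tau>" and v: "v \<in> B" and w: "w \<in> verts \<tau> - {rootv \<tau>}"
    have BV: "B \<subseteq> verts \<tau>" using partition_onD1[OF partition_time_blocks[OF \<tau>]] B by blast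
    have "B \<in> vertex_blocks \<tau>" using B by (simp add: vertex_blocks_def)
    then have "g ` B \<in> fibre ` factors \<gamma>" unfolding gB[symmetric] by (rule imageI)
    moreover have "g ` B = f ` B" using g(2) BV by (intro image_cong) auto
    ultimately obtain i where i: "f ` B = fibre i" by auto
    have "f v \<in> fibre i" using i v by blast
    then have "\<phi> (f v) = i" by (simp add: fibre_def)
    moreover have "f w \<in> W" using w bij_betw_imp_surj_on[OF bij] by blast
    ultimately have "\<phi> (f w) = \<phi> (f v) \<longleftrightarrow> f w \<in> f ` B" by (simp add: i fibre_def)
    also have "\<dots> \<longleftrightarrow> w \<in> B" using inj_on_image_mem_iff[OF inj _ BV] w by simp
    finally show "(\<phi> \<circ> f) w = (\<phi> \<circ> f) v \<longleftrightarrow> w \<in> B" by simp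
  qed
  moreover have "edge_weight (edges \<tau>) (\<phi> \<circ> f) s = edge_weight (parent_edges p) \<phi> s" for s
  proof -
    have "parent_edges p = map_prod f f ` edges \<tau>"
      using edges_iso[OF \<tau> exotic_parent_tree[OF p] f] by simp
    moreover have "inj_on (map_prod f f) (edges \<tau>)"
      by (rule inj_on_subset[OF map_prod_inj_on[OF inj inj] etree_edges[OF \<tau>]])
    ultimately show ?thesis
      unfolding edge_weight_def by (simp add: prod.reindex split_def)
  qed
  ultimately show ?thesis by (simp add: parent_integral_def)
qed

end

section \<open>The two realizations\<close>

lemma poly_var_power: "poly_var v ^ k = Poly_Mapping.single (Poly_Mapping.single v k) 1"
  by (induction k) (simp_all add: poly_var_def mult_single single_add[symmetric])

lemma prod_monomials:
  "finite A \<Longrightarrow> (\<Prod>i\<in>A. Poly_Mapping.single (e i) (1::real)) = Poly_Mapping.single (\<Sum>i\<in>A. e i) 1"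
  by (induction A rule: finite_induct) (simp_all add: mult_single)

text \<open>Since the Heaviside function vanishes at \<open>0\<close>, contractions within one factor have
  weight \<open>0\<close>, and the condition \<open>i \<noteq> j\<close> can be dropped.\<close>

lemma contraction_op_eq:
  "contraction_op \<gamma> s = pair_contraction (factors \<gamma>) (inner_factors \<gamma>) (\<lambda>i j. heaviside (s i - s j))"
proof
  fix p
  have "finite (inner_factors \<gamma>)" using finite_factors by (simp add: inner_factors_def)
  then show "contraction_op \<gamma> s p =
      pair_contraction (factors \<gamma>) (inner_factors \<gamma>) (\<lambda>i j. heaviside (s i - s j)) p"
    unfolding contraction_op_def pair_contraction_def
    by (intro sum.cong[OF refl] sum.mono_neutral_left) (auto simp: heaviside_def poly_const_def)
qed

text \<open>The number of ways to distribute the children of the vertices of a factor over its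
  variables \<open>x\<close>, once it is fixed which children each vertex has.\<close>

fun child_orders :: "zvar \<Rightarrow> nat" where
  "child_orders (ZRoot n) = fact n"
| "child_orders (ZAlpha n) = fact n"
| "child_orders (ZBeta k l) = fact k * fact l"

text \<open>The symmetry factor, sorted by variables: permutations of equal factors, exchanges in
  pairs, and orders of children. The factorial of the exponent of the root variable is \<open>1\<close>.\<close>

lemma sigma_F_eq:
  assumes \<gamma>: "\<gamma> \<in> feynman_mi"
  shows "sigma_F \<gamma> = (\<Prod>z\<in>Poly_Mapping.keys \<gamma>. fact (Poly_Mapping.lookup \<gamma> z) *
    self_isos z ^ Poly_Mapping.lookup \<gamma> z * child_orders z ^ Poly_Mapping.lookup \<gamma> z)"
proof -
  let ?l = "Poly_Mapping.lookup \<gamma>"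
  define F where "F z = fact (?l z) * self_isos z ^ ?l z * child_orders z ^ ?l z" for z
  \<comment> \<open>a common bound for all indices that occur, so that the sums and products over a whole type
      become ones over \<open>{..N}\<close>\<close>
  define N where "N = (\<Sum>z\<in>Poly_Mapping.keys \<gamma>. case z of ZRoot n \<Rightarrow> n | ZAlpha n \<Rightarrow> n | ZBeta k l \<Rightarrow> k + l)"
  have N: "(case z of ZRoot n \<Rightarrow> n | ZAlpha n \<Rightarrow> n | ZBeta k l \<Rightarrow> k + l) \<le> N" if "?l z \<noteq> 0" for z
    unfolding N_def using that by (intro member_le_sum) (simp_all add: in_keys_iff)
  have NR: "n \<le> N" if "?l (ZRoot n) \<noteq> 0" for n using N[OF that] by simp
  have NA: "n \<le> N" if "?l (ZAlpha n) \<noteq> 0" for n using N[OF that] by simp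
  have NB: "k \<le> N \<and> l \<le> N" if "?l (ZBeta k l) \<noteq> 0" for k l using N[OF that] by simp
  let ?B = "\<lambda>k. ZBeta (fst k) (snd k)"
  have sub: "Poly_Mapping.keys \<gamma> \<subseteq> ZRoot ` {..N} \<union> (ZAlpha ` {..N} \<union> ?B ` ({..N} \<times> {..N}))"
  proof
    fix z assume "z \<in> Poly_Mapping.keys \<gamma>"
    then have nz: "?l z \<noteq> 0" by (simp add: in_keys_iff)
    show "z \<in> ZRoot ` {..N} \<union> (ZAlpha ` {..N} \<union> ?B ` ({..N} \<times> {..N}))"
    proof (cases z)
      case (ZRoot n)
      then show ?thesis using NR[of n] nz by simp
    next
      case (ZAlpha n)
      then show ?thesis using NA[of n] nz by simp
    next
      case (ZBeta k l)
      then have "(k, l) \<in> {..N} \<times> {..N}" using NB[of k l] nz by simp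
      then have "?B (k, l) \<in> ?B ` ({..N} \<times> {..N})" by (rule imageI)
      then show ?thesis using ZBeta by simp
    qed
  qed
  have "(\<Prod>z\<in>Poly_Mapping.keys \<gamma>. F z) =
      (\<Prod>z\<in>ZRoot ` {..N} \<union> (ZAlpha ` {..N} \<union> ?B ` ({..N} \<times> {..N})). F z)"
    by (rule prod.mono_neutral_left) (use sub in \<open>auto simp: F_def in_keys_iff\<close>)
  also have "\<dots> = (\<Prod>z\<in>ZRoot ` {..N}. F z) * ((\<Prod>z\<in>ZAlpha ` {..N}. F z) * (\<Prod>z\<in>?B ` ({..N} \<times> {..N}). F z))"
  proof -
    have "ZRoot ` {..N} \<inter> (ZAlpha ` {..N} \<union> ?B ` ({..N} \<times> {..N})) = {}"
      "ZAlpha ` {..N} \<inter> ?B ` ({..N} \<times> {..N}) = {}" by auto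
    then show ?thesis by (simp add: prod.union_disjoint)
  qed
  also have "(\<Prod>z\<in>ZRoot ` {..N}. F z) = (\<Prod>n\<le>N. fact n ^ ?l (ZRoot n))"
  proof -
    obtain m where "\<And>n. ?l (ZRoot n) = (if n = m then 1 else 0)" using root_factor_feynman[OF \<gamma>] by blast
    then have "fact (?l (ZRoot n)) = (1::nat)" for n by simp
    then show ?thesis by (subst prod.reindex) (simp_all add: F_def inj_on_def)
  qed
  also have "(\<Prod>z\<in>ZAlpha ` {..N}. F z) = (\<Prod>n\<le>N. fact (?l (ZAlpha n)) * fact n ^ ?l (ZAlpha n))"
    by (subst prod.reindex) (simp_all add: F_def inj_on_def)
  also have "(\<Prod>z\<in>?B ` ({..N} \<times> {..N}). F z) = (\<Prod>k\<in>{..N} \<times> {..N}. F (?B k))"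
    by (subst prod.reindex) (simp_all add: inj_on_def prod_eq_iff)
  also have "\<dots> = (\<Prod>k\<in>{..N} \<times> {..N}. fact (?l (?B k)) * (fact (fst k) * fact (snd k)) ^ ?l (?B k)) *
      (\<Prod>k\<in>{..N} \<times> {..N}. self_isos (?B k) ^ ?l (?B k))"
    unfolding prod.distrib[symmetric] by (intro prod.cong refl) (simp add: F_def)
  also have "(\<Prod>k\<in>{..N} \<times> {..N}. self_isos (?B k) ^ ?l (?B k)) = 2 ^ (\<Sum>i\<le>N. ?l (ZBeta i i))"
  proof -
    have "(\<Prod>k\<in>{..N} \<times> {..N}. self_isos (?B k) ^ ?l (?B k)) =
        (\<Prod>k\<le>N. \<Prod>l\<le>N. self_isos (ZBeta k l) ^ ?l (ZBeta k l))"
      by (simp add: prod.cartesian_product split_def)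
    also have "\<dots> = (\<Prod>k\<le>N. \<Prod>l\<le>N. if l = k then 2 ^ ?l (ZBeta k k) else 1)"
      by (intro prod.cong refl) simp
    also have "\<dots> = (\<Prod>k\<le>N. 2 ^ ?l (ZBeta k k))"
      by (intro prod.cong refl) simp
    finally show ?thesis by (simp add: power_sum)
  qed
  finally have F: "(\<Prod>z\<in>Poly_Mapping.keys \<gamma>. F z) = (\<Prod>n\<le>N. fact n ^ ?l (ZRoot n)) *
     ((\<Prod>n\<le>N. fact (?l (ZAlpha n)) * fact n ^ ?l (ZAlpha n)) *
      ((\<Prod>k\<in>{..N} \<times> {..N}. fact (?l (?B k)) * (fact (fst k) * fact (snd k)) ^ ?l (?B k)) *
       2 ^ (\<Sum>i\<le>N. ?l (ZBeta i i))))" .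
  have 1: "Prod_any (\<lambda>n. fact (?l (ZAlpha n)) * fact n ^ (?l (ZAlpha n) + ?l (ZRoot n)) :: nat) =
      (\<Prod>n\<le>N. fact (?l (ZAlpha n)) * fact n ^ (?l (ZAlpha n) + ?l (ZRoot n)))"
  proof (rule Prod_any.expand_superset)
    show "{n. fact (?l (ZAlpha n)) * fact n ^ (?l (ZAlpha n) + ?l (ZRoot n)) \<noteq> (1::nat)} \<subseteq> {..N}"
    proof
      fix n assume "n \<in> {n. fact (?l (ZAlpha n)) * fact n ^ (?l (ZAlpha n) + ?l (ZRoot n)) \<noteq> (1::nat)}"
      then have "?l (ZAlpha n) \<noteq> 0 \<or> ?l (ZRoot n) \<noteq> 0" by (rule contrapos_pp) simp
      then show "n \<in> {..N}" using NA NR by auto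
    qed
  qed simp
  have 2: "Prod_any (\<lambda>k. fact (?l (?B k)) * (fact (fst k) * fact (snd k)) ^ ?l (?B k) :: nat) =
      (\<Prod>k\<in>{..N} \<times> {..N}. fact (?l (?B k)) * (fact (fst k) * fact (snd k)) ^ ?l (?B k))"
  proof (rule Prod_any.expand_superset)
    show "{k. fact (?l (?B k)) * (fact (fst k) * fact (snd k)) ^ ?l (?B k) \<noteq> (1::nat)} \<subseteq> {..N} \<times> {..N}"
    proof
      fix k assume "k \<in> {k. fact (?l (?B k)) * (fact (fst k) * fact (snd k)) ^ ?l (?B k) \<noteq> (1::nat)}"
      then have "?l (?B k) \<noteq> 0" by (rule contrapos_pp) simp
      then show "k \<in> {..N} \<times> {..N}" using NB[of "fst k" "snd k"] by (simp add: mem_Times_iff)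
    qed
  qed simp
  have 3: "Sum_any (\<lambda>i. ?l (ZBeta i i)) = (\<Sum>i\<le>N. ?l (ZBeta i i))"
    by (rule Sum_any.expand_superset) (use NB in auto)
  have "sigma_F \<gamma> = (\<Prod>z\<in>Poly_Mapping.keys \<gamma>. F z)"
    unfolding sigma_F_def fst_conv snd_conv 1 2 3
    unfolding F power_add prod.distrib by (simp add: mult_ac)
  then show ?thesis by (simp add: F_def)
qed

context leg_system begin

lemma finite_inner: "finite (inner_factors \<gamma>)"
  using finite_factors by (simp add: inner_factors_def)

lemma factor_poly_eq: "factor_poly \<gamma> = Poly_Mapping.single (leg_exponents \<phi> W legs b) 1"
proof -
  have "factor_poly \<gamma> = Poly_Mapping.single (\<Sum>i\<in>factors \<gamma>.
      Poly_Mapping.single (Y i) (y_exponent (fst i)) + Poly_Mapping.single (X i) (x_exponent (fst i))) 1"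
    unfolding factor_poly_def poly_var_power mult_single
    using prod_monomials[OF finite_factors] by simp
  also have "(\<Sum>i\<in>factors \<gamma>. Poly_Mapping.single (Y i) (y_exponent (fst i)) +
      Poly_Mapping.single (X i) (x_exponent (fst i))) = leg_exponents \<phi> W legs b"
  proof -
    have phi: "\<phi> v = i" if "v \<in> fibre i" for v i using that by (simp add: fibre_def)
    have "(\<Sum>v\<in>legs. Poly_Mapping.single (Y (\<phi> v)) 1) =
        (\<Sum>i\<in>factors \<gamma>. \<Sum>v\<in>{v \<in> legs. \<phi> v = i}. Poly_Mapping.single (Y (\<phi> v)) (1::nat))"
      by (rule sum.group[symmetric]) (use fin_legs finite_factors img in \<open>auto simp: legs_def\<close>)
    also have "\<dots> = (\<Sum>i\<in>factors \<gamma>. Poly_Mapping.single (Y i) (y_exponent (fst i)))"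
    proof (rule sum.cong[OF refl])
      fix i assume i: "i \<in> factors \<gamma>"
      have f: "{v \<in> legs. \<phi> v = i} = fibre i - {r}" by (auto simp: fibre_def legs_def)
      from i show "(\<Sum>v\<in>{v \<in> legs. \<phi> v = i}. Poly_Mapping.single (Y (\<phi> v)) (1::nat)) =
          Poly_Mapping.single (Y i) (y_exponent (fst i))"
        unfolding f
      proof (cases rule: fibre_cases)
        case (alpha v n)
        then have "fibre i - {r} = {v}" by (auto simp: legs_def)
        then show "(\<Sum>v\<in>fibre i - {r}. Poly_Mapping.single (Y (\<phi> v)) (1::nat)) =
            Poly_Mapping.single (Y i) (y_exponent (fst i))"
          using alpha phi[of v i] by simp
      next
        case (beta v w k l)
        then have "fibre i - {r} = {v, w}" by (auto simp: legs_def)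
        then show "(\<Sum>v\<in>fibre i - {r}. Poly_Mapping.single (Y (\<phi> v)) (1::nat)) =
            Poly_Mapping.single (Y i) (y_exponent (fst i))"
          using beta phi[of v i] phi[of w i] by (simp add: single_add[symmetric] numeral_2_eq_2)
      qed simp
    qed
    finally have Y: "(\<Sum>v\<in>legs. Poly_Mapping.single (Y (\<phi> v)) 1) =
        (\<Sum>i\<in>factors \<gamma>. Poly_Mapping.single (Y i) (y_exponent (fst i)))" .
    have "(\<Sum>w\<in>W. Poly_Mapping.single (X (\<phi> w)) (b w)) =
        (\<Sum>i\<in>factors \<gamma>. \<Sum>w\<in>fibre i. Poly_Mapping.single (X (\<phi> w)) (b w))"
      unfolding fibre_def by (rule sum.group[symmetric]) (use finW finite_factors img in auto)
    also have "\<dots> = (\<Sum>i\<in>factors \<gamma>. Poly_Mapping.single (X i) (x_exponent (fst i)))"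
    proof (rule sum.cong[OF refl])
      fix i assume i: "i \<in> factors \<gamma>"
      from i show "(\<Sum>w\<in>fibre i. Poly_Mapping.single (X (\<phi> w)) (b w)) = Poly_Mapping.single (X i) (x_exponent (fst i))"
      proof (cases rule: fibre_cases)
        case root
        then show ?thesis using phi[of r i] by simp
      next
        case (alpha v n)
        then show ?thesis using phi[of v i] by simp
      next
        case (beta v w k l)
        then show ?thesis using phi[of v i] phi[of w i] by (simp add: single_add)
      qed
    qed
    finally have X: "(\<Sum>w\<in>W. Poly_Mapping.single (X (\<phi> w)) (b w)) =
        (\<Sum>i\<in>factors \<gamma>. Poly_Mapping.single (X i) (x_exponent (fst i)))" .
    show ?thesis unfolding leg_exponents_def sum.distrib X Y ..
  qed
  finally show ?thesis .
qed

lemma wick_factor_poly: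
  "poly_eval (\<lambda>_. 0) (exp_op (contraction_op \<gamma> s) (factor_poly \<gamma>)) =
    (\<Prod>w\<in>W. fact (b w)) * (\<Sum>p\<in>parent_maps W legs b. edge_weight (parent_edges p) \<phi> s)"
proof -
  have "inj_on (\<lambda>v. (v, p v)) legs" for p :: "nat \<Rightarrow> nat" by (simp add: inj_on_def)
  then have "edge_weight (parent_edges p) \<phi> s = (\<Prod>v\<in>legs. heaviside (s (\<phi> (p v)) - s (\<phi> v)))" for p
    unfolding edge_weight_def parent_edges_def by (simp add: prod.reindex)
  then show ?thesis
    unfolding contraction_op_eq factor_poly_eq
    using finW fin_legs finite_factors finite_inner img phi_legs
    by (subst wick) simp_all
qed

text \<open>If the weight is not zero, then times increase strictly from each vertex to its
  parent. So among a vertex and its ancestors, the one with the latest time has no parent: it is the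
  root, and the parent map is acyclic.\<close>

lemma edge_weight_cyclic:
  assumes p: "p \<in> parent_maps W legs b" and cyc: "p \<notin> tree_parents"
  shows "edge_weight (parent_edges p) \<phi> s = 0"
proof (rule ccontr)
  assume nz: "edge_weight (parent_edges p) \<phi> s \<noteq> 0"
  let ?h = "\<lambda>v. s (\<phi> v)"
  have fin: "finite (parent_edges p)" using fin_legs by (simp add: parent_edges_def)
  have incr: "?h v < ?h (p v)" if "v \<in> legs" for v
  proof -
    have "(v, p v) \<in> parent_edges p" using that by (simp add: parent_edges_def)
    then have "heaviside (?h (p v) - ?h v) \<noteq> 0"
      using nz fin unfolding edge_weight_def by (auto simp: prod_zero_iff)
    then show ?thesis by (simp add: heaviside_def split: if_splits)
  qed
  have "(v, r) \<in> (parent_edges p)\<^sup>*" if v: "v \<in> W" for v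
  proof -
    define R where "R = {u \<in> W. (v, u) \<in> (parent_edges p)\<^sup>*}"
    have R: "finite (?h ` R)" "?h ` R \<noteq> {}" using finW v by (auto simp: R_def)
    from Max_in[OF R] obtain u where u: "Max (?h ` R) = ?h u" "u \<in> R" by (rule imageE)
    have "u = r"
    proof (rule ccontr)
      assume "u \<noteq> r"
      then have l: "u \<in> legs" using u(2) by (simp add: R_def legs_def)
      then have "(u, p u) \<in> parent_edges p" by (simp add: parent_edges_def)
      then have "p u \<in> R"
        using u(2) parent_in_W[OF p l] by (auto simp: R_def intro: rtrancl.rtrancl_into_rtrancl)
      then have "?h (p u) \<le> ?h u" unfolding u(1)[symmetric] by (intro Max_ge R(1) imageI)
      with incr[OF l] show False by simp
    qed
    then show ?thesis using u(2) by (simp add: R_def)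
  qed
  then show False using p cyc by (simp add: tree_parents_def)
qed

lemma Pi_mi_eq_sum_parent_integrals:
  "Pi_mi T t \<gamma> = (\<Prod>w\<in>W. fact (b w)) * (\<Sum>p\<in>tree_parents. parent_integral T t p)"
proof -
  let ?M = "\<Pi>\<^sub>M i\<in>inner_factors \<gamma>. (lborel :: real measure)"
  let ?A = "\<Pi>\<^sub>E i\<in>inner_factors \<gamma>. {0..T}"
  let ?g = "\<lambda>p s. edge_weight (parent_edges p) \<phi> (s(root_factor \<gamma> := t))"
  have "(\<Sum>p\<in>parent_maps W legs b. ?g p s) = (\<Sum>p\<in>tree_parents. ?g p s)" for s
    by (rule sum.mono_neutral_right[OF finite_parent_maps])
       (use edge_weight_cyclic in \<open>auto simp: tree_parents_def\<close>)
  then have "Pi_mi T t \<gamma> = set_lebesgue_integral ?M ?A (\<lambda>s. (\<Prod>w\<in>W. fact (b w)) * (\<Sum>p\<in>tree_parents. ?g p s))"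
    unfolding Pi_mi_def wick_factor_poly by simp
  also have "\<dots> = (\<Prod>w\<in>W. fact (b w)) * set_lebesgue_integral ?M ?A (\<lambda>s. \<Sum>p\<in>tree_parents. ?g p s)"
    by (rule set_integral_mult_right)
  also have "set_lebesgue_integral ?M ?A (\<lambda>s. \<Sum>p\<in>tree_parents. ?g p s) =
      (\<Sum>p\<in>tree_parents. set_lebesgue_integral ?M ?A (?g p))"
    unfolding set_lebesgue_integral_def scaleR_sum_right
  proof (rule Bochner_Integration.integral_sum)
    fix p assume p: "p \<in> tree_parents"
    then have "parent_edges p \<subseteq> W \<times> W"
      using etree_edges[OF exotic_parent_tree[OF p]] by simp
    moreover have "\<phi> ` W \<subseteq> insert (root_factor \<gamma>) (inner_factors \<gamma>)"
      by (auto simp: img inner_factors_def)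
    ultimately have "?g p \<in> borel_measurable ?M" by (rule measurable_edge_weight)
    then have "set_integrable ?M ?A (?g p)"
      by (rule box_integrable[OF finite_inner]) (rule abs_edge_weight_le)
    then show "integrable ?M (\<lambda>s. indicator ?A s *\<^sub>R ?g p s)" by (simp add: set_integrable_def)
  qed
  finally show ?thesis by (simp add: parent_integral_def)
qed

lemma prod_fact_children:
  "(\<Prod>w\<in>W. fact (b w)) = (\<Prod>z\<in>Poly_Mapping.keys \<gamma>. child_orders z ^ Poly_Mapping.lookup \<gamma> z)"
proof -
  have "(\<Prod>w\<in>W. fact (b w)) = (\<Prod>i\<in>factors \<gamma>. \<Prod>w\<in>fibre i. fact (b w) :: nat)"
    unfolding fibre_def by (rule prod.group[symmetric]) (use finW finite_factors img in auto)
  also have "\<dots> = (\<Prod>i\<in>factors \<gamma>. child_orders (fst i))"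
  proof (rule prod.cong[OF refl])
    fix i assume "i \<in> factors \<gamma>"
    then show "(\<Prod>w\<in>fibre i. fact (b w)) = child_orders (fst i)"
      by (cases rule: fibre_cases) simp_all
  qed
  also have "\<dots> = (\<Prod>z\<in>Poly_Mapping.keys \<gamma>. \<Prod>i\<in>{i \<in> factors \<gamma>. fst i = z}. child_orders (fst i))"
    by (rule prod.group[symmetric]) (use finite_factors in \<open>auto simp: factors_def in_keys_iff\<close>)
  also have "\<dots> = (\<Prod>z\<in>Poly_Mapping.keys \<gamma>. child_orders z ^ Poly_Mapping.lookup \<gamma> z)"
    by (intro prod.cong refl) (simp add: card_factors_of_type[symmetric])
  finally show ?thesis .
qed

text \<open>Sorting the acyclic parent maps by the isomorphism class of their tree turns the sum for
  \<open>Pi_mi\<close> into the one for \<open>Pi_e_lin\<close>.\<close>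

lemma realization_eq: "Pi_e_lin T t (Phi \<gamma>) = Pi_mi T t \<gamma>"
proof -
  define D where "D = {C \<in> etree_classes. Psi (class_rep C) = \<gamma>}"
  define cls where "cls p = etree_rel `` {parent_tree p}" for p
  define B where "B = (\<Prod>w\<in>W. fact (b w) :: nat)"
  note equiv = equiv_etree_rel
  have rep: "class_rep C \<in> C" "exotic_tree (class_rep C)" "C = etree_rel `` {class_rep C}"
    if "C \<in> etree_classes" for C
  proof -
    have C: "C \<in> {\<tau>. exotic_tree \<tau>} // etree_rel" using that by (simp add: etree_classes_def)
    then have "C \<noteq> {}" using in_quotient_imp_non_empty[OF equiv] by blast
    then show 1: "class_rep C \<in> C" unfolding class_rep_def by (simp add: some_in_eq)
    then show "exotic_tree (class_rep C)" using in_quotient_imp_subset[OF equiv C] by blast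
    show "C = etree_rel `` {class_rep C}"
      using C 1 equiv by (metis Image_singleton_iff equiv_class_eq quotientE)
  qed
  have cls_iff: "cls p = C \<longleftrightarrow> (\<exists>f. is_etree_iso f (class_rep C) (parent_tree p))"
    if "C \<in> etree_classes" "p \<in> tree_parents" for C p
  proof -
    have "cls p = C \<longleftrightarrow> (class_rep C, parent_tree p) \<in> etree_rel"
      unfolding cls_def using rep[OF that(1)] exotic_parent_tree[OF that(2)] equiv
      by (metis (no_types, lifting) Image_singleton_iff equiv_class_eq mem_Collect_eq equiv_class_self)
    then show ?thesis
      using rep(2)[OF that(1)] exotic_parent_tree[OF that(2)] by (simp add: etree_rel_def)
  qed
  have cls_in: "cls p \<in> etree_classes" if "p \<in> tree_parents" for p
    unfolding cls_def etree_classes_def using exotic_parent_tree[OF that] by (simp add: quotientI)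
  have key: "card {p \<in> tree_parents. cls p = C} * sigma_e (class_rep C) * B = sigma_F \<gamma>"
    if "C \<in> D" for C
  proof -
    have C: "C \<in> etree_classes" "Psi (class_rep C) = \<gamma>" using that by (simp_all add: D_def)
    have "{p \<in> tree_parents. cls p = C} =
        {p \<in> tree_parents. \<exists>f. is_etree_iso f (class_rep C) (parent_tree p)}"
      using cls_iff[OF C(1)] by blast
    then have "card {p \<in> tree_parents. cls p = C} * sigma_e (class_rep C) * B =
      (\<Prod>z\<in>Poly_Mapping.keys \<gamma>. fact (Poly_Mapping.lookup \<gamma> z) * self_isos z ^ Poly_Mapping.lookup \<gamma> z) * B"
      using card_parents_times_sigma_e[OF rep(2)[OF C(1)] C(2)] by simp
    also have "\<dots> = sigma_F \<gamma>"
      unfolding B_def prod_fact_children sigma_F_eq[OF feynman] prod.distrib[symmetric] ..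
    finally show ?thesis .
  qed
  have "cls p \<in> D" if p: "p \<in> tree_parents" for p
  proof -
    obtain f where "is_etree_iso f (class_rep (cls p)) (parent_tree p)"
      using cls_iff[OF cls_in[OF p] p] by blast
    from Psi_iso[OF rep(2)[OF cls_in[OF p]] exotic_parent_tree[OF p] this] show ?thesis
      using cls_in[OF p] Psi_parent_tree[OF p] by (simp add: D_def)
  qed
  moreover have "C \<in> cls ` tree_parents" if "C \<in> D" for C
  proof -
    \<comment> \<open>every class with the right multi-index contains some \<open>parent_tree p\<close>, for otherwise the count
        \<open>key\<close> would give \<open>sigma_F \<gamma> = 0\<close>\<close>
    have "sigma_F \<gamma> > 0"
      unfolding sigma_F_eq[OF feynman]
    proof (rule prod_pos)
      fix z
      show "0 < fact (Poly_Mapping.lookup \<gamma> z) * self_isos z ^ Poly_Mapping.lookup \<gamma> z *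
          child_orders z ^ Poly_Mapping.lookup \<gamma> z"
        by (cases z) simp_all
    qed
    then have "card {p \<in> tree_parents. cls p = C} > 0" using key[OF that] by (metis mult_is_0 neq0_conv)
    then have "{p \<in> tree_parents. cls p = C} \<noteq> {}" by fastforce
    then show ?thesis by blast
  qed
  ultimately have D: "D = cls ` tree_parents" by blast
  then have finD: "finite D" using finite_tree_parents by simp
  have Phi: "Poly_Mapping.lookup (Phi \<gamma>) C =
      (if C \<in> D then real (sigma_F \<gamma>) / real (sigma_e (class_rep C)) else 0)" for C
    unfolding Phi_def D_def[symmetric] lookup_sum lookup_single when_def
    using finD by (simp add: sum.delta)
  have "Pi_e_lin T t (Phi \<gamma>) = (\<Sum>C\<in>D. Poly_Mapping.lookup (Phi \<gamma>) C * Pi_e T t (class_rep C))"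
    unfolding Pi_e_lin_def
    by (rule sum.mono_neutral_left[OF finD]) (auto simp: in_keys_iff Phi split: if_splits)
  also have "\<dots> = (\<Sum>C\<in>D. real B * (\<Sum>p\<in>{p \<in> tree_parents. cls p = C}. parent_integral T t p))"
  proof (rule sum.cong[OF refl])
    fix C assume C: "C \<in> D"
    then have C': "C \<in> etree_classes" by (simp add: D_def)
    have "sigma_e (class_rep C) > 0" by (rule sigma_e_pos[OF rep(2)[OF C']])
    then have "real (sigma_F \<gamma>) / real (sigma_e (class_rep C)) = real (card {p \<in> tree_parents. cls p = C}) * real B"
      unfolding key[OF C, symmetric] by simp
    moreover have "(\<Sum>p\<in>{p \<in> tree_parents. cls p = C}. parent_integral T t p) =
        (\<Sum>p\<in>{p \<in> tree_parents. cls p = C}. Pi_e T t (class_rep C))"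
    proof (rule sum.cong[OF refl])
      fix p assume "p \<in> {p \<in> tree_parents. cls p = C}"
      then have p: "p \<in> tree_parents" "cls p = C" by simp_all
      then obtain f where "is_etree_iso f (class_rep C) (parent_tree p)" using cls_iff[OF C' p(1)] by blast
      from Pi_e_eq_parent_integral[OF rep(2)[OF C'] p(1) this]
      show "parent_integral T t p = Pi_e T t (class_rep C)" by simp
    qed
    ultimately show "Poly_Mapping.lookup (Phi \<gamma>) C * Pi_e T t (class_rep C) =
        real B * (\<Sum>p\<in>{p \<in> tree_parents. cls p = C}. parent_integral T t p)"
      using C by (simp add: Phi)
  qed
  also have "\<dots> = real B * (\<Sum>p\<in>tree_parents. parent_integral T t p)"
    unfolding sum_distrib_left[symmetric]
    by (subst sum.group) (use finite_tree_parents finD D in auto)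
  also have "\<dots> = Pi_mi T t \<gamma>"
    unfolding Pi_mi_eq_sum_parent_integrals B_def by simp
  finally show ?thesis .
qed

end

text \<open>The vertices are pairs of a factor and a number below its exponent of \<open>y\<close>, with one vertex
  for the root factor although its exponent is \<open>0\<close>; they are encoded as natural numbers.\<close>

lemma ex_leg_system:
  assumes \<gamma>: "\<gamma> \<in> feynman_mi"
  obtains W \<phi> b r where "leg_system \<gamma> W \<phi> b r"
proof -
  define V where "V = (SIGMA i:factors \<gamma>. {..<max 1 (y_exponent (fst i))})"
  define c :: "factor \<times> nat \<Rightarrow> nat" where "c = (\<lambda>(i, j). case fst i of ZRoot m \<Rightarrow> m | ZAlpha n \<Rightarrow> n
     | ZBeta k l \<Rightarrow> if j = 0 then k else l)"
  have "finite V" unfolding V_def using finite_factors by simp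
  then obtain enc :: "factor \<times> nat \<Rightarrow> nat" where enc: "inj_on enc V"
    using finite_imp_inj_to_nat_seg by blast
  define dec where "dec = the_inv_into V enc"
  have dec: "dec (enc x) = x" if "x \<in> V" for x
    unfolding dec_def by (rule the_inv_into_f_f[OF enc that])
  have root: "(root_factor \<gamma>, 0) \<in> V" using root_in_factors[OF \<gamma>] by (simp add: V_def)
  obtain m where m: "root_factor \<gamma> = (ZRoot m, 0)" using root_factor_feynman[OF \<gamma>] .
  have "leg_system \<gamma> (enc ` V) (fst \<circ> dec) (c \<circ> dec) (enc (root_factor \<gamma>, 0))"
  proof
    show "\<gamma> \<in> feynman_mi" by (rule \<gamma>)
    show "finite (enc ` V)" using \<open>finite V\<close> by simp
    show "enc (root_factor \<gamma>, 0) \<in> enc ` V" using root by simp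
    have "(fst \<circ> dec) ` enc ` V = fst ` V" unfolding image_image using dec by (intro image_cong) simp_all
    also have "\<dots> = factors \<gamma>"
    proof (intro set_eqI iffI)
      fix i assume "i \<in> factors \<gamma>"
      then have "(i, 0) \<in> V" by (simp add: V_def)
      then show "i \<in> fst ` V" by (intro image_eqI[of _ _ "(i, 0)"]) simp_all
    qed (auto simp: V_def)
    finally show "(fst \<circ> dec) ` enc ` V = factors \<gamma>" .
    show "(fst \<circ> dec) w = root_factor \<gamma> \<longleftrightarrow> w = enc (root_factor \<gamma>, 0)" if w: "w \<in> enc ` V" for w
    proof -
      obtain i j where x: "(i, j) \<in> V" "w = enc (i, j)" using w by auto
      have "i = root_factor \<gamma> \<longleftrightarrow> (i, j) = (root_factor \<gamma>, 0)"
        using x(1) by (auto simp: V_def m)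
      also have "\<dots> \<longleftrightarrow> w = enc (root_factor \<gamma>, 0)"
        using x root enc by (auto simp: inj_on_def)
      finally show ?thesis using dec[OF x(1)] x(2) by simp
    qed
    fix i assume i: "i \<in> factors \<gamma>"
    have fib: "{w \<in> enc ` V. (fst \<circ> dec) w = i} = enc ` ({i} \<times> {..<max 1 (y_exponent (fst i))})"
    proof (intro set_eqI iffI)
      fix w assume "w \<in> {w \<in> enc ` V. (fst \<circ> dec) w = i}"
      then obtain x where "x \<in> V" "w = enc x" "fst x = i" using dec by auto
      then show "w \<in> enc ` ({i} \<times> {..<max 1 (y_exponent (fst i))})" by (auto simp: V_def)
    next
      fix w assume "w \<in> enc ` ({i} \<times> {..<max 1 (y_exponent (fst i))})"
      then obtain j where "(i, j) \<in> V" "w = enc (i, j)" using i by (auto simp: V_def)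
      then show "w \<in> {w \<in> enc ` V. (fst \<circ> dec) w = i}" using dec by simp
    qed
    have d: "dec (enc (i, j)) = (i, j)" if "j < max 1 (y_exponent (fst i))" for j
      using dec[of "(i, j)"] i that by (simp add: V_def)
    show "block_type (leg_label (fst \<circ> dec) (c \<circ> dec)) {w \<in> enc ` V. (fst \<circ> dec) w = i} (fst i)"
    proof (cases "fst i")
      case (ZRoot n)
      then have "{i} \<times> {..<max 1 (y_exponent (fst i))} = {(i, 0)}" by auto
      moreover have "block_type (leg_label (fst \<circ> dec) (c \<circ> dec)) {enc (i, 0)} (ZRoot n)"
        by (rule block_type.root) (use ZRoot d[of 0] in \<open>simp add: leg_label_def c_def\<close>)
      ultimately show ?thesis unfolding fib using ZRoot by simp
    next
      case (ZAlpha n)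
      then have "{i} \<times> {..<max 1 (y_exponent (fst i))} = {(i, 0)}" by auto
      moreover have "block_type (leg_label (fst \<circ> dec) (c \<circ> dec)) {enc (i, 0)} (ZAlpha n)"
        by (rule block_type.alpha) (use ZAlpha d[of 0] in \<open>simp add: leg_label_def c_def\<close>)
      ultimately show ?thesis unfolding fib using ZAlpha by simp
    next
      case (ZBeta k l)
      \<comment> \<open>the type \<open>ZBeta k l\<close> of a block requires that the first vertex does not have more children\<close>
      have kl: "k \<le> l"
      proof -
        have "Poly_Mapping.lookup \<gamma> (ZBeta k l) \<noteq> 0" using i ZBeta by (auto simp: factors_def)
        then show ?thesis using \<gamma> by (simp add: feynman_mi_def)
      qed
      have "{i} \<times> {..<max 1 (y_exponent (fst i))} = {(i, 0), (i, 1)}" using ZBeta by auto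
      moreover have "block_type (leg_label (fst \<circ> dec) (c \<circ> dec)) {enc (i, 0), enc (i, 1)} (ZBeta k l)"
      proof (rule block_type.beta)
        have "(i, 0) \<in> V" "(i, 1) \<in> V" using i ZBeta by (simp_all add: V_def)
        then show "enc (i, 0) \<noteq> enc (i, 1)" using enc by (auto simp: inj_on_def)
      qed (use ZBeta d[of 0] d[of 1] kl in \<open>simp_all add: leg_label_def c_def\<close>)
      ultimately show ?thesis unfolding fib using ZBeta by simp
    qed
  qed
  then show ?thesis by (rule that)
qed

theorem theorem4p6:
  fixes T t :: real and \<gamma> :: multi_index
  assumes "T > 0" and "\<gamma> \<in> populated_mi" and "t \<in> {0..T}"
  shows "Pi_e_lin T t (Phi \<gamma>) = Pi_mi T t \<gamma>"
proof -
  have "\<gamma> \<in> feynman_mi" using assms(2) by (simp add: populated_mi_def)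
  then obtain W \<phi> b r where "leg_system \<gamma> W \<phi> b r" by (rule ex_leg_system)
  then interpret leg_system \<gamma> W \<phi> b r .
  show ?thesis by (rule realization_eq)
qed

end
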